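(* Let $f$ be an invariant of the factor analysis model $\mathbf{F}_{p,m}$, and let $\Psi$ be a positive definite $p\times p$ covariance matrix such that $f$ vanishes at $\Psi$ but its gradient vector $\nabla f$ does not vanish at $\Psi$. Let $X_1,X_2,\dots,X_N$ be independent random vectors distributed as $\mathcal{N}_p(\mu,\Psi)$, with $\mu\in\mathbb{R}^p$. Then, as the sample size $N$ tends to infinity, the standardized sample invariant $$Z_f=\frac{f(S)}{\sqrt{\operatorname{Var}_S[f(S)]}}$$ converges in distribution to the standard normal distribution $\mathcal{N}(0,1)$.
   Context: The parameter space of the model $\mathbf{F}_{p,m}$ is $F_{p,m}=\{\Sigma+\Lambda\Lambda^t\in\mathbb{R}^{p\times p} : \Sigma \text{ diagonal and positive definite},\ \Lambda\in\mathbb{R}^{p\times m}\}$. A polynomial $f$ with real coefficients in the entries $\psi_{ij}$, $1\le i\le j\le p$, of a symmetric $p\times p$-matrix $\Psi$ is an invariant of $\mathbf{F}_{p,m}$ if $f(\Psi)=0$ for all $\Psi\in F_{p,m}$. The gradient $\nabla f$ is taken with respect to the variables $\psi_{ij}$, $i\le j$. $\bar X=\frac1N\sum_{k=1}^N X_k$ is the sample mean, and $$S=\frac{1}{N-1}\sum_{k=1}^N (X_k-\bar X)(X_k-\bar X)^t$$ is the sample covariance matrix; $(N-1)S$ has a Wishart distribution. For each $N$, the variance of $f(S)$ when the true covariance matrix is $\Psi$, denoted $\operatorname{Var}_\Psi[f(S)]$, is a polynomial function of $\Psi$ (with coefficients depending on $N$). $\operatorname{Var}_S[f(S)]$ denotes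 the estimator obtained by replacing $\Psi$ by the sample covariance matrix $S$ in this polynomial. *)

theory Defs
  imports "HOL-Probability.Probability"
begin

text \<open>With these synonyms the sort of \<open>'p\<close> need not be repeated at every occurrence;
  the notation \<open>real ^ 'p\<close> always adds the constraint \<open>'p::finite\<close>.\<close>

type_synonym 'p rvec = "(real, 'p) vec"
type_synonym 'p rmat = "((real, 'p) vec, 'p) vec"


section \<open>Polynomials in the entries of a symmetric matrix\<close>

text \<open>The variables \<open>\<psi>\<^sub>i\<^sub>j\<close>, \<open>i \<le> j\<close>, are indexed by the type of pairs \<open>(i, j)\<close> with \<open>i \<le> j\<close>.
  A polynomial in these variables is a \<^const>\<open>real_polynomial_function\<close> on
  \<open>real ^ ('p upper)\<close>, so that its gradient consists of the partial derivatives with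
  respect to the \<open>\<psi>\<^sub>i\<^sub>j\<close>, \<open>i \<le> j\<close>, only.\<close>

typedef (overloaded) ('p::linorder) upper = "{(i :: 'p, j). i \<le> j}"
  by auto

instance upper :: ("{finite, linorder}") finite
proof
  have "inj (Rep_upper :: 'a upper \<Rightarrow> 'a \<times> 'a)"
    by (simp add: inj_def Rep_upper_inject)
  then show "finite (UNIV :: 'a upper set)"
    using finite_imageD[of "Rep_upper :: 'a upper \<Rightarrow> 'a \<times> 'a" UNIV] by simp
qed

definition upper_entries ::
    "('p::{finite, linorder}) rmat \<Rightarrow> 'p upper rvec" where
  "upper_entries A = (\<chi> ij. case Rep_upper ij of (i, j) \<Rightarrow> A $ i $ j)"

definition pos_def :: "('p::finite) rmat \<Rightarrow> bool" where
  "pos_def A \<longleftrightarrow> transpose A = A \<and> (\<forall>x. x \<noteq> 0 \<longrightarrow> x \<bullet> (A *v x) > 0)"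


section \<open>The factor analysis model\<close>

text \<open>The \<open>p \<times> m\<close> matrix \<open>\<Lambda>\<close> is given by its columns \<open>\<Lambda> 0, \<dots>, \<Lambda> (m - 1)\<close>, so that
  \<open>m\<close> is an arbitrary natural number; the sum below is the \<open>(i, j)\<close> entry of \<open>\<Lambda>\<Lambda>\<^sup>t\<close>.\<close>

definition factor_model :: "nat \<Rightarrow> ('p::finite) rmat set" where
  "factor_model m = {\<Sigma> + (\<chi> i j. \<Sum>k<m. \<Lambda> k $ i * \<Lambda> k $ j) | (\<Sigma> :: 'p rmat) (\<Lambda> :: nat \<Rightarrow> 'p rvec).
     (\<forall>i j. i \<noteq> j \<longrightarrow> \<Sigma> $ i $ j = 0) \<and> pos_def \<Sigma>}"

definition model_invariant ::
    "nat \<Rightarrow> (('p::{finite, linorder}) upper rvec \<Rightarrow> real) \<Rightarrow> bool" where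
  "model_invariant m f \<longleftrightarrow>
     real_polynomial_function f \<and> (\<forall>\<Psi> \<in> (factor_model m :: 'p rmat set). f (upper_entries \<Psi>) = 0)"


section \<open>Normal samples\<close>

definition multi_normal :: "('p::finite) rvec \<Rightarrow> 'p rmat \<Rightarrow> 'p rvec measure" where
  "multi_normal \<mu> \<Psi> = density lborel (\<lambda>x. ennreal
     (exp (- ((x - \<mu>) \<bullet> (matrix_inv \<Psi> *v (x - \<mu>))) / 2) / sqrt ((2 * pi) ^ CARD('p) * det \<Psi>)))"

definition sample_mean :: "nat \<Rightarrow> (nat \<Rightarrow> ('p::finite) rvec) \<Rightarrow> 'p rvec" where
  "sample_mean N x = (1 / real N) *\<^sub>R (\<Sum>k = 1..N. x k)"

definition sample_cov :: "nat \<Rightarrow> (nat \<Rightarrow> ('p::finite) rvec) \<Rightarrow> 'p rmat" where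
  "sample_cov N x = (1 / (real N - 1)) *\<^sub>R
     (\<Sum>k = 1..N. \<chi> i j. (x k - sample_mean N x) $ i * (x k - sample_mean N x) $ j)"

definition var_at ::
    "(('p::{finite, linorder}) upper rvec \<Rightarrow> real) \<Rightarrow> nat \<Rightarrow> 'p rvec \<Rightarrow> 'p rmat \<Rightarrow> real" where
  "var_at f N \<mu> \<Psi> = prob_space.variance (PiM {1..N} (\<lambda>_. multi_normal \<mu> \<Psi>))
     (\<lambda>x. f (upper_entries (sample_cov N x)))"

text \<open>The variance does not depend on \<open>\<mu>\<close> and is a polynomial in \<open>\<Psi>\<close>. Its values on the
  positive definite matrices determine the polynomial, which can then be evaluated at any
  symmetric matrix, including a singular sample covariance matrix.\<close>

definition var_poly ::
    "(('p::{finite, linorder}) upper rvec \<Rightarrow> real) \<Rightarrow> nat \<Rightarrow> 'p upper rvec \<Rightarrow> real" where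
  "var_poly f N = (THE q. real_polynomial_function q \<and>
     (\<forall>\<mu> \<Psi>. pos_def \<Psi> \<longrightarrow> q (upper_entries \<Psi>) = var_at f N \<mu> \<Psi>))"

definition standardized_invariant ::
    "(('p::{finite, linorder}) upper rvec \<Rightarrow> real) \<Rightarrow> nat \<Rightarrow> (nat \<Rightarrow> 'p rvec) \<Rightarrow> real" where
  "standardized_invariant f N x =
     f (upper_entries (sample_cov N x)) / sqrt (var_poly f N (upper_entries (sample_cov N x)))"

end

theory Submission
  imports Defs
begin

text \<open>Write \<open>n = N - 1\<close> and \<open>t = 1 / n\<close>. Gaussian integration by parts expresses the expectation of a monomial
  in the entries of \<open>S\<close> by those of monomials of lower degree, with coefficients polynomial in \<open>\<Psi>\<close> and \<open>t\<close>.
  Hence the mean of \<open>f(S)\<close> is \<open>f(\<Psi>) + t m(\<Psi>, t)\<close> and its variance is \<open>t V(\<Psi>, t)\<close> with polynomials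
  \<open>m\<close> and \<open>V\<close>, and \<open>V(\<Psi>, 0)\<close> is the variance of the quadratic form \<open>Q = \<nabla>f(\<Psi>) \<bullet> (X - \<mu>)(X - \<mu>)\<^sup>t\<close>, which is
  positive when \<open>\<nabla>f(\<Psi>) \<noteq> 0\<close>. So \<open>n Var\<^sub>S[f(S)] = V(S, t)\<close> tends to \<open>V(\<Psi>, 0)\<close> in probability.
  The same expansion, applied to \<open>f\<close> minus its linearisation at \<open>\<Psi>\<close> (a polynomial with vanishing
  gradient there), replaces Taylor's formula in the delta method: it shows in \<open>L\<^sup>2\<close> that \<open>f(S)\<close> may be
  replaced by the mean of the centred \<open>Q\<^sub>k\<close>, to which the central limit theorem applies. Slutsky's lemma
  concludes.\<close>

section \<open>Gaussian integration by parts\<close>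

text \<open>The denominator of Z_f decides the shape of the proof. Var_S[f(S)] evaluates at the
  random S the one polynomial that agrees with the variance on the positive definite matrices, so
  the variance at the true \<Psi> alone is not enough: it must be known as a polynomial in \<Psi>,
  with its dependence on N under control. Both are obtained by treating t as one more polynomial
  variable. A remainder of order t^k then means divisibility by t^k, and limits of moments reduce to
  continuity of a polynomial at (\<Psi>, 0). A second saving comes from writing a Wishart matrix as
  Y^t P Y / T with an orthogonal projection P of rank T: the recursion for the moments uses only P =
  P^t = P^2 and tr P = T. The correction between S and the mean of the single terms (X - \<mu>)(X -
  \<mu>)^t comes from such a matrix too, of rank 1, so its size is read off from the same
  formulas.\<close>

lemma std_normal_power_Suc:
  "(\<integral>x. x ^ Suc k \<partial>std_normal_distribution) = real k * (\<integral>x. x ^ (k - 1) \<partial>std_normal_distribution)"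
proof (cases "even k")
  case True
  \<comment> \<open>For \<open>k = 0\<close> the truncated \<open>k - 1\<close> is even, but the
    factor \<open>k\<close> annihilates the moment.\<close>
  then have "k = 0 \<or> odd (k - 1)" by auto
  then have "real k * (\<integral>x. x ^ (k - 1) \<partial>std_normal_distribution) = 0"
    using integral_std_normal_distribution_moment_odd by (metis mult_zero_left mult_zero_right of_nat_0)
  moreover have "(\<integral>x. x ^ Suc k \<partial>std_normal_distribution) = 0"
    using True by (intro integral_std_normal_distribution_moment_odd) simp
  ultimately show ?thesis by simp
next
  case False
  then obtain l where k: "k = 2 * l + 1" by (auto elim: oddE)
  then have "Suc k = 2 * Suc l" "k - 1 = 2 * l" by simp_all
  moreover have "fact (2 * Suc l) / (2 ^ Suc l * fact (Suc l)) = real k * (fact (2 * l) / (2 ^ l * fact l))"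
  proof -
    have "(fact (2 * Suc l) :: real) = 2 * real (Suc l) * (real k * fact (2 * l))"
      by (simp add: k algebra_simps)
    moreover have "(2 ^ Suc l * fact (Suc l) :: real) = 2 * real (Suc l) * (2 ^ l * fact l)"
      by simp
    moreover have "2 * real (Suc l) \<noteq> 0" by simp
    ultimately show ?thesis
      by (simp only: mult_divide_mult_cancel_left) simp
  qed
  ultimately show ?thesis
    by (simp only: std_normal_distribution_even_moments)
qed

text \<open>By linearity Stein's identity only has to hold for monomials, where it is the moment
  recursion above; boundary terms never appear.\<close>

lemma std_normal_stein:
  assumes p: "real_polynomial_function p" and p': "\<And>y. (p has_real_derivative p' y) (at y)"
  shows "(\<integral>y. y * p y \<partial>std_normal_distribution) = (\<integral>y. p' y \<partial>std_normal_distribution)"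
proof -
  obtain a n where pa: "p = (\<lambda>x. \<Sum>i\<le>n. a i * x ^ i)"
    using p by (auto simp: real_polynomial_function_iff_sum)
  have "(p has_real_derivative (\<Sum>i\<le>n. a i * (real i * y ^ (i - 1)))) (at y)" for y
    unfolding pa by (auto intro!: derivative_eq_intros sum.cong)
  then have p'a: "p' = (\<lambda>y. \<Sum>i\<le>n. a i * (real i * y ^ (i - 1)))"
    using p' DERIV_unique by blast
  have "(\<integral>y. y * p y \<partial>std_normal_distribution) = (\<integral>y. (\<Sum>i\<le>n. a i * y ^ Suc i) \<partial>std_normal_distribution)"
    by (simp add: pa sum_distrib_left ac_simps)
  also have "\<dots> = (\<Sum>i\<le>n. a i * (\<integral>y. y ^ Suc i \<partial>std_normal_distribution))"
    by (subst Bochner_Integration.integral_sum)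
       (auto intro!: integrable_mult_right integrable_std_normal_distribution_moment simp del: power_Suc)
  also have "\<dots> = (\<Sum>i\<le>n. (\<integral>y. a i * (real i * y ^ (i - 1)) \<partial>std_normal_distribution))"
    by (simp add: std_normal_power_Suc del: power_Suc)
  also have "\<dots> = (\<integral>y. p' y \<partial>std_normal_distribution)"
    unfolding p'a
    by (subst Bochner_Integration.integral_sum)
       (auto intro!: integrable_mult_right integrable_std_normal_distribution_moment)
  finally show ?thesis .
qed

text \<open>Product measures live on the function type \<open>'i \<Rightarrow> real\<close>, while
  \<open>real_polynomial_function\<close> asks for a normed space. The inductive form turns
  measurability, integrability and the passage to one variable into simple inductions.\<close>

inductive coord_poly :: "'i set \<Rightarrow> (('i \<Rightarrow> real) \<Rightarrow> real) \<Rightarrow> bool" for I where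
  const: "coord_poly I (\<lambda>z. c)"
| coord: "i \<in> I \<Longrightarrow> coord_poly I (\<lambda>z. z i)"
| add: "coord_poly I F \<Longrightarrow> coord_poly I G \<Longrightarrow> coord_poly I (\<lambda>z. F z + G z)"
| mult: "coord_poly I F \<Longrightarrow> coord_poly I G \<Longrightarrow> coord_poly I (\<lambda>z. F z * G z)"

lemma coord_poly_sum:
  "(\<And>j. j \<in> J \<Longrightarrow> coord_poly I (F j)) \<Longrightarrow> coord_poly I (\<lambda>z. \<Sum>j\<in>J. F j z)"
  by (induction J rule: infinite_finite_induct) (auto intro: coord_poly.intros)

lemma coord_poly_divide: "coord_poly I F \<Longrightarrow> coord_poly I (\<lambda>z. F z / c)"
  using coord_poly.mult[OF coord_poly.const[of I "inverse c"], of F] by (simp add: divide_inverse mult.commute)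

abbreviation std_normals :: "'i set \<Rightarrow> ('i \<Rightarrow> real) measure" where
  "std_normals I \<equiv> PiM I (\<lambda>_. std_normal_distribution)"

lemma prob_space_std_normal: "prob_space std_normal_distribution"
  by (simp add: prob_space_normal_density)

lemma prob_space_std_normals: "prob_space (std_normals I)"
  by (intro prob_space_PiM prob_space_std_normal)

lemma coord_poly_measurable: "coord_poly I F \<Longrightarrow> F \<in> borel_measurable (std_normals I)"
proof (induction rule: coord_poly.induct)
  case (coord i)
  have "(\<lambda>z. z i) \<in> measurable (std_normals I) std_normal_distribution"
    by (rule measurable_component_singleton) fact
  then show ?case by simp
qed auto

text \<open>All powers are treated at once because the product case needs twice the exponent: |F
  G|^k \<le> |F|^(2k) + |G|^(2k).\<close>

lemma coord_poly_integrable_power: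
  assumes "coord_poly I F"
  shows "integrable (std_normals I) (\<lambda>z. \<bar>F z\<bar> ^ k)"
proof -
  interpret prob_space "std_normals I" by (rule prob_space_std_normals)
  show ?thesis using assms
  proof (induction arbitrary: k rule: coord_poly.induct)
    case (coord i)
    have d: "distr (std_normals I) std_normal_distribution (\<lambda>z. z i) = std_normal_distribution"
      by (rule distr_PiM_component[OF prob_space_std_normal coord])
    have m: "(\<lambda>z. z i) \<in> measurable (std_normals I) std_normal_distribution"
      by (rule measurable_component_singleton) fact
    have "integrable std_normal_distribution (\<lambda>x. \<bar>x ^ k\<bar>)"
      using integrable_std_normal_distribution_moment[of k] by (rule integrable_abs)
    then have "integrable std_normal_distribution (\<lambda>x. \<bar>x\<bar> ^ k)"
      by (simp add: power_abs)
    then have "integrable (distr (std_normals I) std_normal_distribution (\<lambda>z. z i)) (\<lambda>x. \<bar>x\<bar> ^ k)"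
      by (simp add: d)
    then show ?case
      by (rule integrable_distr[OF m])
  next
    case (add F G)
    have [measurable]: "F \<in> borel_measurable (std_normals I)" "G \<in> borel_measurable (std_normals I)"
      using add by (auto intro: coord_poly_measurable)
    show ?case
    proof (rule Bochner_Integration.integrable_bound)
      show "integrable (std_normals I) (\<lambda>z. 2 ^ k * (\<bar>F z\<bar> ^ k + \<bar>G z\<bar> ^ k))"
        using add by auto
      have "\<bar>x + y\<bar> ^ k \<le> 2 ^ k * (\<bar>x\<bar> ^ k + \<bar>y\<bar> ^ k)" for x y :: real
      proof -
        have "\<bar>x + y\<bar> ^ k \<le> (2 * max \<bar>x\<bar> \<bar>y\<bar>) ^ k"
          by (intro power_mono) auto
        also have "\<dots> \<le> 2 ^ k * (\<bar>x\<bar> ^ k + \<bar>y\<bar> ^ k)"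
          by (auto simp: power_mult_distrib max_def)
        finally show ?thesis .
      qed
      then show "AE z in std_normals I. norm (\<bar>F z + G z\<bar> ^ k) \<le> norm (2 ^ k * (\<bar>F z\<bar> ^ k + \<bar>G z\<bar> ^ k))"
        by (auto simp: abs_mult)
    qed measurable
  next
    case (mult F G)
    have [measurable]: "F \<in> borel_measurable (std_normals I)" "G \<in> borel_measurable (std_normals I)"
      using mult by (auto intro: coord_poly_measurable)
    show ?case
    proof (rule Bochner_Integration.integrable_bound)
      show "integrable (std_normals I) (\<lambda>z. \<bar>F z\<bar> ^ (2 * k) + \<bar>G z\<bar> ^ (2 * k))"
        using mult by auto
      have "\<bar>x * y\<bar> ^ k \<le> \<bar>x\<bar> ^ (2 * k) + \<bar>y\<bar> ^ (2 * k)" for x y :: real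
      proof -
        have "a * b \<le> a\<^sup>2 + b\<^sup>2" for a b :: real
          using zero_le_power2[of "a - b"] zero_le_power2[of a] zero_le_power2[of b]
          unfolding power2_diff by linarith
        from this[of "\<bar>x\<bar> ^ k" "\<bar>y\<bar> ^ k"] show ?thesis
          by (simp add: abs_mult power_mult_distrib power_mult[symmetric] mult.commute)
      qed
      then show "AE z in std_normals I. norm (\<bar>F z * G z\<bar> ^ k) \<le> norm (\<bar>F z\<bar> ^ (2 * k) + \<bar>G z\<bar> ^ (2 * k))"
        by auto
    qed measurable
  qed auto
qed

lemma coord_poly_integrable:
  assumes "coord_poly I F"
  shows "integrable (std_normals I) F"
  using coord_poly_integrable_power[OF assms, of 1] coord_poly_measurable[OF assms]
  by (simp add: integrable_abs_iff)

lemma coord_poly_slice: "coord_poly I F \<Longrightarrow> real_polynomial_function (\<lambda>y. F (x(i := y)))"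
proof (induction rule: coord_poly.induct)
  case (coord j)
  then show ?case
    by (cases "i = j") (auto intro: real_polynomial_function.intros bounded_linear_ident)
qed (auto intro: real_polynomial_function.intros)

text \<open>Fubini with coordinate \<open>i\<close> innermost: for frozen other coordinates
  \<open>F\<close> is a polynomial in one variable, and the one-dimensional identity applies to
  it.\<close>

lemma std_normals_stein:
  assumes I: "finite I" "i \<in> I"
    and F: "coord_poly I F" and F': "coord_poly I F'"
    and der: "\<And>z. ((\<lambda>y. F (z(i := y))) has_real_derivative F' z) (at (z i))"
  shows "(\<integral>z. z i * F z \<partial>std_normals I) = (\<integral>z. F' z \<partial>std_normals I)"
proof -
  interpret product_sigma_finite "\<lambda>_::'a. std_normal_distribution"
    unfolding product_sigma_finite_def
    using prob_space_std_normal prob_space_imp_sigma_finite by blast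
  define J where "J = I - {i}"
  have J: "finite J" "i \<notin> J" "I = insert i J" using I by (auto simp: J_def)
  have 1: "(\<integral>z. G z \<partial>std_normals I) = (\<integral>x. (\<integral>y. G (x(i := y)) \<partial>std_normal_distribution) \<partial>std_normals J)"
    if "coord_poly I G" for G
    using product_integral_insert[OF J(1,2), of G] coord_poly_integrable[OF that] J(3) by simp
  have "(\<integral>y. y * F (x(i := y)) \<partial>std_normal_distribution) = (\<integral>y. F' (x(i := y)) \<partial>std_normal_distribution)" for x
  proof (rule std_normal_stein)
    show "real_polynomial_function (\<lambda>y. F (x(i := y)))" by (rule coord_poly_slice[OF F])
    show "((\<lambda>y. F (x(i := y))) has_real_derivative F' (x(i := y))) (at y)" for y
      using der[of "x(i := y)"] by simp
  qed
  then show ?thesis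
    using 1[OF coord_poly.mult[OF coord_poly.coord[OF I(2)] F]] 1[OF F'] by simp
qed

section \<open>The multivariate normal distribution as a linear image\<close>

text \<open>Gram-Schmidt for the inner product \<open>x \<bullet> (\<Psi> *v y)\<close>: fewer than
  p vectors do not span, and a vector outside their span, minus its projection to it, can be
  normalised and added.\<close>

lemma pos_def_orthonormal_set:
  fixes \<Psi> :: "('p::finite) rmat"
  assumes pd: "pos_def \<Psi>" and n: "n \<le> CARD('p)"
  shows "\<exists>S. finite S \<and> card S = n \<and> (\<forall>s\<in>S. \<forall>t\<in>S. s \<bullet> (\<Psi> *v t) = (if s = t then 1 else 0))"
  using n
proof (induction n)
  case 0
  show ?case by (intro exI[of _ "{}"]) auto
next
  case (Suc n)
  have sym: "x \<bullet> (\<Psi> *v y) = y \<bullet> (\<Psi> *v x)" for x y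
    using pd dot_lmul_matrix[of x \<Psi> y] vector_transpose_matrix[of x \<Psi>]
    by (simp add: pos_def_def inner_commute)
  obtain S where S: "finite S" "card S = n"
    and on: "\<And>s t. s \<in> S \<Longrightarrow> t \<in> S \<Longrightarrow> s \<bullet> (\<Psi> *v t) = (if s = t then 1 else 0)"
    using Suc by auto
  have "dim (span S) < CARD('p)"
    using dim_le_card[of "span S" S] S Suc.prems by (simp add: le_less_trans)
  then have "span S \<noteq> UNIV"
    by (metis DIM_cart DIM_real dim_UNIV mult.right_neutral nat_neq_iff)
  then obtain x where x: "x \<notin> span S" by auto
  define y where "y = x - (\<Sum>s\<in>S. (s \<bullet> (\<Psi> *v x)) *\<^sub>R s)"
  have "y \<noteq> 0"
    using x unfolding y_def by (metis (no_types, lifting) eq_iff_diff_eq_0 span_base span_scale span_sum)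
  have sy: "s \<bullet> (\<Psi> *v y) = 0" if "s \<in> S" for s
  proof -
    have "s \<bullet> (\<Psi> *v y) = s \<bullet> (\<Psi> *v x) - (\<Sum>t\<in>S. (t \<bullet> (\<Psi> *v x)) * (s \<bullet> (\<Psi> *v t)))"
      by (simp add: y_def matrix_vector_mult_diff_distrib inner_diff_right
         inner_sum_right linear_sum[OF matrix_vector_mul_linear] o_def matrix_vector_mult_scaleR)
    also have "(\<Sum>t\<in>S. (t \<bullet> (\<Psi> *v x)) * (s \<bullet> (\<Psi> *v t))) = (\<Sum>t\<in>S. if t = s then s \<bullet> (\<Psi> *v x) else 0)"
      using on that by (intro sum.cong) auto
    finally show ?thesis using S that by simp
  qed
  have py: "y \<bullet> (\<Psi> *v y) > 0" using pd \<open>y \<noteq> 0\<close> by (auto simp: pos_def_def)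
  define w where "w = (1 / sqrt (y \<bullet> (\<Psi> *v y))) *\<^sub>R y"
  have ww: "w \<bullet> (\<Psi> *v w) = 1"
    using py by (simp add: w_def matrix_vector_mult_scaleR)
  have sw: "s \<bullet> (\<Psi> *v w) = 0" "w \<bullet> (\<Psi> *v s) = 0" if "s \<in> S" for s
    using sy[OF that] sym[of w s] by (simp_all add: w_def matrix_vector_mult_scaleR)
  have "w \<notin> S" using ww sw by force
  then show ?case
    using S on ww sw by (intro exI[of _ "insert w S"]) auto
qed

text \<open>A \<Psi>-orthonormal basis, written as the columns of \<open>V\<close>, gives V^t \<Psi>
  V = 1. Hence \<Psi> V is inverse to V^t, and A = \<Psi> V satisfies A A^t = (\<Psi> V V^t) \<Psi>
  = \<Psi>.\<close>

lemma pos_def_factor: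
  fixes \<Psi> :: "('p::finite) rmat"
  assumes "pos_def \<Psi>"
  obtains A :: "'p rmat" where "A ** transpose A = \<Psi>" "invertible A"
proof -
  obtain S :: "'p rvec set" where S: "finite S" "card S = CARD('p)"
    and on: "\<And>s t. s \<in> S \<Longrightarrow> t \<in> S \<Longrightarrow> s \<bullet> (\<Psi> *v t) = (if s = t then 1 else 0)"
    using pos_def_orthonormal_set[OF assms order_refl] by blast
  obtain h :: "'p \<Rightarrow> 'p rvec" where h: "bij_betw h UNIV S"
    using finite_same_card_bij[of "UNIV :: 'p set" S] S by auto
  define V :: "'p rmat" where "V = (\<chi> i j. h j $ i)"
  have "(transpose V ** (\<Psi> ** V)) $ i $ j = (mat 1 :: 'p rmat) $ i $ j" for i j
  proof -
    have "(transpose V ** (\<Psi> ** V)) $ i $ j = h i \<bullet> (\<Psi> *v h j)"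
      by (simp add: matrix_matrix_mult_def transpose_def V_def inner_vec_def matrix_vector_mult_def)
    also have "\<dots> = (if i = j then 1 else 0)"
      using on[of "h i" "h j"] h by (auto simp: bij_betw_def inj_eq)
    finally show ?thesis by (simp add: mat_def)
  qed
  then have 1: "transpose V ** (\<Psi> ** V) = mat 1" by (simp add: vec_eq_iff)
  then have 2: "(\<Psi> ** V) ** transpose V = mat 1" by (simp add: matrix_left_right_inverse)
  have "(\<Psi> ** V) ** transpose (\<Psi> ** V) = ((\<Psi> ** V) ** transpose V) ** transpose \<Psi>"
    by (simp add: matrix_transpose_mul matrix_mul_assoc)
  also have "\<dots> = \<Psi>" using 2 assms by (simp add: pos_def_def)
  finally show ?thesis
    using 1 2 by (intro that[of "\<Psi> ** V"]) (auto simp: invertible_def)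
qed

section \<open>Lebesgue measure under linear maps\<close>

lemma measurable_vec_lambda:
  assumes [measurable]: "\<And>i::'p::finite. (\<lambda>z. f z i) \<in> borel_measurable M"
  shows "(\<lambda>z. (\<chi> i. f z i) :: 'p rvec) \<in> borel_measurable M"
proof -
  have "(\<lambda>z. (\<chi> i. f z i) :: 'p rvec) = (\<lambda>z. \<Sum>i\<in>UNIV. f z i *\<^sub>R axis i 1)"
    by (auto simp: vec_eq_iff axis_def if_distrib cong: if_cong)
  then show ?thesis by simp
qed

lemma Basis_vec_eq_axis: "(Basis :: ('p::finite) rvec set) = (\<lambda>i. axis i 1) ` UNIV"
  by (auto simp: Basis_vec_def)

lemma inj_axis_1: "inj (\<lambda>i::'p::finite. axis i (1::real))"
  by (auto simp: inj_def axis_eq_axis)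

lemma prod_Basis_vec: "prod g Basis = (\<Prod>i\<in>UNIV. g (axis (i::'p::finite) (1::real)))"
  unfolding Basis_vec_eq_axis by (simp add: prod.reindex[OF inj_axis_1])

lemma sum_Basis_vec: "sum g Basis = (\<Sum>i\<in>UNIV. g (axis (i::'p::finite) (1::real)))"
  unfolding Basis_vec_eq_axis by (simp add: sum.reindex[OF inj_axis_1])

lemma lborel_vec: "(lborel :: ('p::finite) rvec measure) = distr (PiM UNIV (\<lambda>_. lborel)) borel (\<lambda>z. \<chi> i. z i)"
proof (rule lborel_eqI)
  interpret L: product_sigma_finite "\<lambda>_::'p. lborel :: real measure" ..
  fix l u :: "'p rvec" assume lu: "\<And>b. b \<in> Basis \<Longrightarrow> l \<bullet> b \<le> u \<bullet> b"
  have le: "l $ i \<le> u $ i" for i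
    using lu[of "axis i 1"] by (simp add: Basis_vec_def inner_axis) blast
  have [measurable]: "(\<lambda>z. (\<chi> i. z i) :: 'p rvec) \<in> borel_measurable (PiM UNIV (\<lambda>_. lborel))"
    by (rule measurable_vec_lambda) measurable
  have "(\<lambda>z. (\<chi> i. z i) :: 'p rvec) -` box l u \<inter> space (PiM UNIV (\<lambda>_. lborel)) = Pi\<^sub>E UNIV (\<lambda>i. {l $ i <..< u $ i})"
    by (auto simp: mem_box_cart space_PiM PiE_def Pi_def)
  then have "emeasure (distr (PiM UNIV (\<lambda>_. lborel)) borel (\<lambda>z. (\<chi> i. z i) :: 'p rvec)) (box l u) = (\<Prod>i\<in>UNIV. ennreal (u $ i - l $ i))"
    using le by (simp add: emeasure_distr L.emeasure_PiM)
  also have "\<dots> = ennreal (\<Prod>i\<in>UNIV. u $ i - l $ i)"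
    using le by (intro prod_ennreal) auto
  also have "(\<Prod>i\<in>UNIV. u $ i - l $ i) = (\<Prod>b\<in>Basis. (u - l) \<bullet> b)"
    by (simp add: prod_Basis_vec inner_axis)
  finally show "emeasure (distr (PiM UNIV (\<lambda>_. lborel)) borel (\<lambda>z. (\<chi> i. z i) :: 'p rvec)) (box l u)
    = ennreal (\<Prod>b\<in>Basis. (u - l) \<bullet> b)" .
qed simp

lemma nn_integral_lborel_vec:
  assumes [measurable]: "f \<in> borel_measurable (borel :: ('p::finite) rvec measure)"
  shows "(\<integral>\<^sup>+x. f x \<partial>lborel) = (\<integral>\<^sup>+z. f (\<chi> i. z i) \<partial>PiM UNIV (\<lambda>_. lborel))"
proof -
  have [measurable]: "(\<lambda>z. (\<chi> i. z i) :: 'p rvec) \<in> borel_measurable (PiM UNIV (\<lambda>_. lborel))"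
    by (rule measurable_vec_lambda) measurable
  show ?thesis
    by (subst lborel_vec) (simp add: nn_integral_distr)
qed

text \<open>The change of variables theorems of the library need a well-ordered index type, so the linear
  case is derived here by elementary matrices.\<close>

lemma nn_integral_lborel_shear:
  fixes m n :: "'p::finite"
  assumes mn: "m \<noteq> n" and [measurable]: "f \<in> borel_measurable (borel :: 'p rvec measure)"
  shows "(\<integral>\<^sup>+x. f (\<chi> i. if i = m then x $ m + c * x $ n else x $ i) \<partial>lborel) = (\<integral>\<^sup>+x. f x \<partial>lborel)"
proof -
  interpret L: product_sigma_finite "\<lambda>_::'p. lborel :: real measure" ..
  have [measurable]: "(\<lambda>x. (\<chi> i. if i = m then x $ m + c * x $ n else x $ i) :: 'p rvec) \<in> borel_measurable borel"
    by (rule measurable_vec_lambda) measurable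
  let ?J = "UNIV - {m}"
  have [measurable]: "(\<lambda>z. (\<chi> i. z i) :: 'p rvec) \<in> borel_measurable (PiM UNIV (\<lambda>_. lborel))"
    by (rule measurable_vec_lambda) measurable
  have ins: "insert m ?J = UNIV" by auto
  have 1: "(\<integral>\<^sup>+x. g x \<partial>lborel) = (\<integral>\<^sup>+x. (\<integral>\<^sup>+y. g (\<chi> i. (x(m := y)) i) \<partial>lborel) \<partial>PiM ?J (\<lambda>_. lborel))"
    if [measurable]: "g \<in> borel_measurable borel" for g :: "'p rvec \<Rightarrow> ennreal"
    using L.product_nn_integral_insert[of ?J m "\<lambda>z. g (\<chi> i. z i)", unfolded ins] by (simp add: nn_integral_lborel_vec)
  have "(\<integral>\<^sup>+y. f (\<chi> i. if i = m then (x(m := y)) m + c * (x(m := y)) n else (x(m := y)) i) \<partial>lborel)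
      = (\<integral>\<^sup>+y. f (\<chi> i. (x(m := y)) i) \<partial>lborel)" for x :: "'p \<Rightarrow> real"
  proof -
    have [measurable]: "(\<lambda>y. (\<chi> i. (x(m := y)) i) :: 'p rvec) \<in> borel_measurable borel"
    proof (rule measurable_vec_lambda)
      show "(\<lambda>y. (x(m := y)) i) \<in> borel_measurable borel" for i by (cases "i = m") auto
    qed
    \<comment> \<open>With \<open>x\<close> frozen and \<open>n\<close> different from
      \<open>m\<close>, the shear only translates the coordinate \<open>y\<close> by
      \<open>c * x n\<close>.\<close>
    have "(\<integral>\<^sup>+y. f (\<chi> i. (x(m := y)) i) \<partial>lborel) = (\<integral>\<^sup>+y. f (\<chi> i. (x(m := y)) i) \<partial>distr lborel borel ((+) (c * x n)))"
      by (simp only: lborel_distr_plus)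
    also have "\<dots> = (\<integral>\<^sup>+y. f (\<chi> i. (x(m := c * x n + y)) i) \<partial>lborel)"
      by (subst nn_integral_distr) auto
    also have "\<dots> = (\<integral>\<^sup>+y. f (\<chi> i. if i = m then (x(m := y)) m + c * (x(m := y)) n else (x(m := y)) i) \<partial>lborel)"
      using mn by (intro nn_integral_cong arg_cong[of _ _ f]) (auto simp: vec_eq_iff)
    finally show ?thesis ..
  qed
  note shear = this
  have "(\<integral>\<^sup>+x. f (\<chi> i. if i = m then x $ m + c * x $ n else x $ i) \<partial>lborel)
    = (\<integral>\<^sup>+x. (\<integral>\<^sup>+y. f (\<chi> i. if i = m then (\<chi> i. (x(m := y)) i) $ m + c * (\<chi> i. (x(m := y)) i) $ n
        else (\<chi> i. (x(m := y)) i) $ i) \<partial>lborel) \<partial>PiM ?J (\<lambda>_. lborel))"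
    by (rule 1) measurable
  also have "\<dots> = (\<integral>\<^sup>+x. (\<integral>\<^sup>+y. f (\<chi> i. (x(m := y)) i) \<partial>lborel) \<partial>PiM ?J (\<lambda>_. lborel))"
    by (simp only: vec_lambda_beta shear)
  also have "\<dots> = (\<integral>\<^sup>+x. f x \<partial>lborel)"
    by (rule 1[symmetric]) measurable
  finally show ?thesis .
qed

text \<open>Letting \<open>f\<close> vary is what makes the claim multiplicative: for
  \<open>A ** B\<close> it is used for \<open>A\<close> with \<open>f\<close> and for
  \<open>B\<close> with \<open>f\<close> composed with \<open>A\<close>. A zero row is excluded by
  the determinant; the other elementary matrices are coordinate scalings, swaps, which permute the
  sides of boxes, and shears.\<close>

lemma nn_integral_lborel_matrix:
  fixes A :: "('p::finite) rmat"
  assumes "det A \<noteq> 0" "f \<in> borel_measurable borel"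
  shows "ennreal \<bar>det A\<bar> * (\<integral>\<^sup>+x. f (A *v x) \<partial>lborel) = (\<integral>\<^sup>+x. f x \<partial>lborel)"
  using assms
proof (induction A arbitrary: f rule: induct_matrix_elementary[case_names mult zero_row diagonal swap1 idplus])
  case (mult A B)
  have [measurable]: "(\<lambda>x. f (A *v x)) \<in> borel_measurable borel"
    using mult.prems(2)
    by (intro measurable_compose[OF _ mult.prems(2)] borel_measurable_continuous_onI matrix_vector_mult_linear_continuous_on)
  have "det A \<noteq> 0" "det B \<noteq> 0" using mult.prems(1) by (auto simp: det_mul)
  then show ?case
    using mult.IH(1)[OF _ mult.prems(2)] mult.IH(2)[of "\<lambda>x. f (A *v x)"]
    by (simp add: det_mul abs_mult ennreal_mult' matrix_vector_mul_assoc[symmetric] mult.assoc)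
next
  case (zero_row A i)
  then show ?case using det_zero_row by blast
next
  case (diagonal A)
  have d: "det A = (\<Prod>i\<in>UNIV. A $ i $ i)" by (rule det_diagonal) (use diagonal.hyps in auto)
  \<comment> \<open>The scaling factors of \<open>lborel_affine_euclidean\<close> are indexed by
    basis vectors; on \<open>axis i 1\<close> this quadratic form returns the diagonal
    entry.\<close>
  define c where "c b = (b::'p rvec) \<bullet> (A *v b)" for b
  have Aax: "A *v axis i 1 = A $ i $ i *\<^sub>R axis i 1" for i
    unfolding matrix_vector_mult_basis using diagonal.hyps by (auto simp: vec_eq_iff column_def axis_def)
  have cax: "c (axis i 1) = A $ i $ i" for i
    by (simp add: c_def Aax inner_axis_axis)
  have T: "A *v x = 0 + (\<Sum>j\<in>Basis. (c j * (x \<bullet> j)) *\<^sub>R j)" for x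
  proof -
    have "(\<Sum>j\<in>UNIV. A $ i $ j * x $ j) = A $ i $ i * x $ i" for i
    proof -
      have "(\<Sum>j\<in>UNIV. A $ i $ j * x $ j) = (\<Sum>j\<in>UNIV. if j = i then A $ i $ i * x $ i else 0)"
        using diagonal.hyps by (intro sum.cong) auto
      then show ?thesis by simp
    qed
    moreover have "(\<Sum>j\<in>Basis. (c j * (x \<bullet> j)) *\<^sub>R j) = (\<Sum>j\<in>UNIV. (A $ j $ j * x $ j) *\<^sub>R axis j 1)"
      by (simp add: sum_Basis_vec cax inner_axis)
    ultimately show ?thesis
      by (simp add: vec_eq_iff matrix_vector_mult_def axis_def if_distrib cong: if_cong)
  qed
  have cp: "(\<Prod>j\<in>Basis. \<bar>c j\<bar>) = \<bar>det A\<bar>"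
    by (simp add: prod_Basis_vec cax d abs_prod)
  have nz: "c j \<noteq> 0" if "j \<in> Basis" for j
    using that diagonal.prems(1) unfolding d Basis_vec_eq_axis by (auto simp: cax)
  have eq: "lborel = density (distr lborel borel ((*v) A)) (\<lambda>_. ennreal \<bar>det A\<bar>)"
    using lborel_affine_euclidean[of c 0, OF nz] unfolding T[symmetric] cp by (simp add: T[symmetric] cong: distr_cong)
  have [measurable]: "(*v) A \<in> borel_measurable borel"
    by (intro borel_measurable_continuous_onI matrix_vector_mult_linear_continuous_on)
  note diagonal.prems(2)[measurable]
  show ?case
    by (subst (2) eq) (simp add: nn_integral_density nn_integral_distr nn_integral_cmult)
next
  case (swap1 m n)
  let ?\<tau> = "Transposition.transpose m n" and ?P = "(\<chi> i j. mat 1 $ i $ Transposition.transpose m n j) :: 'p rmat"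
  have Px: "?P *v x = (\<chi> i. x $ ?\<tau> i)" for x
  proof -
    have "(\<Sum>j\<in>UNIV. (mat 1 :: 'p rmat) $ i $ ?\<tau> j * x $ j) = x $ ?\<tau> i" for i
    proof -
      have "(\<Sum>j\<in>UNIV. (mat 1 :: 'p rmat) $ i $ ?\<tau> j * x $ j) = (\<Sum>j\<in>UNIV. if j = ?\<tau> i then x $ j else 0)"
        by (intro sum.cong) (auto simp: mat_def transpose_eq_iff)
      then show ?thesis by simp
    qed
    then show ?thesis by (simp add: vec_eq_iff matrix_vector_mult_def)
  qed
  have [measurable]: "(*v) ?P \<in> borel_measurable borel"
    by (intro borel_measurable_continuous_onI matrix_vector_mult_linear_continuous_on)
  have eq: "lborel = distr lborel borel ((*v) ?P)"
  proof (rule lborel_eqI)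
    fix l u :: "'p rvec" assume lu: "\<And>b. b \<in> Basis \<Longrightarrow> l \<bullet> b \<le> u \<bullet> b"
    have le: "l $ i \<le> u $ i" for i using lu[of "axis i 1"] by (simp add: Basis_vec_eq_axis inner_axis)
    have "(*v) ?P -` box l u = box (\<chi> i. l $ ?\<tau> i) (\<chi> i. u $ ?\<tau> i)"
      unfolding vimage_def Px by (auto simp: mem_box_cart) (metis transpose_involutory)+
    then have "emeasure (distr lborel borel ((*v) ?P)) (box l u) = emeasure lborel (box (\<chi> i. l $ ?\<tau> i) (\<chi> i. u $ ?\<tau> i))"
      by (simp add: emeasure_distr)
    also have "\<dots> = ennreal (\<Prod>b\<in>Basis. ((\<chi> i. u $ ?\<tau> i) - (\<chi> i. l $ ?\<tau> i)) \<bullet> b)"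
      by (rule emeasure_lborel_box) (use le in \<open>auto simp: Basis_vec_eq_axis inner_axis\<close>)
    also have "(\<Prod>b\<in>Basis. ((\<chi> i. u $ ?\<tau> i) - (\<chi> i. l $ ?\<tau> i)) \<bullet> b) = (\<Prod>i\<in>UNIV. (\<lambda>i. u $ i - l $ i) (?\<tau> i))"
      by (simp add: prod_Basis_vec inner_axis)
    also have "\<dots> = (\<Prod>i\<in>UNIV. u $ i - l $ i)"
      by (rule prod.reindex_bij_betw) simp
    also have "\<dots> = (\<Prod>b\<in>Basis. (u - l) \<bullet> b)"
      by (simp add: prod_Basis_vec inner_axis)
    finally show "emeasure (distr lborel borel ((*v) ?P)) (box l u) = (\<Prod>b\<in>Basis. (u - l) \<bullet> b)" .
  qed simp
  have "\<bar>det ?P\<bar> = 1"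
    using permutes_swap_id[of m UNIV n] by (simp add: det_permute_columns sign_swap_id abs_mult)
  note swap1.prems(2)[measurable]
  show ?case
    unfolding \<open>\<bar>det ?P\<bar> = 1\<close>
    by (subst (2) eq) (simp add: nn_integral_distr)
next
  case (idplus m n c)
  let ?P = "(\<chi> i j. if i = m \<and> j = n then c else of_bool (i = j)) :: 'p rmat"
  have "det ?P = det (\<chi> k. if k = m then row m (mat 1) + c *s row n (mat 1) else row k (mat 1 :: 'p rmat))"
    using idplus.hyps by (intro arg_cong[of _ _ det]) (auto simp: vec_eq_iff row_def mat_def)
  also have "\<dots> = 1" using idplus.hyps by (subst det_row_operation) auto
  finally have d: "det ?P = 1" .
  have Px: "?P *v x = (\<chi> i. if i = m then x $ m + c * x $ n else x $ i)" for x
  proof -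
    have "(\<Sum>j\<in>UNIV. (if i = m \<and> j = n then c else of_bool (i = j)) * x $ j) = (if i = m then x $ m + c * x $ n else x $ i)" for i
    proof -
      have "(\<Sum>j\<in>UNIV. (if i = m \<and> j = n then c else of_bool (i = j)) * x $ j)
        = (\<Sum>j\<in>UNIV. (if j = i then x $ j else 0) + (if j = n then if i = m then c * x $ j else 0 else 0))"
        using idplus.hyps by (intro sum.cong) auto
      then show ?thesis by (simp add: sum.distrib)
    qed
    then show ?thesis by (simp add: vec_eq_iff matrix_vector_mult_def)
  qed
  show ?case
    unfolding Px d using nn_integral_lborel_shear[OF idplus.hyps idplus.prems(2)] by simp
qed

lemma lborel_affine_matrix:
  fixes A :: "('p::finite) rmat"
  assumes A: "invertible A"
  shows "lborel = density (distr lborel borel (\<lambda>z. \<mu> + A *v z)) (\<lambda>_. ennreal \<bar>det A\<bar>)" (is "_ = ?D")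
proof (rule measure_eqI)
  fix S assume "S \<in> sets (lborel :: 'p rvec measure)"
  then have [measurable]: "S \<in> sets borel" by simp
  have [measurable]: "(\<lambda>z. \<mu> + A *v z) \<in> borel \<rightarrow>\<^sub>M borel"
    by (intro borel_measurable_continuous_onI continuous_intros matrix_vector_mult_linear_continuous_on)
  have dA: "det A \<noteq> 0" using A by (simp add: invertible_det_nz)
  have "emeasure lborel S = (\<integral>\<^sup>+x. indicator S x \<partial>distr lborel borel ((+) \<mu>))"
    by (simp add: lborel_distr_plus)
  also have "\<dots> = (\<integral>\<^sup>+x. indicator S (\<mu> + x) \<partial>lborel)"
    by (subst nn_integral_distr) auto
  also have "\<dots> = ennreal \<bar>det A\<bar> * (\<integral>\<^sup>+x. indicator S (\<mu> + A *v x) \<partial>lborel)"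
    by (rule nn_integral_lborel_matrix[OF dA, symmetric]) measurable
  also have "(\<integral>\<^sup>+x. indicator S (\<mu> + A *v x) \<partial>lborel) = (\<integral>\<^sup>+x. indicator S x \<partial>distr lborel borel (\<lambda>z. \<mu> + A *v z))"
    by (simp add: nn_integral_distr del: nn_integral_indicator)
  finally show "emeasure lborel S = emeasure ?D S"
    by (simp add: emeasure_density_const)
qed simp

section \<open>Densities and independent normal samples\<close>

lemma PiM_density:
  fixes f :: "real \<Rightarrow> ennreal"
  assumes I: "finite I" and [measurable]: "f \<in> borel_measurable borel"
    and sf: "sigma_finite_measure (density lborel f)"
  shows "PiM I (\<lambda>_. density lborel f) = density (PiM I (\<lambda>_. lborel)) (\<lambda>z. \<Prod>i\<in>I. f (z i))"
proof -
  interpret L: product_sigma_finite "\<lambda>_::'a. lborel :: real measure" ..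
  interpret D: product_sigma_finite "\<lambda>_::'a. density lborel f"
    unfolding product_sigma_finite_def using sf by blast
  show ?thesis
  proof (rule D.PiM_eqI[OF I, symmetric])
    show "sets (density (PiM I (\<lambda>_. lborel)) (\<lambda>z. \<Prod>i\<in>I. f (z i))) = sets (PiM I (\<lambda>_. density lborel f))"
      unfolding sets_density by (rule sets_PiM_cong) auto
  next
    fix A assume "\<And>i. i \<in> I \<Longrightarrow> A i \<in> sets (density lborel f)"
    then have A [measurable]: "\<And>i. i \<in> I \<Longrightarrow> A i \<in> sets borel" by simp
    have "emeasure (density (PiM I (\<lambda>_. lborel)) (\<lambda>z. \<Prod>i\<in>I. f (z i))) (Pi\<^sub>E I A)
        = (\<integral>\<^sup>+z. (\<Prod>i\<in>I. f (z i)) * indicator (Pi\<^sub>E I A) z \<partial>PiM I (\<lambda>_. lborel))"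
      using I by (subst emeasure_density) (auto intro!: sets_PiM_I_finite)
    also have "\<dots> = (\<integral>\<^sup>+z. (\<Prod>i\<in>I. f (z i) * indicator (A i) (z i)) \<partial>PiM I (\<lambda>_. lborel))"
    proof (rule nn_integral_cong)
      fix z assume "z \<in> space (PiM I (\<lambda>_. lborel :: real measure))"
      \<comment> \<open>Membership in \<open>Pi\<^sub>E I A\<close> also fixes the values outside
        \<open>I\<close>; points of the product space satisfy this, so only the factors in
        \<open>I\<close> matter.\<close>
      then have e: "z \<in> extensional I" by (simp add: space_PiM PiE_def)
      have "indicator (Pi\<^sub>E I A) z = (\<Prod>i\<in>I. indicator (A i) (z i) :: ennreal)"
      proof (cases "z \<in> Pi\<^sub>E I A")
        case True
        then show ?thesis by (auto simp: PiE_def Pi_def)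
      next
        case False
        then obtain i where "i \<in> I" "z i \<notin> A i" using e by (auto simp: PiE_def)
        then have "(\<Prod>i\<in>I. indicator (A i) (z i) :: ennreal) = 0" using I by (intro prod_zero bexI[of _ i]) auto
        with False show ?thesis by simp
      qed
      then show "(\<Prod>i\<in>I. f (z i)) * indicator (Pi\<^sub>E I A) z = (\<Prod>i\<in>I. f (z i) * indicator (A i) (z i))"
        by (simp add: prod.distrib)
    qed
    also have "\<dots> = (\<Prod>i\<in>I. \<integral>\<^sup>+x. f x * indicator (A i) x \<partial>lborel)"
      using I by (intro L.product_nn_integral_prod) auto
    also have "\<dots> = (\<Prod>i\<in>I. emeasure (density lborel f) (A i))"
      by (intro prod.cong refl) (simp add: emeasure_density)
    finally show "emeasure (density (PiM I (\<lambda>_. lborel)) (\<lambda>z. \<Prod>i\<in>I. f (z i))) (Pi\<^sub>E I A)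
       = (\<Prod>i\<in>I. emeasure (density lborel f) (A i))" .
  qed
qed

lemma distr_std_normals_vec:
  "distr (std_normals UNIV) borel (\<lambda>z. (\<chi> i. z i) :: ('p::finite) rvec)
   = density lborel (\<lambda>z. ennreal (exp (- (z \<bullet> z) / 2) / sqrt (2 * pi) ^ CARD('p)))"
proof -
  have [measurable]: "(\<lambda>z. (\<chi> i. z i) :: 'p rvec) \<in> borel_measurable (PiM UNIV (\<lambda>_. lborel))"
    by (rule measurable_vec_lambda) measurable
  have p: "(\<Prod>i\<in>UNIV. ennreal (std_normal_density (z $ i))) = ennreal (exp (- (z \<bullet> z) / 2) / sqrt (2 * pi) ^ CARD('p))"
    for z :: "'p rvec"
  proof -
    have "(\<Prod>i\<in>UNIV. std_normal_density (z $ i)) = (\<Prod>i\<in>UNIV. exp (- (z $ i)\<^sup>2 / 2) / sqrt (2 * pi))"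
      by (simp add: std_normal_density_def)
    also have "\<dots> = (\<Prod>i\<in>UNIV. exp (- (z $ i)\<^sup>2 / 2)) / sqrt (2 * pi) ^ CARD('p)"
      by (simp only: prod_dividef prod_constant)
    also have "(\<Prod>i\<in>UNIV. exp (- (z $ i)\<^sup>2 / 2)) = exp (\<Sum>i\<in>UNIV. - (z $ i)\<^sup>2 / 2)"
      by (simp only: exp_sum finite_class.finite_UNIV)
    also have "(\<Sum>i\<in>UNIV. - (z $ i)\<^sup>2 / 2) = - (z \<bullet> z) / 2"
      by (simp only: sum_divide_distrib[symmetric] sum_negf inner_vec_def inner_real_def power2_eq_square)
    finally have "(\<Prod>i\<in>UNIV. std_normal_density (z $ i)) = exp (- (z \<bullet> z) / 2) / sqrt (2 * pi) ^ CARD('p)" .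
    then show ?thesis by (simp add: prod_ennreal normal_density_nonneg)
  qed
  have "distr (std_normals UNIV) borel (\<lambda>z. (\<chi> i. z i) :: 'p rvec) =
     distr (density (PiM UNIV (\<lambda>_. lborel)) (\<lambda>z. \<Prod>i\<in>UNIV. ennreal (std_normal_density (z i)))) borel (\<lambda>z. (\<chi> i. z i) :: 'p rvec)"
    by (subst PiM_density) (auto intro!: prob_space_imp_sigma_finite prob_space_std_normal)
  also have "\<dots> = density (distr (PiM UNIV (\<lambda>_. lborel)) borel (\<lambda>z. (\<chi> i. z i) :: 'p rvec)) (\<lambda>z. \<Prod>i\<in>UNIV. ennreal (std_normal_density (z $ i)))"
    by (subst density_distr) auto
  also have "\<dots> = density lborel (\<lambda>z. ennreal (exp (- (z \<bullet> z) / 2) / sqrt (2 * pi) ^ CARD('p)))"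
    by (simp add: lborel_vec[symmetric] p)
  finally show ?thesis .
qed

text \<open>Substitute x = \<mu> + A z in the density: the quadratic form becomes z \<bullet> z, and
  since det \<Psi> = (det A)^2 the Jacobian cancels the determinant.\<close>

lemma multi_normal_eq_distr:
  fixes A :: "('p::finite) rmat"
  assumes A: "A ** transpose A = \<Psi>" "invertible A"
  shows "multi_normal \<mu> \<Psi> = distr (std_normals UNIV) borel (\<lambda>z. \<mu> + A *v (\<chi> i. z i))"
proof -
  let ?T = "\<lambda>z. \<mu> + A *v z"
  have [measurable]: "?T \<in> borel \<rightarrow>\<^sub>M borel"
    by (intro borel_measurable_continuous_onI continuous_intros matrix_vector_mult_linear_continuous_on)
  have [measurable]: "(\<lambda>x. matrix_inv \<Psi> *v x) \<in> borel \<rightarrow>\<^sub>M borel"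
    by (intro borel_measurable_continuous_onI matrix_vector_mult_linear_continuous_on)
  have [measurable]: "(\<lambda>z. (\<chi> i. z i) :: 'p rvec) \<in> borel_measurable (std_normals UNIV)"
    by (rule measurable_vec_lambda) measurable
  define g where "g x = exp (- ((x - \<mu>) \<bullet> (matrix_inv \<Psi> *v (x - \<mu>))) / 2) / sqrt ((2 * pi) ^ CARD('p) * det \<Psi>)" for x
  have [measurable]: "g \<in> borel_measurable borel" unfolding g_def by measurable
  have dA: "det A \<noteq> 0" using A(2) by (simp add: invertible_det_nz)
  have dP: "det \<Psi> = (det A)\<^sup>2" unfolding A(1)[symmetric] by (simp add: det_mul power2_eq_square)
  then have "invertible \<Psi>" using dA by (simp add: invertible_det_nz)
  obtain B where B: "B ** A = mat 1" using A(2) by (auto simp: invertible_def)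
  have q: "(A *v z) \<bullet> (matrix_inv \<Psi> *v (A *v z)) = z \<bullet> z" for z
  proof -
    \<comment> \<open>Cancelling \<open>A\<close> in A A^t w = A z gives A^t w = z, so (A z)
      \<bullet> w = z \<bullet> (A^t w) = z \<bullet> z.\<close>
    let ?w = "matrix_inv \<Psi> *v (A *v z)"
    have "A *v (transpose A *v ?w) = \<Psi> *v ?w"
      by (simp only: matrix_vector_mul_assoc matrix_mul_assoc A(1))
    also have "\<dots> = A *v z"
    proof -
      have "\<Psi> ** matrix_inv \<Psi> = mat 1"
        using \<open>invertible \<Psi>\<close> unfolding invertible_def matrix_inv_def by (rule someI2_ex) simp
      then show ?thesis by (simp add: matrix_vector_mul_assoc matrix_mul_assoc)
    qed
    finally have "B *v (A *v (transpose A *v ?w)) = B *v (A *v z)" by simp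
    then have "transpose A *v ?w = z" using B by (simp only: matrix_vector_mul_assoc matrix_mul_assoc) simp
    then show ?thesis
      by (metis dot_lmul_matrix transpose_transpose vector_transpose_matrix inner_commute)
  qed
  have gT: "ennreal \<bar>det A\<bar> * ennreal (g (?T z)) = ennreal (exp (- (z \<bullet> z) / 2) / sqrt (2 * pi) ^ CARD('p))" for z
  proof -
    have "\<bar>det A\<bar> * g (?T z) = exp (- (z \<bullet> z) / 2) / sqrt (2 * pi) ^ CARD('p)"
    proof -
      have "sqrt ((2 * pi) ^ CARD('p) * det \<Psi>) = sqrt (2 * pi) ^ CARD('p) * \<bar>det A\<bar>"
        by (subst real_sqrt_mult, subst real_sqrt_power) (simp only: dP real_sqrt_abs)
      then show ?thesis using dA by (simp add: g_def q del: real_sqrt_mult)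
    qed
    then show ?thesis by (simp add: ennreal_mult'[symmetric])
  qed
  have "multi_normal \<mu> \<Psi> = density lborel (\<lambda>x. ennreal (g x))"
    by (simp add: multi_normal_def g_def)
  also have "\<dots> = density (density (distr lborel borel ?T) (\<lambda>_. ennreal \<bar>det A\<bar>)) (\<lambda>x. ennreal (g x))"
    using lborel_affine_matrix[OF A(2), of \<mu>] by simp
  also have "\<dots> = density (distr lborel borel ?T) (\<lambda>x. ennreal \<bar>det A\<bar> * ennreal (g x))"
    by (subst density_density_eq) auto
  also have "\<dots> = distr (density lborel (\<lambda>z. ennreal \<bar>det A\<bar> * ennreal (g (?T z)))) borel ?T"
    by (subst density_distr) auto
  also have "\<dots> = distr (distr (std_normals UNIV) borel (\<lambda>z. (\<chi> i. z i) :: 'p rvec)) borel ?T"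
    unfolding gT distr_std_normals_vec ..
  also have "\<dots> = distr (std_normals UNIV) borel (\<lambda>z. ?T (\<chi> i. z i))"
    by (subst distr_distr) (auto simp: o_def)
  finally show ?thesis .
qed

text \<open>The whole sample is driven by one family of independent standard normals indexed by
  \<open>K \<times> UNIV\<close>, so integration by parts can act on a single coordinate. The blocks
  \<open>{k} \<times> UNIV\<close> are disjoint, whence the observations are independent.\<close>

lemma PiM_multi_normal_eq_distr:
  fixes A :: "('p::finite) rmat" and \<mu> :: "'p rvec" and K :: "'k set"
  assumes A: "A ** transpose A = \<Psi>" "invertible A" and K: "K \<noteq> {}"
  defines "Z \<equiv> std_normals (K \<times> (UNIV :: 'p set))"
  defines "X \<equiv> \<lambda>k z. \<mu> + A *v (\<chi> i. z (k, i))"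
  shows "PiM K (\<lambda>_. multi_normal \<mu> \<Psi>) = distr Z (PiM K (\<lambda>_. borel)) (\<lambda>z. \<lambda>k\<in>K. X k z)"
    and "k \<in> K \<Longrightarrow> X k \<in> borel_measurable Z"
proof -
  interpret Z: prob_space Z unfolding Z_def by (rule prob_space_std_normals)
  let ?I = "K \<times> (UNIV :: 'p set)"
  let ?T = "\<lambda>z. \<mu> + A *v z"
  have [measurable]: "?T \<in> borel \<rightarrow>\<^sub>M borel"
    by (intro borel_measurable_continuous_onI continuous_intros matrix_vector_mult_linear_continuous_on)
  have comp: "(\<lambda>z. z i) \<in> measurable Z std_normal_distribution" if "i \<in> ?I" for i
    unfolding Z_def by (rule measurable_component_singleton[OF that])
  have X [measurable]: "X k \<in> borel_measurable Z" if "k \<in> K" for k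
  proof -
    have "(\<lambda>z. (\<chi> i. z (k, i)) :: 'p rvec) \<in> borel_measurable Z"
      by (rule measurable_vec_lambda) (use comp that in simp)
    then show ?thesis unfolding X_def by measurable
  qed
  then show "k \<in> K \<Longrightarrow> X k \<in> borel_measurable Z" .
  have "Z.indep_vars (\<lambda>_. std_normal_distribution) (\<lambda>i z. z i) ?I"
  proof (subst Z.indep_vars_iff_distr_eq_PiM')
    show "?I \<noteq> {}" using K by auto
    have "distr Z (std_normals ?I) (\<lambda>z. \<lambda>i\<in>?I. z i) = distr Z (std_normals ?I) (\<lambda>z. z)"
      by (intro distr_cong) (auto simp: Z_def space_PiM PiE_def extensional_restrict)
    also have "\<dots> = Z" unfolding Z_def by simp
    also have "\<dots> = PiM ?I (\<lambda>i. distr Z std_normal_distribution (\<lambda>z. z i))"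
      unfolding Z_def
      by (intro PiM_cong refl distr_PiM_component[symmetric] prob_space_std_normal) auto
    finally show "distr Z (std_normals ?I) (\<lambda>z. \<lambda>i\<in>?I. z i) = PiM ?I (\<lambda>i. distr Z std_normal_distribution (\<lambda>z. z i))" .
  qed (use comp in auto)
  then have "Z.indep_vars (\<lambda>k. std_normals ({k} \<times> UNIV)) (\<lambda>k z. restrict (\<lambda>i. z i) ({k} \<times> (UNIV :: 'p set))) K"
    by (rule Z.indep_vars_restrict) (auto simp: disjoint_family_on_def)
  then have "Z.indep_vars (\<lambda>_. borel) (\<lambda>k z. (\<lambda>w. ?T (\<chi> i. w (k, i))) (restrict (\<lambda>i. z i) ({k} \<times> (UNIV :: 'p set)))) K"
  proof (rule Z.indep_vars_compose2)
    fix k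
    have "(\<lambda>w. (\<chi> i. w (k, i)) :: 'p rvec) \<in> borel_measurable (std_normals ({k} \<times> UNIV))"
    proof (rule measurable_vec_lambda)
      fix i :: 'p
      have "(\<lambda>z. z (k, i)) \<in> measurable (std_normals ({k} \<times> UNIV)) std_normal_distribution"
        by (rule measurable_component_singleton) simp
      then show "(\<lambda>z. z (k, i)) \<in> borel_measurable (std_normals ({k} \<times> (UNIV :: 'p set)))" by simp
    qed
    then show "(\<lambda>w. ?T (\<chi> i. w (k, i))) \<in> std_normals ({k} \<times> UNIV) \<rightarrow>\<^sub>M borel" by measurable
  qed
  then have iX: "Z.indep_vars (\<lambda>_. borel) X K"
    by (simp add: X_def)
  have dX: "distr Z borel (X k) = multi_normal \<mu> \<Psi>" if k: "k \<in> K" for k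
  proof -
    have 1: "distr Z (std_normals UNIV) (\<lambda>z. \<lambda>i\<in>UNIV. z (k, i)) = std_normals (UNIV :: 'p set)"
      unfolding Z_def
      by (rule distr_PiM_reindex[where f = "\<lambda>i. (k, i)"]) (use k in \<open>auto simp: inj_on_def intro: prob_space_std_normal\<close>)
    have mr: "(\<lambda>z. \<lambda>i\<in>UNIV. z (k, i)) \<in> measurable Z (std_normals (UNIV :: 'p set))"
      by (rule measurable_restrict) (use comp k in auto)
    have m: "(\<lambda>z. (\<chi> i. z i) :: 'p rvec) \<in> borel_measurable (std_normals UNIV)"
      by (rule measurable_vec_lambda) measurable
    have "multi_normal \<mu> \<Psi> = distr (distr Z (std_normals UNIV) (\<lambda>z. \<lambda>i\<in>UNIV. z (k, i))) borel (\<lambda>z. ?T (\<chi> i. z i))"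
      by (simp add: 1 multi_normal_eq_distr[OF A])
    also have "\<dots> = distr Z borel (X k)"
    proof (subst distr_distr[OF _ mr])
      show "(\<lambda>z. ?T (\<chi> i. z i)) \<in> borel_measurable (std_normals UNIV)" using m by measurable
    qed (simp add: X_def o_def restrict_UNIV)
    finally show ?thesis ..
  qed
  have "distr Z (PiM K (\<lambda>_. borel)) (\<lambda>z. \<lambda>k\<in>K. X k z) = PiM K (\<lambda>k. distr Z borel (X k))"
    using iX K X by (subst (asm) Z.indep_vars_iff_distr_eq_PiM') auto
  also have "\<dots> = PiM K (\<lambda>_. multi_normal \<mu> \<Psi>)"
    by (intro PiM_cong refl dX)
  finally show "PiM K (\<lambda>_. multi_normal \<mu> \<Psi>) = distr Z (PiM K (\<lambda>_. borel)) (\<lambda>z. \<lambda>k\<in>K. X k z)" ..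
qed

section \<open>Moments of Wishart matrices\<close>

lemmas rpf_linear = real_polynomial_function.intros(1)
  and rpf_const = real_polynomial_function.intros(2)
  and rpf_add = real_polynomial_function.intros(3)
  and rpf_mult = real_polynomial_function.intros(4)

text \<open>Inverse of \<open>upper_entries\<close> on symmetric matrices. The pair
  \<open>(min i j, max i j)\<close> always represents an element of \<open>upper\<close>, so entries
  below the diagonal may be used freely; integration by parts permutes indices without regard to
  their order.\<close>

definition sym_mat :: "('p::{finite, linorder}) upper rvec \<Rightarrow> 'p rmat" where
  "sym_mat u = (\<chi> i j. u $ Abs_upper (min i j, max i j))"

lemma sym_mat_sym: "sym_mat u $ i $ j = sym_mat u $ j $ i"
  by (simp add: sym_mat_def min.commute max.commute)

lemma upper_entries_nth: "upper_entries A $ e = A $ fst (Rep_upper e) $ snd (Rep_upper e)"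
  by (simp add: upper_entries_def split: prod.splits)

lemma fst_le_snd_Rep_upper: "fst (Rep_upper e) \<le> snd (Rep_upper e)"
  using Rep_upper[of e] by (auto split: prod.splits)

lemma upper_entries_sym_mat [simp]: "upper_entries (sym_mat u) = u"
  by (simp add: vec_eq_iff upper_entries_nth sym_mat_def min_absorb1 max_absorb2
      fst_le_snd_Rep_upper Rep_upper_inverse)

lemma sym_mat_upper_entries:
  assumes "\<And>i j. A $ i $ j = A $ j $ i"
  shows "sym_mat (upper_entries A) = A"
proof -
  have "Rep_upper (Abs_upper (min i j, max i j)) = (min i j, max i j)" for i j :: 'a
    by (rule Abs_upper_inverse) (auto simp: min_le_iff_disj)
  then show ?thesis
    using assms by (auto simp: vec_eq_iff sym_mat_def upper_entries_nth min_def max_def)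
qed

lemma linear_upper_entries: "linear upper_entries"
  by (rule linearI) (simp_all add: vec_eq_iff upper_entries_nth)

text \<open>A monomial is the list of positions of its factors, not a vector of exponents: the
  moment recursion takes off the first factor and replaces others in place.\<close>

definition entry_prod :: "('p::finite) rmat \<Rightarrow> ('p \<times> 'p) list \<Rightarrow> real" where
  "entry_prod A xs = (\<Prod>(i, j)\<leftarrow>xs. A $ i $ j)"

lemma entry_prod_simps [simp]:
  "entry_prod A [] = 1"
  "entry_prod A ((i, j) # xs) = A $ i $ j * entry_prod A xs"
  "entry_prod A (xs @ ys) = entry_prod A xs * entry_prod A ys"
  by (simp_all add: entry_prod_def)

text \<open>The Leibniz rule: the derivative of \<open>entry_prod\<close> at \<open>A\<close> in the
  direction \<open>\<phi>\<close>. Taking a function of the position as direction lets such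
  derivatives be nested, as in the covariance expansion.\<close>

primrec dprod :: "('p::finite) rmat \<Rightarrow> ('p \<times> 'p \<Rightarrow> real) \<Rightarrow> ('p \<times> 'p) list \<Rightarrow> real" where
  "dprod A \<phi> [] = 0"
| "dprod A \<phi> (x # xs) = \<phi> x * entry_prod A xs + A $ fst x $ snd x * dprod A \<phi> xs"

text \<open>For a Wishart matrix \<open>S\<close> with mean \<open>\<Psi>\<close> and \<open>1 / t\<close> degrees of freedom, \<open>t * wkernel \<Psi> x y\<close> is the
  covariance of the entries of \<open>S\<close> at the positions \<open>x\<close> and \<open>y\<close>.\<close>

definition wkernel :: "('p::finite) rmat \<Rightarrow> 'p \<times> 'p \<Rightarrow> 'p \<times> 'p \<Rightarrow> real" where
  "wkernel \<Psi> x y = \<Psi> $ snd x $ fst y * \<Psi> $ fst x $ snd y + \<Psi> $ snd x $ snd y * \<Psi> $ fst x $ fst y"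

text \<open>The moment \<open>E (\<Prod>(i, j)\<leftarrow>xs. S\<^sub>i\<^sub>j)\<close> of a Wishart matrix with mean \<open>\<Psi>\<close> and \<open>1 / t\<close>
  degrees of freedom; the recursion is Gaussian integration by parts.\<close>

function wmom :: "real \<Rightarrow> ('p::finite) rmat \<Rightarrow> ('p \<times> 'p) list \<Rightarrow> real" where
  "wmom t \<Psi> [] = 1"
| "wmom t \<Psi> ((i, j) # xs) = \<Psi> $ i $ j * wmom t \<Psi> xs +
     t * (\<Sum>q<length xs. \<Psi> $ j $ fst (xs ! q) * wmom t \<Psi> (xs[q := (i, snd (xs ! q))])
                       + \<Psi> $ j $ snd (xs ! q) * wmom t \<Psi> (xs[q := (i, fst (xs ! q))]))"
  by pat_completeness auto
termination
  by (relation "Wellfounded.measure (\<lambda>(t, \<Psi>, xs). length xs)") auto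

text \<open>A point consists of the entries of \<open>\<Psi>\<close> and of the reciprocal \<open>t\<close> of the degrees of freedom.\<close>

type_synonym 'p pt = "'p upper rvec \<times> real"

text \<open>Divisibility by \<open>t ^ k\<close> among polynomial functions, which stands in for an
  estimate O(t^k).\<close>

definition vanish :: "nat \<Rightarrow> ('a::real_normed_vector \<times> real \<Rightarrow> real) \<Rightarrow> bool" where
  "vanish k h \<longleftrightarrow> (\<exists>R. real_polynomial_function R \<and> (\<forall>z. h z = snd z ^ k * R z))"

lemma vanish_add: "vanish k g \<Longrightarrow> vanish k h \<Longrightarrow> vanish k (\<lambda>z. g z + h z)"
  unfolding vanish_def
proof clarify
  fix R R' assume "real_polynomial_function R" "\<forall>z. g z = snd z ^ k * R z"
    "real_polynomial_function R'" "\<forall>z. h z = snd z ^ k * R' z"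
  then show "\<exists>R. real_polynomial_function R \<and> (\<forall>z. g z + h z = snd z ^ k * R z)"
    by (intro exI[of _ "\<lambda>z. R z + R' z"]) (auto simp: distrib_left intro: rpf_add)
qed

lemma vanish_0: "vanish k (\<lambda>z. 0)"
  unfolding vanish_def by (rule exI[of _ "\<lambda>z. 0"]) (simp add: rpf_const)

lemma vanish_sum: "finite I \<Longrightarrow> (\<And>i. i \<in> I \<Longrightarrow> vanish k (f i)) \<Longrightarrow> vanish k (\<lambda>z. \<Sum>i\<in>I. f i z)"
  by (induction I rule: finite_induct) (simp_all add: vanish_add vanish_0)

lemma vanish_mult_poly: "vanish k g \<Longrightarrow> real_polynomial_function h \<Longrightarrow> vanish k (\<lambda>z. h z * g z)"
  unfolding vanish_def
proof clarify
  fix R assume "real_polynomial_function R" "\<forall>z. g z = snd z ^ k * R z" "real_polynomial_function h"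
  then show "\<exists>R. real_polynomial_function R \<and> (\<forall>z. h z * g z = snd z ^ k * R z)"
    by (intro exI[of _ "\<lambda>z. h z * R z"]) (auto simp: ac_simps intro: rpf_mult)
qed

lemma vanish_Suc: "vanish k g \<Longrightarrow> vanish (Suc k) (\<lambda>z. snd z * g z)"
  by (auto simp: vanish_def ac_simps)

lemma real_polynomial_function_snd [intro]: "real_polynomial_function (snd :: 'a::real_normed_vector \<times> real \<Rightarrow> real)"
  by (rule rpf_linear) (rule bounded_linear_snd)

lemma vanish_Suc_imp: "vanish (Suc k) g \<Longrightarrow> vanish k g"
  unfolding vanish_def
proof clarify
  fix R assume R: "real_polynomial_function R" "\<forall>z. g z = snd z ^ Suc k * R z"
  show "\<exists>R. real_polynomial_function R \<and> (\<forall>z. g z = snd z ^ k * R z)"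
    by (rule exI[of _ "\<lambda>z. snd z * R z"]) (use R in \<open>auto simp: ac_simps intro!: rpf_mult\<close>)
qed

lemma poly_imp_vanish_0: "real_polynomial_function h \<Longrightarrow> vanish 0 h"
  by (auto simp: vanish_def)

lemma real_polynomial_sym_mat:
  "real_polynomial_function (\<lambda>z::('p::{finite,linorder}) pt. sym_mat (fst z) $ i $ j)"
  unfolding sym_mat_def
  by (simp, rule rpf_linear)
     (intro bounded_linear_compose[OF bounded_linear_vec_nth] bounded_linear_fst)

lemma real_polynomial_entry_prod:
  "real_polynomial_function (\<lambda>z::('p::{finite,linorder}) pt. entry_prod (sym_mat (fst z)) xs)"
  by (induction xs) (auto intro!: rpf_mult real_polynomial_sym_mat)

lemma real_polynomial_dprod:
  assumes "\<And>x. real_polynomial_function (\<lambda>z::('p::{finite,linorder}) pt. \<phi> z x)"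
  shows "real_polynomial_function (\<lambda>z. dprod (sym_mat (fst z)) (\<phi> z) xs)"
  by (induction xs)
     (auto intro!: rpf_add rpf_mult
        real_polynomial_sym_mat real_polynomial_entry_prod assms)

lemma real_polynomial_wkernel:
  "real_polynomial_function (\<lambda>z::('p::{finite,linorder}) pt. wkernel (sym_mat (fst z)) x y)"
  unfolding wkernel_def
  by (intro rpf_add rpf_mult real_polynomial_sym_mat)

lemma real_polynomial_wmom:
  "real_polynomial_function (\<lambda>z::('p::{finite,linorder}) pt. wmom (snd z) (sym_mat (fst z)) xs)"
proof (induction "length xs" arbitrary: xs rule: less_induct)
  case less
  show ?case
  proof (cases xs)
    case (Cons x ys)
    have IH: "real_polynomial_function (\<lambda>z::'p pt. wmom (snd z) (sym_mat (fst z)) zs)"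
      if "length zs = length ys" for zs
      using less Cons that by simp
    obtain i j where "x = (i, j)" by (cases x)
    with Cons show ?thesis
      by simp (intro rpf_add rpf_mult real_polynomial_function_sum
          real_polynomial_function_snd real_polynomial_sym_mat IH; simp)
  qed auto
qed

text \<open>Only the first summand of the recursion for \<open>wmom\<close> lacks the factor
  \<open>t\<close>; iterating it multiplies out to \<open>entry_prod\<close>.\<close>

lemma wmom_minus_entry_prod:
  "vanish 1 (\<lambda>z::('p::{finite,linorder}) pt. wmom (snd z) (sym_mat (fst z)) xs - entry_prod (sym_mat (fst z)) xs)"
proof (induction xs)
  case (Cons x xs)
  obtain i j where x: "x = (i, j)" by (cases x)
  let ?S = "\<lambda>z::'p pt. sym_mat (fst z)"
  let ?R = "\<lambda>z::'p pt. \<Sum>q<length xs. ?S z $ j $ fst (xs ! q) * wmom (snd z) (?S z) (xs[q := (i, snd (xs ! q))])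
                       + ?S z $ j $ snd (xs ! q) * wmom (snd z) (?S z) (xs[q := (i, fst (xs ! q))])"
  have "vanish (Suc 0) (\<lambda>z::'p pt. ?S z $ i $ j * (wmom (snd z) (?S z) xs - entry_prod (?S z) xs) + snd z * ?R z)"
    by (intro vanish_add vanish_mult_poly real_polynomial_sym_mat Cons[simplified] vanish_Suc poly_imp_vanish_0
        rpf_add rpf_mult real_polynomial_function_sum real_polynomial_wmom; simp)
  then show ?case
    by (simp add: x algebra_simps)
qed (simp add: vanish_0)

text \<open>The replacement sum in the moment recursion is a derivative by the Leibniz rule. Two
  matrices are kept apart because two cases occur: \<open>A = B = \<Psi>\<close>, where the
  direction is \<open>wkernel \<Psi> (i, j)\<close>, and \<open>B = \<Psi>\<close> with a random
  \<open>A\<close>, where the derivative comes out of integration by parts.\<close>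

lemma sum_update_entry_prod:
  "(\<Sum>q<length ys. B $ j $ fst (ys ! q) * entry_prod A (ys[q := (i, snd (ys ! q))])
                + B $ j $ snd (ys ! q) * entry_prod A (ys[q := (i, fst (ys ! q))]))
   = dprod A (\<lambda>y. B $ j $ fst y * A $ i $ snd y + B $ j $ snd y * A $ i $ fst y) ys"
proof (induction ys)
  case (Cons y ys)
  obtain a b where y: "y = (a, b)" by (cases y)
  define \<phi> where "\<phi> = (\<lambda>y. B $ j $ fst y * A $ i $ snd y + B $ j $ snd y * A $ i $ fst y)"
  have \<phi>: "\<phi> (a, b) = B $ j $ a * A $ i $ b + B $ j $ b * A $ i $ a"
    by (simp add: \<phi>_def)
  show ?case
    unfolding \<phi>_def[symmetric]
    by (simp add: y \<phi> sum.lessThan_Suc_shift Cons.IH[folded \<phi>_def, symmetric] sum_distrib_left algebra_simps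
        del: sum.lessThan_Suc)
qed simp

lemma wkernel_fun: "wkernel \<Psi> (i, j) = (\<lambda>y. \<Psi> $ j $ fst y * \<Psi> $ i $ snd y + \<Psi> $ j $ snd y * \<Psi> $ i $ fst y)"
  by (simp add: fun_eq_iff wkernel_def)

text \<open>The second argument of \<open>g\<close> is the operation of writing a value into the
  chosen position, so that both kinds of index replacement are covered by one splitting of the
  sum.\<close>

lemma sum_append_update:
  fixes g :: "_ \<Rightarrow> _ \<Rightarrow> 'b::comm_monoid_add"
  shows "(\<Sum>q<length (xs @ ys). g ((xs @ ys) ! q) (\<lambda>v. (xs @ ys)[q := v])) =
   (\<Sum>q<length xs. g (xs ! q) (\<lambda>v. xs[q := v] @ ys)) + (\<Sum>q<length ys. g (ys ! q) (\<lambda>v. xs @ ys[q := v]))"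
proof -
  have "(\<Sum>q<length xs + length ys. h q) = (\<Sum>q<length xs. h q) + (\<Sum>q<length ys. h (length xs + q))"
    for h :: "nat \<Rightarrow> 'b"
    by (induction ys) (simp_all add: add.assoc)
  then show ?thesis
    by (auto simp: nth_append list_update_append intro!: arg_cong2[where f="(+)"] sum.cong)
qed

text \<open>In the recursion for \<open>xs @ ys\<close> the first factor pairs either with a factor
  of \<open>xs\<close>, which gives \<open>t\<close> times a covariance with a shorter first list,
  itself O(t), or with a factor of \<open>ys\<close>, which gives the leading term. The replaced
  lists differ from the tail of \<open>xs\<close>, so the induction is on the length.\<close>

lemma wmom_covariance:
  "vanish 2 (\<lambda>z::('p::{finite,linorder}) pt.
     wmom (snd z) (sym_mat (fst z)) (xs @ ys)
     - wmom (snd z) (sym_mat (fst z)) xs * wmom (snd z) (sym_mat (fst z)) ys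
     - snd z * dprod (sym_mat (fst z)) (\<lambda>x. dprod (sym_mat (fst z)) (wkernel (sym_mat (fst z)) x) ys) xs)"
proof (induction "length xs" arbitrary: xs rule: less_induct)
  case less
  let ?S = "\<lambda>z::'p pt. sym_mat (fst z)"
  let ?W = "\<lambda>xs z. wmom (snd z) (?S z) xs"
  let ?c = "\<lambda>xs z. dprod (?S z) (\<lambda>x. dprod (?S z) (wkernel (?S z) x) ys) xs"
  let ?K = "\<lambda>xs z. ?W (xs @ ys) z - ?W xs z * ?W ys z"
  show ?case
  proof (cases xs)
    case Nil
    then show ?thesis by (simp add: vanish_0)
  next
    case (Cons x us)
    obtain i j where x: "x = (i, j)" by (cases x)
    have cpoly: "real_polynomial_function (\<lambda>z. ?c zs z)" for zs
      by (intro real_polynomial_dprod real_polynomial_wkernel)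
    have IH2: "vanish (Suc (Suc 0)) (\<lambda>z. ?K zs z - snd z * ?c zs z)" if "length zs = length us" for zs
      using less[of zs] Cons that by (simp add: numeral_2_eq_2)
    have IH1: "vanish (Suc 0) (?K zs)" if "length zs = length us" for zs
    proof -
      have "vanish (Suc 0) (\<lambda>z. (?K zs z - snd z * ?c zs z) + snd z * ?c zs z)"
        by (intro vanish_add vanish_Suc_imp[OF IH2] vanish_Suc poly_imp_vanish_0 cpoly that)
      then show ?thesis by simp
    qed
    have me: "vanish (Suc 0) (\<lambda>z. ?W zs z - entry_prod (?S z) zs)" for zs
      using wmom_minus_entry_prod[of zs] by simp
    \<comment> \<open>The difference rearranged: the first line is the induction hypothesis; in the
      factor of \<open>snd z\<close> the sum over \<open>us\<close> contains covariances and the sum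
      over \<open>ys\<close> errors of leading terms, each divisible by \<open>snd z\<close> once
      more.\<close>
    let ?E = "\<lambda>z. ?S z $ i $ j * (?K us z - snd z * ?c us z) +
       snd z * ((\<Sum>q<length us. ?S z $ j $ fst (us ! q) * ?K (us[q := (i, snd (us ! q))]) z
                       + ?S z $ j $ snd (us ! q) * ?K (us[q := (i, fst (us ! q))]) z) +
         (\<Sum>q<length ys. ?S z $ j $ fst (ys ! q) * (?W (us @ ys[q := (i, snd (ys ! q))]) z - entry_prod (?S z) (us @ ys[q := (i, snd (ys ! q))]))
                       + ?S z $ j $ snd (ys ! q) * (?W (us @ ys[q := (i, fst (ys ! q))]) z - entry_prod (?S z) (us @ ys[q := (i, fst (ys ! q))]))))"
    have "vanish (Suc (Suc 0)) ?E"
      by (intro vanish_add vanish_mult_poly real_polynomial_sym_mat vanish_Suc vanish_sum IH1 IH2 me; simp)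
    moreover have "?E = (\<lambda>z. ?K xs z - snd z * ?c xs z)"
    proof
      fix z
      let ?w = "\<lambda>zs. ?W zs z" and ?s = "?S z"
      let ?A = "\<Sum>q<length us. ?s $ j $ fst (us ! q) * ?w (us[q := (i, snd (us ! q))] @ ys)
                       + ?s $ j $ snd (us ! q) * ?w (us[q := (i, fst (us ! q))] @ ys)"
      let ?A' = "\<Sum>q<length us. ?s $ j $ fst (us ! q) * ?w (us[q := (i, snd (us ! q))])
                       + ?s $ j $ snd (us ! q) * ?w (us[q := (i, fst (us ! q))])"
      let ?B = "\<Sum>q<length ys. ?s $ j $ fst (ys ! q) * ?w (us @ ys[q := (i, snd (ys ! q))])
                       + ?s $ j $ snd (ys ! q) * ?w (us @ ys[q := (i, fst (ys ! q))])"
      have 1: "?w (xs @ ys) = ?s $ i $ j * ?w (us @ ys) + snd z * (?A + ?B)"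
        using sum_append_update[of "\<lambda>v h. ?s $ j $ fst v * ?w (h (i, snd v)) + ?s $ j $ snd v * ?w (h (i, fst v))" us ys]
        by (simp add: Cons x)
      have 2: "?w xs = ?s $ i $ j * ?w us + snd z * ?A'"
        by (simp add: Cons x)
      have 3: "?c xs z = entry_prod ?s us * (\<Sum>q<length ys. ?s $ j $ fst (ys ! q) * entry_prod ?s (ys[q := (i, snd (ys ! q))])
                + ?s $ j $ snd (ys ! q) * entry_prod ?s (ys[q := (i, fst (ys ! q))])) + ?s $ i $ j * ?c us z"
        by (simp add: Cons x sum_update_entry_prod wkernel_fun)
      show "?E z = ?K xs z - snd z * ?c xs z"
        unfolding 1 2 3
        by (simp add: algebra_simps sum.distrib sum_subtractf sum_distrib_left)
    qed
    ultimately show ?thesis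
      by (simp add: numeral_2_eq_2)
  qed
qed

section \<open>Polynomials as sums of monomials\<close>

lemma entry_sum_mult:
  "\<exists>L''. \<forall>u. (\<Sum>(c, xs)\<leftarrow>L. c * entry_prod (sym_mat u) xs) * (\<Sum>(c, xs)\<leftarrow>L'. c * entry_prod (sym_mat u) xs)
     = (\<Sum>(c, xs)\<leftarrow>L''. c * entry_prod (sym_mat (u :: ('p::{finite,linorder}) upper rvec)) xs)"
proof (induction L)
  case (Cons x L)
  obtain c xs where x: "x = (c, xs)" by (cases x)
  have 1: "c * entry_prod (sym_mat u) xs * (\<Sum>(c, xs)\<leftarrow>L'. c * entry_prod (sym_mat u) xs)
     = (\<Sum>(c, xs)\<leftarrow>map (\<lambda>(d, ys). (c * d, xs @ ys)) L'. c * entry_prod (sym_mat u) xs)" for u :: "'p upper rvec"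
    by (induction L') (auto simp: algebra_simps)
  obtain L'' where L'': "\<And>u. (\<Sum>(c, xs)\<leftarrow>L. c * entry_prod (sym_mat u) xs) * (\<Sum>(c, xs)\<leftarrow>L'. c * entry_prod (sym_mat u) xs)
     = (\<Sum>(c, xs)\<leftarrow>L''. c * entry_prod (sym_mat (u :: 'p upper rvec)) xs)"
    using Cons by blast
  show ?case
    by (rule exI[of _ "map (\<lambda>(d, ys). (c * d, xs @ ys)) L' @ L''"])
       (simp add: x distrib_right 1 L'' del: map_map)
qed (auto intro: exI[of _ "[]"])

text \<open>Formal sums as lists make addition a concatenation; a linear form is expanded in the
  coordinates, each a monomial of degree one.\<close>

lemma real_polynomial_entry_sum_list:
  fixes f :: "('p::{finite,linorder}) upper rvec \<Rightarrow> real"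
  assumes "real_polynomial_function f"
  shows "\<exists>L. \<forall>u. f u = (\<Sum>(c, xs)\<leftarrow>L. c * entry_prod (sym_mat u) xs)"
  using assms
proof induction
  case (linear f)
  obtain es :: "'p upper list" where es: "set es = UNIV" "distinct es"
    using finite_distinct_list[of "UNIV :: 'p upper set"] by auto
  show ?case
  proof (intro exI[of _ "map (\<lambda>e. (f (axis e 1), [Rep_upper e])) es"] allI)
    fix u :: "'p upper rvec"
    interpret bounded_linear f by fact
    have "f u = f (\<Sum>e\<in>UNIV. u $ e *\<^sub>R axis e 1)"
      by (simp add: basis_expansion scalar_mult_eq_scaleR[symmetric])
    also have "\<dots> = (\<Sum>e\<in>UNIV. u $ e * f (axis e 1))"
      by (simp add: sum scaleR)
    also have "\<dots> = (\<Sum>e\<leftarrow>es. u $ e * f (axis e 1))"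
      using es by (simp add: sum_list_distinct_conv_sum_set)
    also have "\<dots> = (\<Sum>e\<leftarrow>es. f (axis e 1) * entry_prod (sym_mat u) [Rep_upper e])"
    proof -
      have "u $ e = entry_prod (sym_mat u) [Rep_upper e]" for e
        using upper_entries_nth[of "sym_mat u" e] by (simp add: entry_prod_def case_prod_unfold)
      then show ?thesis by (simp add: mult.commute)
    qed
    finally show "f u = (\<Sum>(c, xs)\<leftarrow>map (\<lambda>e. (f (axis e 1), [Rep_upper e])) es. c * entry_prod (sym_mat u) xs)"
      by (simp add: o_def)
  qed
next
  case (const c)
  show ?case by (rule exI[of _ "[(c, [])]"]) simp
next
  case (add f g)
  then obtain L L' where
    "\<forall>u. f u = (\<Sum>(c, xs)\<leftarrow>L. c * entry_prod (sym_mat u) xs)"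
    "\<forall>u. g u = (\<Sum>(c, xs)\<leftarrow>L'. c * entry_prod (sym_mat u) xs)" by blast
  then show ?case by (intro exI[of _ "L @ L'"]) simp
next
  case (mult f g)
  then obtain L L' where
    "\<forall>u. f u = (\<Sum>(c, xs)\<leftarrow>L. c * entry_prod (sym_mat u) xs)"
    "\<forall>u. g u = (\<Sum>(c, xs)\<leftarrow>L'. c * entry_prod (sym_mat u) xs)" by blast
  then show ?case using entry_sum_mult[of L L'] by auto
qed

lemma real_polynomial_entry_sum:
  fixes f :: "('p::{finite,linorder}) upper rvec \<Rightarrow> real"
  assumes "real_polynomial_function f"
  obtains c xs and n :: nat where "f = (\<lambda>u. \<Sum>i<n. c i * entry_prod (sym_mat u) (xs i))"
proof -
  obtain L where L: "\<And>u. f u = (\<Sum>(c, xs)\<leftarrow>L. c * entry_prod (sym_mat u) xs)"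
    using real_polynomial_entry_sum_list[OF assms] by blast
  show ?thesis
    by (rule that[where n = "length L" and c = "\<lambda>i. fst (L ! i)" and xs = "\<lambda>i. snd (L ! i)"])
       (simp add: fun_eq_iff L sum_list_sum_nth case_prod_unfold atLeast0LessThan)
qed

section \<open>Integration by parts for Wishart matrices\<close>

lemma dprod_cmult: "dprod A (\<lambda>x. c * \<phi> x) xs = c * dprod A \<phi> xs"
  by (induction xs) (auto simp: algebra_simps)

lemma dprod_sum: "dprod A (\<lambda>x. \<Sum>k\<in>K. \<phi> k x) xs = (\<Sum>k\<in>K. dprod A (\<phi> k) xs)"
  by (induction xs) (auto simp: sum.distrib sum_distrib_left sum_distrib_right)

lemma dprod_cong: "(\<And>x. \<phi> x = \<psi> x) \<Longrightarrow> dprod A \<phi> xs = dprod A \<psi> xs"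
  by (induction xs) auto

lemma entry_prod_has_derivative:
  assumes "\<And>a b. ((\<lambda>t. S t $ a $ b) has_real_derivative \<phi> (a, b)) (at t)"
  shows "((\<lambda>t. entry_prod (S t) xs) has_real_derivative dprod (S t) \<phi> xs) (at t)"
proof (induction xs)
  case (Cons x xs)
  obtain a b where "x = (a, b)" by (cases x)
  then show ?case
    using DERIV_mult[OF assms[of a b] Cons] by (simp add: ac_simps)
qed simp

lemma coord_poly_entry_prod:
  assumes "\<And>a b. coord_poly I (\<lambda>z. S z $ a $ b)"
  shows "coord_poly I (\<lambda>z. entry_prod (S z) xs)"
  by (induction xs) (auto intro!: coord_poly.const coord_poly.mult assms)

lemma coord_poly_dprod:
  assumes "\<And>a b. coord_poly I (\<lambda>z. S z $ a $ b)" "\<And>x. coord_poly I (\<lambda>z. \<phi> z x)"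
  shows "coord_poly I (\<lambda>z. dprod (S z) (\<phi> z) xs)"
  by (induction xs)
     (auto intro!: coord_poly.const coord_poly.mult coord_poly.add coord_poly_entry_prod assms)

text \<open>The matrix Y^t P Y, where the rows of Y are the vectors \<open>y k\<close>.\<close>

definition scatter :: "'k set \<Rightarrow> ('k \<Rightarrow> 'k \<Rightarrow> real) \<Rightarrow> ('k \<Rightarrow> 'p rvec) \<Rightarrow> ('p::finite) rmat" where
  "scatter K P y = (\<chi> a b. \<Sum>k\<in>K. \<Sum>l\<in>K. P k l * (y k $ a * y l $ b))"

text \<open>\<open>P\<close> is an orthogonal projection of rank \<open>T\<close> on \<open>\<real>\<^sup>K\<close>. Three of them are needed: the centering
  matrix (sample covariance), the averaging matrix (sample mean), and the \<open>1 \<times> 1\<close> identity (one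
  observation).\<close>

locale projection_kernel =
  fixes K :: "'k set" and P :: "'k \<Rightarrow> 'k \<Rightarrow> real" and T :: real
  assumes K: "finite K" "K \<noteq> {}"
    and P_sym: "\<And>k l. k \<in> K \<Longrightarrow> l \<in> K \<Longrightarrow> P k l = P l k"
    and P_idem: "\<And>k l. k \<in> K \<Longrightarrow> l \<in> K \<Longrightarrow> (\<Sum>j\<in>K. P k j * P j l) = P k l"
    and T_def: "T = (\<Sum>k\<in>K. P k k)" and T_pos: "T > 0"
begin

context
  fixes A \<Psi> :: "('p::finite) rmat"
  assumes A: "A ** transpose A = \<Psi>"
begin

definition yv :: "('k \<times> 'p \<Rightarrow> real) \<Rightarrow> 'k \<Rightarrow> 'p rvec" where
  "yv z k = A *v (\<chi> c. z (k, c))"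

definition pv :: "('k \<times> 'p \<Rightarrow> real) \<Rightarrow> 'k \<Rightarrow> 'p \<Rightarrow> real" where
  "pv z k a = (\<Sum>l\<in>K. P k l * yv z l $ a)"

definition wish :: "('k \<times> 'p \<Rightarrow> real) \<Rightarrow> 'p rmat" where
  "wish z = (1 / T) *\<^sub>R scatter K P (yv z)"

text \<open>Since P = P^t = P^2, the matrices Y^t (P Y), (P Y)^t Y and (P Y)^t (P Y) agree, where
  \<open>pv\<close> holds the rows of P Y. The first form is differentiated, the second exposes the
  coordinates of z for integration by parts, and the third recognises the result as entries of
  \<open>wish\<close> again.\<close>

lemma wish_yp: "wish z $ a $ b = (\<Sum>k\<in>K. yv z k $ a * pv z k b) / T"
  by (simp add: wish_def scatter_def pv_def sum_distrib_left sum_divide_distrib ac_simps)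

lemma wish_yp': "wish z $ a $ b = (\<Sum>k\<in>K. yv z k $ b * pv z k a) / T"
proof -
  have "(\<Sum>k\<in>K. \<Sum>l\<in>K. P k l * (yv z k $ a * yv z l $ b)) = (\<Sum>l\<in>K. \<Sum>k\<in>K. P k l * (yv z k $ a * yv z l $ b))"
    by (rule sum.swap)
  also have "\<dots> = (\<Sum>k\<in>K. yv z k $ b * pv z k a)"
    by (auto simp: pv_def sum_distrib_left P_sym ac_simps intro!: sum.cong)
  finally show ?thesis by (simp add: wish_def scatter_def)
qed

lemma wish_pp: "wish z $ a $ b = (\<Sum>k\<in>K. pv z k a * pv z k b) / T"
proof -
  have "(\<Sum>k\<in>K. pv z k a * pv z k b) = (\<Sum>k\<in>K. \<Sum>l\<in>K. \<Sum>j\<in>K. yv z l $ a * yv z j $ b * (P l k * P k j))"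
    by (auto simp: pv_def sum_product P_sym ac_simps intro!: sum.cong)
  also have "\<dots> = (\<Sum>l\<in>K. \<Sum>k\<in>K. \<Sum>j\<in>K. yv z l $ a * yv z j $ b * (P l k * P k j))"
    by (rule sum.swap)
  also have "\<dots> = (\<Sum>l\<in>K. \<Sum>j\<in>K. \<Sum>k\<in>K. yv z l $ a * yv z j $ b * (P l k * P k j))"
    by (intro sum.cong refl sum.swap)
  also have "\<dots> = (\<Sum>l\<in>K. \<Sum>j\<in>K. yv z l $ a * yv z j $ b * P l j)"
    by (simp add: sum_distrib_left[symmetric] P_idem)
  also have "\<dots> = (\<Sum>k\<in>K. yv z k $ a * pv z k b)"
    by (simp add: pv_def sum_distrib_left ac_simps)
  finally show ?thesis by (simp add: wish_yp)
qed

lemma coord_poly_yv: "k \<in> K \<Longrightarrow> coord_poly (K \<times> UNIV) (\<lambda>z. yv z k $ a)"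
  by (simp add: yv_def matrix_vector_mult_def)
     (intro coord_poly_sum coord_poly.mult coord_poly.const coord_poly.coord; simp)

lemma coord_poly_pv: "coord_poly (K \<times> UNIV) (\<lambda>z. pv z k a)"
  unfolding pv_def by (intro coord_poly_sum coord_poly.mult coord_poly.const coord_poly_yv)

lemma coord_poly_wish: "coord_poly (K \<times> UNIV) (\<lambda>z. wish z $ a $ b)"
  unfolding wish_yp by (intro coord_poly_divide coord_poly_sum coord_poly.mult coord_poly_yv coord_poly_pv)

lemma yv_deriv:
  "((\<lambda>t. yv (z((k, c) := t)) l $ a) has_real_derivative (if l = k then A $ a $ c else 0)) (at t)"
proof -
  have eq: "(\<lambda>t. yv (z((k, c) := t)) l $ a) = (\<lambda>t. \<Sum>e\<in>UNIV. A $ a $ e * (if l = k \<and> e = c then t else z (l, e)))"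
    by (auto simp: yv_def matrix_vector_mult_def fun_eq_iff intro!: sum.cong)
  have "((\<lambda>t. A $ a $ e * (if l = k \<and> e = c then t else z (l, e)))
     has_real_derivative (if e = c then if l = k then A $ a $ c else 0 else 0)) (at t)" for e
    by (cases "l = k \<and> e = c") (auto intro!: derivative_eq_intros)
  then have "((\<lambda>t. \<Sum>e\<in>UNIV. A $ a $ e * (if l = k \<and> e = c then t else z (l, e))) has_real_derivative
     (\<Sum>e\<in>UNIV. if e = c then if l = k then A $ a $ c else 0 else 0)) (at t)"
    by (rule DERIV_sum)
  moreover have "(\<Sum>e\<in>UNIV. if e = c then if l = k then A $ a $ c else 0 else 0) = (if l = k then A $ a $ c else 0)"
    by simp
  ultimately show ?thesis unfolding eq by (simp only:)
qed

lemma pv_deriv: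
  assumes "k \<in> K"
  shows "((\<lambda>t. pv (z((k, c) := t)) l a) has_real_derivative P l k * A $ a $ c) (at t)"
proof -
  have "((\<lambda>t. pv (z((k, c) := t)) l a) has_real_derivative (\<Sum>j\<in>K. P l j * (if j = k then A $ a $ c else 0))) (at t)"
    unfolding pv_def by (intro DERIV_sum DERIV_cmult yv_deriv)
  then show ?thesis using assms K by (simp add: if_distrib cong: if_cong)
qed

text \<open>Both Y and P Y depend on the coordinate; the symmetry of P turns the contribution of the
  second factor into an entry of P Y as well.\<close>

lemma wish_deriv:
  assumes k: "k \<in> K"
  shows "((\<lambda>t. wish (z((k, c) := t)) $ a $ b) has_real_derivative
     (A $ a $ c * pv z k b + A $ b $ c * pv z k a) / T) (at (z (k, c)))"
proof -
  have "((\<lambda>t. yv (z((k, c) := t)) l $ a * pv (z((k, c) := t)) l b) has_real_derivative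
      (if l = k then A $ a $ c else 0) * pv z l b + P l k * A $ b $ c * yv z l $ a) (at (z (k, c)))" for l
    using DERIV_mult[OF yv_deriv[where t = "z (k, c)" and z = z and k = k and c = c and l = l and a = a]
       pv_deriv[OF k, where t = "z (k, c)" and z = z and c = c and l = l and a = b]]
    by (simp only: fun_upd_triv)
  then have "((\<lambda>t. wish (z((k, c) := t)) $ a $ b) has_real_derivative
     (\<Sum>l\<in>K. (if l = k then A $ a $ c else 0) * pv z l b + P l k * A $ b $ c * yv z l $ a) / T) (at (z (k, c)))"
    unfolding wish_yp
    by (intro DERIV_cdivide DERIV_sum)
  moreover have "(\<Sum>l\<in>K. (if l = k then A $ a $ c else 0) * pv z l b + P l k * A $ b $ c * yv z l $ a)
     = A $ a $ c * pv z k b + A $ b $ c * pv z k a"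
  proof -
    have "(\<Sum>l\<in>K. (if l = k then A $ a $ c else 0) * pv z l b) = (\<Sum>l\<in>K. if l = k then A $ a $ c * pv z k b else 0)"
      by (intro sum.cong) auto
    moreover have "(\<Sum>l\<in>K. P l k * A $ b $ c * yv z l $ a) = A $ b $ c * pv z k a"
      using k by (auto simp: pv_def sum_distrib_left P_sym[of _ k] intro!: sum.cong)
    ultimately show ?thesis using k K by (simp add: sum.distrib)
  qed
  ultimately show ?thesis by simp
qed

lemma psi_entry: "(\<Sum>c\<in>UNIV. A $ i $ c * A $ j $ c) = \<Psi> $ i $ j"
  unfolding A[symmetric] by (simp add: matrix_matrix_mult_def transpose_def)

text \<open>Expand one factor of the monomial in the coordinates \<open>z (k, c)\<close> and
  integrate each by parts. The derivative of the accompanying \<open>pv z k i\<close> produces the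
  mean term, that of the other factors the correction of order 1 / T.\<close>

lemma wish_stein:
  defines "Z \<equiv> std_normals (K \<times> (UNIV :: 'p set))"
  shows "(\<integral>z. wish z $ i $ j * entry_prod (wish z) xs \<partial>Z) = \<Psi> $ i $ j * (\<integral>z. entry_prod (wish z) xs \<partial>Z)
    + (1 / T) * (\<integral>z. dprod (wish z) (\<lambda>y. \<Psi> $ j $ fst y * wish z $ i $ snd y + \<Psi> $ j $ snd y * wish z $ i $ fst y) xs \<partial>Z)"
proof -
  let ?I = "K \<times> (UNIV :: 'p set)"
  let ?F = "\<lambda>z. entry_prod (wish z) xs"
  let ?\<phi> = "\<lambda>k c z y. (A $ fst y $ c * pv z k (snd y) + A $ snd y $ c * pv z k (fst y)) / T"
  let ?D = "\<lambda>k c z. dprod (wish z) (?\<phi> k c z) xs"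
  have pF: "coord_poly ?I ?F" by (intro coord_poly_entry_prod coord_poly_wish)
  have pD: "coord_poly ?I (?D k c)" for k c
    by (intro coord_poly_dprod coord_poly_wish coord_poly_divide coord_poly.add coord_poly.mult
        coord_poly.const coord_poly_pv)
  have step: "(\<integral>z. z (k, c) * (pv z k i * ?F z) \<partial>Z) = (\<integral>z. P k k * A $ i $ c * ?F z + pv z k i * ?D k c z \<partial>Z)"
    if k: "k \<in> K" for k c
    unfolding Z_def
  proof (rule std_normals_stein)
    fix z :: "'k \<times> 'p \<Rightarrow> real"
    have "((\<lambda>t. ?F (z((k, c) := t))) has_real_derivative dprod (wish (z((k, c) := z (k, c)))) (?\<phi> k c z) xs) (at (z (k, c)))"
      by (rule entry_prod_has_derivative) (use wish_deriv[OF k] in simp)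
    from DERIV_mult[OF pv_deriv[OF k, of z c k i] this]
    show "((\<lambda>y. pv (z((k, c) := y)) k i * ?F (z((k, c) := y))) has_real_derivative P k k * A $ i $ c * ?F z + pv z k i * ?D k c z) (at (z (k, c)))"
      by (simp add: ac_simps fun_upd_idem)
  qed (use K that in \<open>auto intro!: coord_poly.mult coord_poly.add coord_poly.const coord_poly_pv pF pD\<close>)
  have int: "integrable Z G" if "coord_poly ?I G" for G
    unfolding Z_def by (rule coord_poly_integrable[OF that])
  have "(\<integral>z. wish z $ i $ j * ?F z \<partial>Z) = (\<integral>z. (\<Sum>k\<in>K. \<Sum>c\<in>UNIV. (A $ j $ c / T) * (z (k, c) * (pv z k i * ?F z))) \<partial>Z)"
    by (intro Bochner_Integration.integral_cong refl)
       (simp add: wish_yp' yv_def matrix_vector_mult_def sum_distrib_right sum_distrib_left sum_divide_distrib ac_simps)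
  also have "\<dots> = (\<Sum>k\<in>K. \<Sum>c\<in>UNIV. (A $ j $ c / T) * (\<integral>z. z (k, c) * (pv z k i * ?F z) \<partial>Z))"
  proof -
    have i1: "integrable Z (\<lambda>z. (A $ j $ c / T) * (z (k, c) * (pv z k i * ?F z)))" if "k \<in> K" for k c
      by (rule int, intro coord_poly.mult coord_poly.const coord_poly_pv pF coord_poly.coord) (use that in auto)
    then show ?thesis
      by (subst Bochner_Integration.integral_sum, intro Bochner_Integration.integrable_sum, simp)
         (intro sum.cong refl, subst Bochner_Integration.integral_sum, auto)
  qed
  also have "\<dots> = (\<Sum>k\<in>K. \<Sum>c\<in>UNIV. (A $ j $ c / T) * (\<integral>z. P k k * A $ i $ c * ?F z + pv z k i * ?D k c z \<partial>Z))"
    by (intro sum.cong refl) (simp add: step)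
  also have "\<dots> = (\<Sum>k\<in>K. \<Sum>c\<in>UNIV. (\<integral>z. (A $ j $ c / T) * (P k k * A $ i $ c * ?F z + pv z k i * ?D k c z) \<partial>Z))"
    by simp
  also have "\<dots> = (\<integral>z. (\<Sum>k\<in>K. \<Sum>c\<in>UNIV. (A $ j $ c / T) * (P k k * A $ i $ c * ?F z + pv z k i * ?D k c z)) \<partial>Z)"
  proof -
    have i1: "integrable Z (\<lambda>z. (A $ j $ c / T) * (P k k * A $ i $ c * ?F z + pv z k i * ?D k c z))" for k c
      by (rule int, intro coord_poly.mult coord_poly.add coord_poly.const coord_poly_pv pF pD)
    then show ?thesis
      by (subst Bochner_Integration.integral_sum, intro Bochner_Integration.integrable_sum, simp)
         (intro sum.cong refl, subst Bochner_Integration.integral_sum, auto)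
  qed
  also have "\<dots> = (\<integral>z. \<Psi> $ i $ j * ?F z + (1 / T) * dprod (wish z) (\<lambda>y. \<Psi> $ j $ fst y * wish z $ i $ snd y + \<Psi> $ j $ snd y * wish z $ i $ fst y) xs \<partial>Z)"
  proof (intro Bochner_Integration.integral_cong refl)
    fix z
    have "(\<Sum>k\<in>K. \<Sum>c\<in>UNIV. (A $ j $ c / T) * (P k k * A $ i $ c * ?F z + pv z k i * ?D k c z))
      = (\<Sum>k\<in>K. \<Sum>c\<in>UNIV. (A $ i $ c * A $ j $ c) * (P k k * (?F z / T)))
        + (\<Sum>k\<in>K. \<Sum>c\<in>UNIV. (1 / T) * dprod (wish z) (\<lambda>y. A $ j $ c * pv z k i * ?\<phi> k c z y) xs)"
    proof -
      have "dprod (wish z) (\<lambda>y. A $ j $ c * pv z k i * ?\<phi> k c z y) xs = A $ j $ c * pv z k i * ?D k c z" for k c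
        by (rule dprod_cmult)
      then show ?thesis
        by (simp only:) (simp add: sum.distrib[symmetric] algebra_simps)
    qed
    \<comment> \<open>The sum over \<open>c\<close> gives an entry of A A^t = \<Psi>, the sum over
      \<open>k\<close> the trace of P, which is T and cancels the normalisation.\<close>
    also have "(\<Sum>k\<in>K. \<Sum>c\<in>UNIV. (A $ i $ c * A $ j $ c) * (P k k * (?F z / T))) = \<Psi> $ i $ j * ?F z"
    proof -
      have "(\<Sum>k\<in>K. \<Sum>c\<in>UNIV. (A $ i $ c * A $ j $ c) * (P k k * (?F z / T)))
        = (\<Sum>k\<in>K. P k k) * (\<Psi> $ i $ j * (?F z / T))"
        unfolding sum_distrib_right[symmetric] psi_entry by (simp add: sum_distrib_right sum_distrib_left sum_divide_distrib ac_simps)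
      then show ?thesis using T_pos by (simp add: T_def[symmetric])
    qed
    also have "(\<Sum>k\<in>K. \<Sum>c\<in>UNIV. (1 / T) * dprod (wish z) (\<lambda>y. A $ j $ c * pv z k i * ?\<phi> k c z y) xs)
       = (1 / T) * dprod (wish z) (\<lambda>y. \<Sum>k\<in>K. \<Sum>c\<in>UNIV. A $ j $ c * pv z k i * ?\<phi> k c z y) xs"
      by (simp add: dprod_sum sum_distrib_left)
    also have "dprod (wish z) (\<lambda>y. \<Sum>k\<in>K. \<Sum>c\<in>UNIV. A $ j $ c * pv z k i * ?\<phi> k c z y) xs
       = dprod (wish z) (\<lambda>y. \<Psi> $ j $ fst y * wish z $ i $ snd y + \<Psi> $ j $ snd y * wish z $ i $ fst y) xs"
    proof (rule dprod_cong)
      \<comment> \<open>Here the sum over \<open>k\<close> of products of \<open>pv\<close> is an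
        entry of \<open>wish\<close> by \<open>wish_pp\<close>; the recursion closes because P is
        idempotent.\<close>
      fix y :: "'p \<times> 'p"
      have "(\<Sum>c\<in>UNIV. A $ j $ c * pv z k i * ?\<phi> k c z y) =
         (\<Sum>c\<in>UNIV. A $ j $ c * A $ fst y $ c) * (pv z k i * pv z k (snd y) / T)
         + (\<Sum>c\<in>UNIV. A $ j $ c * A $ snd y $ c) * (pv z k i * pv z k (fst y) / T)" for k
        unfolding sum_distrib_right sum.distrib[symmetric]
        by (intro sum.cong refl) (simp add: algebra_simps add_divide_distrib)
      then have "(\<Sum>k\<in>K. \<Sum>c\<in>UNIV. A $ j $ c * pv z k i * ?\<phi> k c z y) =
         (\<Sum>k\<in>K. \<Psi> $ j $ fst y * (pv z k i * pv z k (snd y) / T)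
         + \<Psi> $ j $ snd y * (pv z k i * pv z k (fst y) / T))"
        by (simp add: psi_entry)
      then show "(\<Sum>k\<in>K. \<Sum>c\<in>UNIV. A $ j $ c * pv z k i * ?\<phi> k c z y) = \<Psi> $ j $ fst y * wish z $ i $ snd y + \<Psi> $ j $ snd y * wish z $ i $ fst y"
        by (simp add: sum.distrib wish_pp sum_distrib_left sum_divide_distrib)
    qed
    finally show "(\<Sum>k\<in>K. \<Sum>c\<in>UNIV. (A $ j $ c / T) * (P k k * A $ i $ c * ?F z + pv z k i * ?D k c z))
      = \<Psi> $ i $ j * ?F z + (1 / T) * dprod (wish z) (\<lambda>y. \<Psi> $ j $ fst y * wish z $ i $ snd y + \<Psi> $ j $ snd y * wish z $ i $ fst y) xs" .
  qed
  also have "\<dots> = \<Psi> $ i $ j * (\<integral>z. ?F z \<partial>Z)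
    + (1 / T) * (\<integral>z. dprod (wish z) (\<lambda>y. \<Psi> $ j $ fst y * wish z $ i $ snd y + \<Psi> $ j $ snd y * wish z $ i $ fst y) xs \<partial>Z)"
  proof -
    have "integrable Z (\<lambda>z. dprod (wish z) (\<lambda>y. \<Psi> $ j $ fst y * wish z $ i $ snd y + \<Psi> $ j $ snd y * wish z $ i $ fst y) xs)"
      by (rule int, intro coord_poly_dprod coord_poly_wish coord_poly.add coord_poly.mult coord_poly.const)
    then show ?thesis
      using int[OF pF] by simp
  qed
  finally show ?thesis .
qed

lemma integral_entry_prod_wish:
  "(\<integral>z. entry_prod (wish z) xs \<partial>std_normals (K \<times> (UNIV :: 'p set))) = wmom (1 / T) \<Psi> xs"
proof (induction "length xs" arbitrary: xs rule: less_induct)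
  case less
  let ?Z = "std_normals (K \<times> (UNIV :: 'p set))"
  interpret Z: prob_space ?Z by (rule prob_space_std_normals)
  show ?case
  proof (cases xs)
    case Nil
    then show ?thesis by (simp add: Z.prob_space)
  next
    case (Cons x us)
    obtain i j where x: "x = (i, j)" by (cases x)
    have IH: "(\<integral>z. entry_prod (wish z) zs \<partial>?Z) = wmom (1 / T) \<Psi> zs" if "length zs = length us" for zs
      using less[of zs] Cons that by simp
    have int: "integrable ?Z (\<lambda>z. entry_prod (wish z) zs)" for zs
      by (rule coord_poly_integrable) (intro coord_poly_entry_prod coord_poly_wish)
    have "(\<integral>z. dprod (wish z) (\<lambda>y. \<Psi> $ j $ fst y * wish z $ i $ snd y + \<Psi> $ j $ snd y * wish z $ i $ fst y) us \<partial>?Z)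
      = (\<Sum>q<length us. \<Psi> $ j $ fst (us ! q) * wmom (1 / T) \<Psi> (us[q := (i, snd (us ! q))])
                       + \<Psi> $ j $ snd (us ! q) * wmom (1 / T) \<Psi> (us[q := (i, fst (us ! q))]))"
      unfolding sum_update_entry_prod[symmetric]
      by (subst Bochner_Integration.integral_sum) (simp_all add: int IH)
    then show ?thesis
      using wish_stein[of i j us] by (simp add: Cons x IH)
  qed
qed

end

text \<open>The transfer from standard normals: under the linear map of
  \<open>pos_def_factor\<close> the scatter matrix of the centred observations becomes
  \<open>wish\<close>, whatever \<open>\<mu>\<close> is.\<close>

lemma
  fixes \<Psi> :: "('p::finite) rmat" and \<mu> :: "'p rvec"
  assumes pd: "pos_def \<Psi>"
  defines "M \<equiv> PiM K (\<lambda>_. multi_normal \<mu> \<Psi>)"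
  shows prob_space_PiM_multi_normal: "prob_space M"
    and integrable_entry_prod_scatter: "integrable M (\<lambda>x. entry_prod ((1 / T) *\<^sub>R scatter K P (\<lambda>k. x k - \<mu>)) xs)"
    and integral_entry_prod_scatter: "(\<integral>x. entry_prod ((1 / T) *\<^sub>R scatter K P (\<lambda>k. x k - \<mu>)) xs \<partial>M) = wmom (1 / T) \<Psi> xs"
proof -
  obtain A :: "'p rmat" where A: "A ** transpose A = \<Psi>" "invertible A" using pos_def_factor[OF pd] by blast
  let ?Z = "std_normals (K \<times> (UNIV :: 'p set))"
  let ?X = "\<lambda>z. \<lambda>k\<in>K. \<mu> + A *v (\<chi> i. z (k, i))"
  let ?g = "\<lambda>x. entry_prod ((1 / T) *\<^sub>R scatter K P (\<lambda>k. x k - \<mu>)) xs"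
  interpret Z: prob_space ?Z by (rule prob_space_std_normals)
  have M: "M = distr ?Z (PiM K (\<lambda>_. borel)) ?X"
    unfolding M_def by (rule PiM_multi_normal_eq_distr[OF A K(2)])
  have X [measurable]: "?X \<in> measurable ?Z (PiM K (\<lambda>_. borel))"
    by (rule measurable_restrict) (rule PiM_multi_normal_eq_distr(2)[OF A K(2)])
  show "prob_space M" unfolding M by (rule Z.prob_space_distr[OF X])
  have g [measurable]: "?g \<in> borel_measurable (PiM K (\<lambda>_. borel))"
  proof (induction xs)
    case (Cons x xs)
    obtain a b where x: "x = (a, b)" by (cases x)
    have "(\<lambda>x. x k $ c) \<in> borel_measurable (PiM K (\<lambda>_. borel :: 'p rvec measure))" if "k \<in> K" for k c
      by (rule measurable_compose[OF measurable_component_singleton[OF that]]) measurable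
    then have "(\<lambda>x. ((1 / T) *\<^sub>R scatter K P (\<lambda>k. x k - \<mu>)) $ a $ b) \<in> borel_measurable (PiM K (\<lambda>_. borel))"
      unfolding scatter_def by (auto intro!: borel_measurable_sum borel_measurable_times borel_measurable_divide borel_measurable_diff)
    then show ?case unfolding x entry_prod_simps by (intro borel_measurable_times Cons)
  qed simp
  have gX: "?g (?X z) = entry_prod (wish A z) xs" for z
  proof -
    have "scatter K P (\<lambda>k. ?X z k - \<mu>) = scatter K P (yv A z)"
      unfolding scatter_def yv_def[OF A(1)] by (auto simp: vec_eq_iff intro!: sum.cong)
    then show ?thesis by (simp add: wish_def[OF A(1)])
  qed
  show "integrable M ?g"
    unfolding M
    by (subst integrable_distr_eq[OF X g], unfold gX, rule coord_poly_integrable)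
       (intro coord_poly_entry_prod coord_poly_wish[OF A(1)])
  show "(\<integral>x. ?g x \<partial>M) = wmom (1 / T) \<Psi> xs"
    unfolding M by (subst integral_distr[OF X g], unfold gX, rule integral_entry_prod_wish[OF A(1)])
qed

end

section \<open>Mean and variance of polynomials of a Wishart matrix\<close>

text \<open>The quadratic form G^t C G, where C is the covariance matrix of the entries (i \<le> j)
  of (X - \<mu>)(X - \<mu>)^t for one observation, or equally of sqrt(n) S for n degrees of freedom.
  The nesting follows the nested \<open>dprod\<close> of \<open>wmom_covariance\<close>.\<close>

definition asym_var :: "('p::{finite, linorder}) rmat \<Rightarrow> 'p upper rvec \<Rightarrow> real" where
  "asym_var \<Psi> G = G \<bullet> upper_entries (\<chi> i j. G \<bullet> upper_entries (\<chi> a b. wkernel \<Psi> (i, j) (a, b)))"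

lemma sum_upper:
  fixes g :: "('p::{finite, linorder}) \<times> 'p \<Rightarrow> real"
  shows "(\<Sum>e\<in>UNIV. G $ e * g (Rep_upper e)) = (\<Sum>x\<in>UNIV. (if fst x \<le> snd x then G $ Abs_upper x else 0) * g x)"
proof -
  have r: "range Rep_upper = {x :: 'p \<times> 'p. fst x \<le> snd x}"
    using type_definition.Rep_range[OF type_definition_upper] by auto
  have inj: "inj (Rep_upper :: 'p upper \<Rightarrow> 'p \<times> 'p)" by (simp add: inj_def Rep_upper_inject)
  have "(\<Sum>x\<in>UNIV. (if fst x \<le> snd x then G $ Abs_upper x else 0) * g x) = (\<Sum>x\<in>range Rep_upper. G $ Abs_upper x * g x)"
    unfolding r by (intro sum.mono_neutral_cong_right) auto
  also have "\<dots> = (\<Sum>e\<in>UNIV. G $ e * g (Rep_upper e))"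
    by (simp add: sum.reindex[OF inj] Rep_upper_inverse)
  finally show ?thesis ..
qed

lemma sum_bilinear_factor:
  fixes g :: "'x::finite \<Rightarrow> real"
  shows "(\<Sum>p\<in>UNIV. \<Sum>q\<in>UNIV. g p * (g q * (\<Sum>r\<in>UNIV. h1 p r * h2 q r)))
    = (\<Sum>r\<in>(UNIV::'r::finite set). (\<Sum>p\<in>UNIV. g p * h1 p r) * (\<Sum>q\<in>UNIV. g q * h2 q r))"
proof -
  have "(\<Sum>p\<in>UNIV. \<Sum>q\<in>UNIV. g p * (g q * (\<Sum>r\<in>UNIV. h1 p r * h2 q r)))
    = (\<Sum>p\<in>UNIV. \<Sum>q\<in>UNIV. \<Sum>r\<in>UNIV. g p * h1 p r * (g q * h2 q r))"
    by (simp add: sum_distrib_left ac_simps)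
  also have "\<dots> = (\<Sum>p\<in>UNIV. \<Sum>r\<in>UNIV. \<Sum>q\<in>UNIV. g p * h1 p r * (g q * h2 q r))"
    by (intro sum.cong refl sum.swap)
  also have "\<dots> = (\<Sum>r\<in>UNIV. \<Sum>p\<in>UNIV. \<Sum>q\<in>UNIV. g p * h1 p r * (g q * h2 q r))"
    by (rule sum.swap)
  finally show ?thesis by (simp add: sum_product)
qed

text \<open>With \<open>\<Psi> = A A\<^sup>t\<close>, \<open>G\<close> read as an upper triangular matrix and \<open>B = A\<^sup>t G A\<close>, the asymptotic variance
  is \<open>\<parallel>B + B\<^sup>t\<parallel>\<^sup>2 / 2\<close> in the Frobenius norm.\<close>

lemma asym_var_pos:
  fixes \<Psi> :: "('p::{finite, linorder}) rmat"
  assumes pd: "pos_def \<Psi>" and G: "G \<noteq> 0"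
  shows "asym_var \<Psi> G > 0"
proof -
  obtain A :: "'p rmat" where A: "A ** transpose A = \<Psi>" "invertible A" using pos_def_factor[OF pd] by blast
  define g where "g x = (if fst x \<le> snd x then G $ Abs_upper x else 0)" for x :: "'p \<times> 'p"
  define B where "B c d = (\<Sum>x\<in>UNIV. g x * (A $ fst x $ c * A $ snd x $ d))" for c d
  have \<Psi>: "\<Psi> $ i $ j = (\<Sum>c\<in>UNIV. A $ i $ c * A $ j $ c)" for i j
    unfolding A(1)[symmetric] by (simp add: matrix_matrix_mult_def transpose_def)
  \<comment> \<open>For every pair \<open>r\<close> of columns of \<open>A\<close> the product
    separates into a factor in (i, k) and one in (j, l). With the index pattern of
    \<open>wkernel\<close> these depend on \<open>x\<close> only and on \<open>y\<close> only, so
    the double sum factors through \<open>B\<close>.\<close>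
  have \<Psi>\<Psi>: "\<Psi> $ i $ j * \<Psi> $ k $ l = (\<Sum>r\<in>UNIV. (A $ i $ fst r * A $ k $ snd r) * (A $ j $ fst r * A $ l $ snd r))" for i j k l
    unfolding \<Psi> sum_product UNIV_Times_UNIV[symmetric] sum.cartesian_product
    by (intro sum.cong) auto
  have "asym_var \<Psi> G = (\<Sum>x\<in>UNIV. g x * (\<Sum>y\<in>UNIV. g y * wkernel \<Psi> x y))"
    unfolding asym_var_def inner_vec_def upper_entries_nth inner_real_def vec_lambda_beta prod.collapse
    using sum_upper[of G "\<lambda>x. (\<Sum>e\<in>UNIV. G $ e * wkernel \<Psi> x (Rep_upper e))"]
    by (simp add: sum_upper[of G "wkernel \<Psi> _"] g_def[symmetric])
  also have "\<dots> = (\<Sum>x\<in>UNIV. \<Sum>y\<in>UNIV. g x * (g y * (\<Psi> $ snd x $ fst y * \<Psi> $ fst x $ snd y)))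
      + (\<Sum>x\<in>UNIV. \<Sum>y\<in>UNIV. g x * (g y * (\<Psi> $ snd x $ snd y * \<Psi> $ fst x $ fst y)))"
    by (simp add: wkernel_def sum.distrib[symmetric] sum_distrib_left algebra_simps)
  also have "\<dots> = (\<Sum>r\<in>UNIV. B (snd r) (fst r) * B (fst r) (snd r)) + (\<Sum>r\<in>UNIV. B (snd r) (fst r) * B (snd r) (fst r))"
    unfolding \<Psi>\<Psi> sum_bilinear_factor B_def by (simp add: ac_simps)
  also have "\<dots> = (\<Sum>r\<in>UNIV. (B (snd r) (fst r))\<^sup>2 + B (fst r) (snd r) * B (snd r) (fst r))"
    by (simp add: sum.distrib power2_eq_square ac_simps)
  also have "\<dots> = (\<Sum>r\<in>UNIV. (B (fst r) (snd r) + B (snd r) (fst r))\<^sup>2) / 2"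
  proof -
    have sw: "(\<Sum>r\<in>UNIV. (B (fst r) (snd r))\<^sup>2) = (\<Sum>r\<in>UNIV. (B (snd r) (fst r))\<^sup>2)"
      using sum.reindex[of prod.swap "UNIV :: ('p \<times> 'p) set" "\<lambda>r. (B (snd r) (fst r))\<^sup>2"] by simp
    then show ?thesis by (simp add: power2_sum sum.distrib sum_distrib_left[symmetric] ac_simps)
  qed
  finally have eq: "asym_var \<Psi> G = (\<Sum>r\<in>UNIV. (B (fst r) (snd r) + B (snd r) (fst r))\<^sup>2) / 2" .
  show ?thesis
  proof (rule ccontr)
    assume "\<not> asym_var \<Psi> G > 0"
    then have "(\<Sum>r\<in>UNIV. (B (fst r) (snd r) + B (snd r) (fst r))\<^sup>2) = 0"
      unfolding eq by (intro antisym sum_nonneg) auto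
    then have z: "B c d + B d c = 0" for c d
      by (subst (asm) sum_nonneg_eq_0_iff) (auto dest!: bspec[of _ _ "(c, d)"])
    \<comment> \<open>\<open>H\<close> is G + G^t, so A^t H A = B + B^t, and invertibility of
      \<open>A\<close> gives \<open>H = 0\<close>. Below the diagonal \<open>g\<close> vanishes and
      on it \<open>H\<close> is twice \<open>g\<close>, so \<open>G = 0\<close> follows.\<close>
    define H :: "'p rmat" where "H = (\<chi> i j. g (i, j) + g (j, i))"
    have "(transpose A ** (H ** A)) $ c $ d = B c d + B d c" for c d
    proof -
      have "(transpose A ** (H ** A)) $ c $ d = (\<Sum>i\<in>UNIV. \<Sum>j\<in>UNIV. g (i, j) * (A $ i $ c * A $ j $ d))
         + (\<Sum>i\<in>UNIV. \<Sum>j\<in>UNIV. g (j, i) * (A $ i $ c * A $ j $ d))"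
        by (simp add: matrix_matrix_mult_def transpose_def H_def sum_distrib_left sum.distrib[symmetric] algebra_simps)
      also have "(\<Sum>i\<in>UNIV. \<Sum>j\<in>UNIV. g (j, i) * (A $ i $ c * A $ j $ d)) = (\<Sum>i\<in>UNIV. \<Sum>j\<in>UNIV. g (i, j) * (A $ j $ c * A $ i $ d))"
        by (rule sum.swap)
      also have "(\<Sum>i\<in>UNIV. \<Sum>j\<in>UNIV. g (i, j) * (A $ i $ c * A $ j $ d)) = B c d"
        unfolding B_def UNIV_Times_UNIV[symmetric] by (simp add: sum.cartesian_product case_prod_unfold)
      also have "(\<Sum>i\<in>UNIV. \<Sum>j\<in>UNIV. g (i, j) * (A $ j $ c * A $ i $ d)) = B d c"
        unfolding B_def UNIV_Times_UNIV[symmetric] by (simp add: sum.cartesian_product case_prod_unfold ac_simps)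
      finally show ?thesis .
    qed
    then have "transpose A ** (H ** A) = 0" using z by (simp add: vec_eq_iff)
    moreover obtain C where C: "A ** C = mat 1" "C ** A = mat 1" using A(2) by (auto simp: invertible_def)
    ultimately have "transpose C ** (transpose A ** (H ** A)) ** C = 0" by simp
    then have "transpose C ** transpose A ** H ** (A ** C) = 0" by (simp add: matrix_mul_assoc)
    then have H: "H = 0" using C by (simp add: matrix_transpose_mul[symmetric])
    have "G $ e = 0" for e
    proof -
      obtain i j where ij: "Rep_upper e = (i, j)" by (cases "Rep_upper e")
      then have "i \<le> j" using fst_le_snd_Rep_upper[of e] by simp
      moreover have "Abs_upper (i, j) = e" using ij Rep_upper_inverse[of e] by simp
      moreover have "H $ i $ j = 0" using H by simp
      ultimately show "G $ e = 0" unfolding H_def g_def by (cases "i = j") auto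
    qed
    then show False using G by (simp add: vec_eq_iff)
  qed
qed

section \<open>Gradients in the variance expansion\<close>

lemma entry_prod_has_fderivative:
  "((\<lambda>u. entry_prod (sym_mat u) xs) has_derivative (\<lambda>h. dprod (sym_mat u) (\<lambda>x. sym_mat h $ fst x $ snd x) xs)) (at u)"
proof (induction xs)
  case (Cons x xs)
  obtain a b where x: "x = (a, b)" by (cases x)
  have l: "((\<lambda>u. sym_mat u $ a $ b) has_derivative (\<lambda>h. sym_mat h $ a $ b)) (at u)"
    unfolding sym_mat_def by (simp add: bounded_linear_imp_has_derivative bounded_linear_vec_nth)
  show ?case
    using has_derivative_mult[OF l Cons] by (simp add: x ac_simps add.commute)
qed simp

text \<open>Uniqueness of the derivative identifies the formal Leibniz derivative of any
  representation of \<open>f\<close> by monomials with the gradient.\<close>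

lemma has_derivative_entry_sum:
  fixes f :: "('p::{finite,linorder}) upper rvec \<Rightarrow> real"
  assumes f: "\<And>u. f u = (\<Sum>i<n. c i * entry_prod (sym_mat u) (xs i))" and G: "GDERIV f u :> G"
  shows "(\<Sum>i<n. c i * dprod (sym_mat u) (\<lambda>x. sym_mat h $ fst x $ snd x) (xs i)) = G \<bullet> h"
proof -
  have "f = (\<lambda>u. \<Sum>i<n. c i * entry_prod (sym_mat u) (xs i))" using f by auto
  then have "(f has_derivative (\<lambda>h. \<Sum>i<n. c i * dprod (sym_mat u) (\<lambda>x. sym_mat h $ fst x $ snd x) (xs i))) (at u)"
    by (auto intro!: has_derivative_sum has_derivative_mult_right entry_prod_has_fderivative)
  moreover have "(f has_derivative (\<lambda>h. h \<bullet> G)) (at u)" using G by (simp add: gderiv_def)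
  ultimately have "(\<lambda>h. \<Sum>i<n. c i * dprod (sym_mat u) (\<lambda>x. sym_mat h $ fst x $ snd x) (xs i)) = (\<lambda>h. h \<bullet> G)"
    by (rule has_derivative_unique)
  then show ?thesis by (metis inner_commute)
qed

text \<open>The gradient is applied twice: to the second list in the direction \<open>W x\<close>,
  then to the first in the resulting direction \<open>V\<close>. Both are symmetric matrices, as
  directions in the variables \<psi>_ij with i \<le> j have to be.\<close>

lemma entry_sum_asym_var:
  fixes f :: "('p::{finite,linorder}) upper rvec \<Rightarrow> real"
  assumes f: "\<And>u. f u = (\<Sum>i<n. c i * entry_prod (sym_mat u) (xs i))" and G: "GDERIV f u :> G"
  shows "(\<Sum>i<n. \<Sum>j<n. c i * c j * dprod (sym_mat u) (\<lambda>x. dprod (sym_mat u) (wkernel (sym_mat u) x) (xs j)) (xs i))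
    = asym_var (sym_mat u) G"
proof -
  let ?\<Psi> = "sym_mat u"
  have dG: "(\<Sum>i<n. c i * dprod ?\<Psi> (\<lambda>x. W $ fst x $ snd x) (xs i)) = G \<bullet> upper_entries W"
    if "\<And>i j. W $ i $ j = W $ j $ i" for W
    using has_derivative_entry_sum[OF f G, of "upper_entries W"] by (simp add: sym_mat_upper_entries[OF that])
  define W where "W x = (\<chi> a b. wkernel ?\<Psi> x (a, b))" for x
  have Wsym: "W x $ a $ b = W x $ b $ a" for x a b
    by (simp add: W_def wkernel_def)
  define V where "V = (\<chi> i j. G \<bullet> upper_entries (W (i, j)))"
  have "W (i, j) = W (j, i)" for i j
    by (simp add: W_def wkernel_def vec_eq_iff mult.commute add.commute)
  then have Vsym: "V $ a $ b = V $ b $ a" for a b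
    by (simp add: V_def)
  have "(\<Sum>i<n. \<Sum>j<n. c i * c j * dprod ?\<Psi> (\<lambda>x. dprod ?\<Psi> (wkernel ?\<Psi> x) (xs j)) (xs i))
    = (\<Sum>i<n. c i * dprod ?\<Psi> (\<lambda>x. \<Sum>j<n. c j * dprod ?\<Psi> (wkernel ?\<Psi> x) (xs j)) (xs i))"
    by (simp add: dprod_sum dprod_cmult sum_distrib_left ac_simps)
  also have "\<dots> = (\<Sum>i<n. c i * dprod ?\<Psi> (\<lambda>x. V $ fst x $ snd x) (xs i))"
  proof (intro sum.cong refl arg_cong2[where f="(*)"] dprod_cong)
    fix x :: "'p \<times> 'p"
    have "(\<Sum>j<n. c j * dprod ?\<Psi> (wkernel ?\<Psi> x) (xs j)) = (\<Sum>j<n. c j * dprod ?\<Psi> (\<lambda>y. W x $ fst y $ snd y) (xs j))"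
      by (intro sum.cong refl arg_cong2[where f="(*)"] dprod_cong) (simp add: W_def)
    also have "\<dots> = V $ fst x $ snd x"
      by (subst dG[OF Wsym]) (simp add: V_def)
    finally show "(\<Sum>j<n. c j * dprod ?\<Psi> (wkernel ?\<Psi> x) (xs j)) = V $ fst x $ snd x" .
  qed
  also have "\<dots> = G \<bullet> upper_entries V" by (rule dG[OF Vsym])
  finally show ?thesis by (simp add: asym_var_def V_def W_def)
qed

lemma (in projection_kernel) scatter_sym: "scatter K P y $ a $ b = scatter K P y $ b $ a"
proof -
  have "(\<Sum>k\<in>K. \<Sum>l\<in>K. P k l * (y k $ a * y l $ b)) = (\<Sum>l\<in>K. \<Sum>k\<in>K. P k l * (y k $ a * y l $ b))"
    by (rule sum.swap)
  also have "\<dots> = (\<Sum>k\<in>K. \<Sum>l\<in>K. P k l * (y k $ b * y l $ a))"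
    by (auto simp: P_sym ac_simps intro!: sum.cong)
  finally show ?thesis by (simp add: scatter_def)
qed

text \<open>\<open>m\<close> and \<open>V\<close> depend on \<open>f\<close> only and serve all
  projections, means and covariances simultaneously. This uniformity makes the variance a polynomial
  in \<Psi> for fixed T and allows t to tend to 0.\<close>

locale moment_expansion =
  fixes f :: "('p::{finite,linorder}) upper rvec \<Rightarrow> real" and m V :: "'p pt \<Rightarrow> real"
  assumes m_poly: "real_polynomial_function m" and V_poly: "real_polynomial_function V"
    and integrable_f: "\<And>(K :: nat set) P T \<Psi> \<mu>. projection_kernel K P T \<Longrightarrow> pos_def \<Psi> \<Longrightarrow>
       integrable (PiM K (\<lambda>_. multi_normal \<mu> \<Psi>)) (\<lambda>x. f (upper_entries ((1 / T) *\<^sub>R scatter K P (\<lambda>k. x k - \<mu>))))"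
    and integrable_f_square: "\<And>(K :: nat set) P T \<Psi> \<mu>. projection_kernel K P T \<Longrightarrow> pos_def \<Psi> \<Longrightarrow>
       integrable (PiM K (\<lambda>_. multi_normal \<mu> \<Psi>)) (\<lambda>x. (f (upper_entries ((1 / T) *\<^sub>R scatter K P (\<lambda>k. x k - \<mu>))))\<^sup>2)"
    and mean_f: "\<And>(K :: nat set) P T \<Psi> \<mu>. projection_kernel K P T \<Longrightarrow> pos_def \<Psi> \<Longrightarrow>
       (\<integral>x. f (upper_entries ((1 / T) *\<^sub>R scatter K P (\<lambda>k. x k - \<mu>))) \<partial>PiM K (\<lambda>_. multi_normal \<mu> \<Psi>))
         = f (upper_entries \<Psi>) + (1 / T) * m (upper_entries \<Psi>, 1 / T)"
    and variance_f: "\<And>(K :: nat set) P T \<Psi> \<mu>. projection_kernel K P T \<Longrightarrow> pos_def \<Psi> \<Longrightarrow>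
       prob_space.variance (PiM K (\<lambda>_. multi_normal \<mu> \<Psi>)) (\<lambda>x. f (upper_entries ((1 / T) *\<^sub>R scatter K P (\<lambda>k. x k - \<mu>))))
         = (1 / T) * V (upper_entries \<Psi>, 1 / T)"
    and V_0: "\<And>u G. GDERIV f u :> G \<Longrightarrow> V (u, 0) = asym_var (sym_mat u) G"

lemma polynomial_moments:
  fixes f :: "('p::{finite,linorder}) upper rvec \<Rightarrow> real"
  assumes "real_polynomial_function f"
  shows "\<exists>m V. moment_expansion f m V"
proof -
  obtain c xs and n :: nat where feq: "f = (\<lambda>u. \<Sum>i<n. c i * entry_prod (sym_mat u) (xs i))"
    by (rule real_polynomial_entry_sum[OF assms]) (rule that)
  have f: "f u = (\<Sum>i<n. c i * entry_prod (sym_mat u) (xs i))" for u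
    by (simp only: feq)
  let ?W = "\<lambda>xs (z::'p pt). wmom (snd z) (sym_mat (fst z)) xs"
  let ?c = "\<lambda>i j (z::'p pt). dprod (sym_mat (fst z)) (\<lambda>x. dprod (sym_mat (fst z)) (wkernel (sym_mat (fst z)) x) (xs j)) (xs i)"
  have "\<exists>Q. \<forall>i. real_polynomial_function (Q i) \<and> (\<forall>z. ?W (xs i) z - entry_prod (sym_mat (fst z)) (xs i) = snd z * Q i z)"
    by (intro choice allI) (rule wmom_minus_entry_prod[unfolded vanish_def power_one_right])
  then obtain Q where Q: "\<And>i. real_polynomial_function (Q i)"
    "\<And>i z. ?W (xs i) z - entry_prod (sym_mat (fst z)) (xs i) = snd z * Q i z" by blast
  have "\<forall>i. \<exists>R. \<forall>j. real_polynomial_function (R j) \<and> (\<forall>z. ?W (xs i @ xs j) z - ?W (xs i) z * ?W (xs j) z - snd z * ?c i j z = (snd z)\<^sup>2 * R j z)"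
    using wmom_covariance by (intro allI choice) (simp add: vanish_def)
  then obtain R where R: "\<And>i j. real_polynomial_function (R i j)"
    "\<And>i j z. ?W (xs i @ xs j) z - ?W (xs i) z * ?W (xs j) z - snd z * ?c i j z = (snd z)\<^sup>2 * R i j z" by metis
  \<comment> \<open>\<open>Q\<close> and \<open>R\<close> are the quotients of the moment errors by
    t and of the covariance errors by t^2, so \<open>m\<close> is the exact bias divided by t and
    \<open>V\<close> the exact variance divided by t.\<close>
  define m where "m z = (\<Sum>i<n. c i * Q i z)" for z
  define V where "V z = (\<Sum>i<n. \<Sum>j<n. c i * c j * (?c i j z + snd z * R i j z))" for z
  have "moment_expansion f m V"
  proof (rule moment_expansion.intro)
    show "real_polynomial_function m"
      unfolding m_def by (intro real_polynomial_function_sum rpf_mult rpf_const Q) simp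
    show "real_polynomial_function V"
      unfolding V_def
      by (intro real_polynomial_function_sum rpf_mult rpf_const rpf_add R real_polynomial_function_snd
          real_polynomial_dprod real_polynomial_wkernel) simp_all
    show "V (u, 0) = asym_var (sym_mat u) G" if "GDERIV f u :> G" for u G
      using entry_sum_asym_var[OF f that] by (simp add: V_def)
  next
    fix K :: "nat set" and P T and \<Psi> :: "'p rmat" and \<mu>
    assume "projection_kernel K P T" and pd: "pos_def \<Psi>"
    interpret projection_kernel K P T by fact
    let ?M = "PiM K (\<lambda>_. multi_normal \<mu> \<Psi>)"
    interpret M: prob_space ?M by (rule prob_space_PiM_multi_normal[OF pd])
    let ?S = "\<lambda>x. (1 / T) *\<^sub>R scatter K P (\<lambda>k. x k - \<mu>)"
    let ?z = "(upper_entries \<Psi>, 1 / T)"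
    have S: "sym_mat (upper_entries (?S x)) = ?S x" for x
      by (rule sym_mat_upper_entries) (simp add: scatter_sym)
    have \<Psi>s: "sym_mat (upper_entries \<Psi>) = \<Psi>"
    proof (rule sym_mat_upper_entries)
      have "transpose \<Psi> = \<Psi>" using pd by (simp add: pos_def_def)
      then show "\<Psi> $ i $ j = \<Psi> $ j $ i" for i j by (metis transpose_def vec_lambda_beta)
    qed
    have fS: "f (upper_entries (?S x)) = (\<Sum>i<n. c i * entry_prod (?S x) (xs i))" for x
      by (simp only: f S)
    have fS2: "(f (upper_entries (?S x)))\<^sup>2 = (\<Sum>i<n. \<Sum>j<n. c i * c j * entry_prod (?S x) (xs i @ xs j))" for x
      unfolding fS power2_eq_square sum_product by (simp add: ac_simps)
    note int = integrable_entry_prod_scatter[OF pd, of \<mu>]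
    show i1: "integrable ?M (\<lambda>x. f (upper_entries (?S x)))"
      unfolding fS by (intro Bochner_Integration.integrable_sum integrable_mult_right int)
    show i2: "integrable ?M (\<lambda>x. (f (upper_entries (?S x)))\<^sup>2)"
      unfolding fS2 by (intro Bochner_Integration.integrable_sum integrable_mult_right int)
    have E1: "(\<integral>x. f (upper_entries (?S x)) \<partial>?M) = (\<Sum>i<n. c i * ?W (xs i) ?z)"
      unfolding fS
      by (subst Bochner_Integration.integral_sum, intro integrable_mult_right int)
         (simp add: integral_entry_prod_scatter[OF pd] \<Psi>s)
    have E2: "(\<integral>x. (f (upper_entries (?S x)))\<^sup>2 \<partial>?M) = (\<Sum>i<n. \<Sum>j<n. c i * c j * ?W (xs i @ xs j) ?z)"
      unfolding fS2
      by (subst Bochner_Integration.integral_sum, intro Bochner_Integration.integrable_sum integrable_mult_right int,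
          subst Bochner_Integration.integral_sum, intro integrable_mult_right int)
         (simp add: integral_entry_prod_scatter[OF pd] \<Psi>s del: entry_prod_simps)
    have "?W (xs i) ?z = entry_prod \<Psi> (xs i) + (1 / T) * Q i ?z" for i
      using Q(2)[where i = i and z = ?z] by (simp add: \<Psi>s algebra_simps)
    then show "(\<integral>x. f (upper_entries (?S x)) \<partial>?M) = f (upper_entries \<Psi>) + (1 / T) * m ?z"
      unfolding E1 by (simp add: f \<Psi>s m_def algebra_simps sum.distrib sum_distrib_left)
    have "?W (xs i @ xs j) ?z = ?W (xs i) ?z * ?W (xs j) ?z + (1 / T) * (?c i j ?z + (1 / T) * R i j ?z)" for i j
      using R(2)[where i = i and j = j and z = ?z] by (simp add: algebra_simps power2_eq_square)
    then have W2: "(\<Sum>i<n. \<Sum>j<n. c i * c j * ?W (xs i @ xs j) ?z)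
        = (\<Sum>i<n. \<Sum>j<n. (c i * ?W (xs i) ?z) * (c j * ?W (xs j) ?z)) + (1 / T) * V ?z"
      by (simp add: V_def algebra_simps sum.distrib sum_distrib_left)
    show "M.variance (\<lambda>x. f (upper_entries (?S x))) = (1 / T) * V ?z"
      unfolding M.variance_eq[OF i1 i2] unfolding E1 E2 W2
      by (simp add: power2_eq_square sum_product)
  qed
  then show ?thesis by blast
qed

section \<open>The projections behind the sample covariance\<close>

lemma projection_kernel_centering:
  assumes "N \<ge> 2"
  shows "projection_kernel {1..N} (\<lambda>k l. (if k = l then 1 else 0) - 1 / real N) (real N - 1)"
proof
  fix k l assume kl: "k \<in> {1..N}" "l \<in> {1..N}"
  have "(\<Sum>j = 1..N. ((if k = j then 1 else 0) - 1 / real N) * ((if j = l then 1 else 0) - 1 / real N))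
    = (\<Sum>j = 1..N. (if j = k then if k = l then 1 else 0 else 0) - (if j = k then 1 / real N else 0)
        - (if j = l then 1 / real N else 0) + 1 / real N * (1 / real N))"
    by (intro sum.cong) (auto simp: algebra_simps)
  also have "\<dots> = (if k = l then 1 else 0) - 1 / real N"
    using kl assms by (simp add: sum.distrib sum_subtractf)
  finally show "(\<Sum>j = 1..N. ((if k = j then 1 else 0) - 1 / real N) * ((if j = l then 1 else 0) - 1 / real N))
    = (if k = l then 1 else 0) - 1 / real N" .
next
  \<comment> \<open>The trace of the centering matrix is the divisor N - 1 of the sample
    covariance.\<close>
  show "real N - 1 = (\<Sum>k = 1..N. (if k = k then 1 else 0) - 1 / real N)"
    using assms by (simp add: sum_subtractf right_diff_distrib)
qed (use assms in auto)

lemma projection_kernel_mean: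
  assumes "N \<ge> 1"
  shows "projection_kernel {1..N} (\<lambda>k l. 1 / real N) 1"
  by standard (use assms in auto)

lemma projection_kernel_single: "projection_kernel {k} (\<lambda>k l. 1) 1"
  by standard auto

text \<open>The centering matrix annihilates constants, so an arbitrary \<open>\<mu>\<close> may be
  subtracted first.\<close>

lemma sample_cov_eq_scatter:
  fixes x :: "nat \<Rightarrow> ('p::finite) rvec"
  assumes "N \<ge> 1"
  shows "sample_cov N x = (1 / (real N - 1)) *\<^sub>R
    scatter {1..N} (\<lambda>k l. (if k = l then 1 else 0) - 1 / real N) (\<lambda>k. x k - \<mu>)"
proof -
  define y where "y k = x k - \<mu>" for k
  define s where "s = (\<Sum>k = 1..N. y k)"
  have sm: "sample_mean N x = \<mu> + (1 / real N) *\<^sub>R s"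
    using assms by (simp add: sample_mean_def s_def y_def sum_subtractf scaleR_diff_right sum_constant_scaleR del: sum_constant)
  have d: "x k $ i - sample_mean N x $ i = y k $ i - s $ i / real N" for k i
    by (simp add: sm y_def)
  have s: "s $ i = (\<Sum>k = 1..N. y k $ i)" for i by (simp add: s_def)
  have "(\<Sum>k = 1..N. (y k $ i - s $ i / real N) * (y k $ j - s $ j / real N))
     = (\<Sum>k = 1..N. y k $ i * y k $ j) - s $ i * s $ j / real N" for i j
  proof -
    have "(\<Sum>k = 1..N. (y k $ i - s $ i / real N) * (y k $ j - s $ j / real N))
      = (\<Sum>k = 1..N. y k $ i * y k $ j) - (s $ i / real N) * (\<Sum>k = 1..N. y k $ j)
        - (s $ j / real N) * (\<Sum>k = 1..N. y k $ i) + real N * (s $ i / real N * (s $ j / real N))"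
      by (simp add: algebra_simps sum.distrib sum_subtractf sum_distrib_left)
    then show ?thesis
      unfolding s[symmetric] using assms by (simp only:) (simp add: field_simps)
  qed
  moreover have "(\<Sum>k = 1..N. \<Sum>l = 1..N. ((if k = l then 1 else 0) - 1 / real N) * (y k $ i * y l $ j))
     = (\<Sum>k = 1..N. y k $ i * y k $ j) - s $ i * s $ j / real N" for i j
  proof -
    have "(\<Sum>k = 1..N. \<Sum>l = 1..N. ((if k = l then 1 else 0) - 1 / real N) * (y k $ i * y l $ j))
      = (\<Sum>k = 1..N. \<Sum>l = 1..N. (if l = k then y k $ i * y k $ j else 0) - y k $ i * y l $ j / real N)"
      by (intro sum.cong) (auto simp: algebra_simps)
    then show ?thesis
      by (simp add: sum_subtractf s sum_product sum_divide_distrib)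
  qed
  ultimately show ?thesis
    unfolding sample_cov_def scatter_def y_def[symmetric] by (simp add: vec_eq_iff d)
qed

text \<open>The centering matrix is the identity minus the averaging matrix: up to one matrix of
  rank at most 1, the scatter is a sum of contributions of single observations, to which a central
  limit theorem can apply.\<close>

lemma scatter_decomposition:
  fixes x :: "nat \<Rightarrow> ('p::finite) rvec"
  shows "scatter {1..N} (\<lambda>k l. (if k = l then 1 else 0) - 1 / real N) x
    = (\<Sum>k = 1..N. scatter {k} (\<lambda>k l. 1) x) - scatter {1..N} (\<lambda>k l. 1 / real N) x"
proof -
  have "(\<Sum>k = 1..N. \<Sum>l = 1..N. ((if k = l then 1 else 0) - 1 / real N) * (x k $ i * x l $ j))
     = (\<Sum>k = 1..N. x k $ i * x k $ j) - (\<Sum>k = 1..N. \<Sum>l = 1..N. 1 / real N * (x k $ i * x l $ j))" for i j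
  proof -
    have "(\<Sum>k = 1..N. \<Sum>l = 1..N. ((if k = l then 1 else 0) - 1 / real N) * (x k $ i * x l $ j))
      = (\<Sum>k = 1..N. \<Sum>l = 1..N. (if l = k then x k $ i * x k $ j else 0) - 1 / real N * (x k $ i * x l $ j))"
      by (intro sum.cong) (auto simp: algebra_simps)
    then show ?thesis by (simp add: sum_subtractf)
  qed
  then show ?thesis by (simp add: vec_eq_iff scatter_def)
qed

lemma pos_def_sym: "pos_def \<Psi> \<Longrightarrow> \<Psi> $ i $ j = \<Psi> $ j $ i"
  unfolding pos_def_def by (metis transpose_def vec_lambda_beta)

lemma sym_mat_upper_entries_pos_def: "pos_def \<Psi> \<Longrightarrow> sym_mat (upper_entries \<Psi>) = \<Psi>"
  by (rule sym_mat_upper_entries) (rule pos_def_sym)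

lemma wmom_pair: "wmom t \<Psi> [x, y] = \<Psi> $ fst x $ snd x * \<Psi> $ fst y $ snd y + t * wkernel \<Psi> x y"
  by (cases x; cases y) (simp add: wkernel_def)

lemma wmom_single: "wmom t \<Psi> [x] = \<Psi> $ fst x $ snd x"
  by (cases x) simp

text \<open>For lists of length at most two \<open>wmom\<close> is explicit, so a linear form has an
  exact variance and not merely an expansion at t = 0. The later applications have T = 1 (one
  observation, the sample mean), where 1 / T is not small.\<close>

lemma (in projection_kernel) linear_moments:
  fixes \<Psi> :: "('p::{finite, linorder}) rmat" and \<mu> :: "'p rvec" and G :: "'p upper rvec"
  assumes pd: "pos_def \<Psi>"
  defines "M \<equiv> PiM K (\<lambda>_. multi_normal \<mu> \<Psi>)"
    and "L \<equiv> \<lambda>x. G \<bullet> upper_entries ((1 / T) *\<^sub>R scatter K P (\<lambda>k. x k - \<mu>))"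
  shows "integrable M L" "integrable M (\<lambda>x. (L x)\<^sup>2)"
    "(\<integral>x. L x \<partial>M) = G \<bullet> upper_entries \<Psi>"
    "prob_space.variance M L = (1 / T) * asym_var \<Psi> G"
proof -
  interpret M: prob_space M unfolding M_def by (rule prob_space_PiM_multi_normal[OF pd])
  let ?S = "\<lambda>x. (1 / T) *\<^sub>R scatter K P (\<lambda>k. x k - \<mu>)"
  note int = integrable_entry_prod_scatter[OF pd, of \<mu>, folded M_def]
  note E = integral_entry_prod_scatter[OF pd, of \<mu>, folded M_def]
  have L: "L x = (\<Sum>e\<in>UNIV. G $ e * entry_prod (?S x) [Rep_upper e])" for x
    by (simp add: L_def inner_vec_def upper_entries_nth entry_prod_def case_prod_unfold)
  have L2: "(L x)\<^sup>2 = (\<Sum>e\<in>UNIV. \<Sum>e'\<in>UNIV. G $ e * G $ e' * entry_prod (?S x) [Rep_upper e, Rep_upper e'])" for x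
    unfolding L power2_eq_square sum_product by (simp add: entry_prod_def ac_simps)
  show i1: "integrable M L"
    unfolding L by (intro Bochner_Integration.integrable_sum integrable_mult_right int)
  show i2: "integrable M (\<lambda>x. (L x)\<^sup>2)"
    unfolding L2 by (intro Bochner_Integration.integrable_sum integrable_mult_right int)
  show E1: "(\<integral>x. L x \<partial>M) = G \<bullet> upper_entries \<Psi>"
    unfolding L
    by (subst Bochner_Integration.integral_sum, intro integrable_mult_right int)
       (simp add: E wmom_single inner_vec_def upper_entries_nth)
  have E2: "(\<integral>x. (L x)\<^sup>2 \<partial>M) = (\<Sum>e\<in>UNIV. \<Sum>e'\<in>UNIV. G $ e * G $ e' * wmom (1 / T) \<Psi> [Rep_upper e, Rep_upper e'])"
    unfolding L2
    by (subst Bochner_Integration.integral_sum, intro Bochner_Integration.integrable_sum integrable_mult_right int,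
        subst Bochner_Integration.integral_sum, intro integrable_mult_right int)
       (simp add: E del: wmom.simps)
  have a: "asym_var \<Psi> G = (\<Sum>e\<in>UNIV. \<Sum>e'\<in>UNIV. G $ e * G $ e' * wkernel \<Psi> (Rep_upper e) (Rep_upper e'))"
    by (simp add: asym_var_def inner_vec_def upper_entries_nth sum_distrib_left ac_simps)
  show "M.variance L = (1 / T) * asym_var \<Psi> G"
    unfolding M.variance_eq[OF i1 i2] unfolding E1 E2 a wmom_pair inner_vec_def upper_entries_nth
    by (simp add: power2_eq_square sum_product sum.distrib sum_distrib_left algebra_simps)
qed

section \<open>Uniqueness of the variance polynomial\<close>

lemma real_polynomial_slice: "real_polynomial_function V \<Longrightarrow> real_polynomial_function (\<lambda>u. V (u, c))"
proof (induction rule: real_polynomial_function.induct)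
  case (linear f)
  then interpret bounded_linear f .
  have "f (u, c) = f (u, 0) + f (0, c)" for u using add[of "(u, 0)" "(0, c)"] by simp
  then have eq: "(\<lambda>u. f (u, c)) = (\<lambda>u. f (u, 0) + f (0, c))" by (rule ext)
  have "bounded_linear (\<lambda>u. f (u, 0))"
    by (rule bounded_linear_compose[OF bounded_linear_axioms]) (intro bounded_linear_Pair bounded_linear_ident bounded_linear_zero)
  then show ?case unfolding eq by (intro rpf_add rpf_linear rpf_const)
qed (auto intro: rpf_add rpf_mult rpf_const)

lemma real_polynomial_line: "real_polynomial_function q \<Longrightarrow> real_polynomial_function (\<lambda>s::real. q (u + s *\<^sub>R v))"
proof (induction rule: real_polynomial_function.induct)
  case (linear f)
  then interpret bounded_linear f .
  have "bounded_linear (\<lambda>s::real. s * f v)" by (rule bounded_linear_mult_left)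
  then show ?case by (simp add: add scaleR rpf_add rpf_linear rpf_const)
qed (auto intro: rpf_add rpf_mult rpf_const)

text \<open>If \<open>k\<close> bounds the operator norm of \<open>D\<close>, then |s (x \<bullet> D
  x)| < |x|^2 for nonzero x as soon as |s| < 1 / k.\<close>

lemma pos_def_near_identity:
  fixes D :: "('p::finite) rmat"
  assumes D: "\<And>i j. D $ i $ j = D $ j $ i"
  obtains e where "e > 0" "\<And>s. \<bar>s\<bar> < e \<Longrightarrow> pos_def (mat 1 + s *\<^sub>R D)"
proof -
  obtain k where k: "k > 0" "\<And>x. norm (D *v x) \<le> norm x * k"
    using bounded_linear.pos_bounded[OF matrix_vector_mul_bounded_linear[of D]] by blast
  have "pos_def (mat 1 + s *\<^sub>R D)" if s: "\<bar>s\<bar> < 1 / k" for s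
    unfolding pos_def_def
  proof (intro conjI allI impI)
    show "transpose (mat 1 + s *\<^sub>R D) = mat 1 + s *\<^sub>R D"
      using D by (simp add: vec_eq_iff transpose_def mat_def)
    fix x :: "'p rvec" assume x: "x \<noteq> 0"
    have "\<bar>x \<bullet> (D *v x)\<bar> \<le> norm x * (norm x * k)"
      by (rule order_trans[OF Cauchy_Schwarz_ineq2]) (intro mult_left_mono k; simp)
    then have "\<bar>s * (x \<bullet> (D *v x))\<bar> \<le> \<bar>s\<bar> * (norm x * (norm x * k))"
      by (simp add: abs_mult mult_left_mono)
    also have "\<dots> < 1 / k * (norm x * (norm x * k))"
      using s x k by (intro mult_strict_right_mono) auto
    also have "\<dots> = x \<bullet> x" using k by (simp add: power2_norm_eq_inner[symmetric] power2_eq_square)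
    finally have "x \<bullet> x + s * (x \<bullet> (D *v x)) > 0" by linarith
    then show "x \<bullet> ((mat 1 + s *\<^sub>R D) *v x) > 0"
      by (simp add: matrix_vector_mult_add_rdistrib inner_add_right scaleR_matrix_vector_assoc[symmetric])
  qed
  then show ?thesis using k by (intro that[of "1 / k"]) auto
qed

text \<open>On the line from the identity to an arbitrary symmetric matrix the points near the
  identity are positive definite. The difference restricted to this line is a polynomial in one
  variable with infinitely many zeros, and so vanishes at the far end.\<close>

lemma real_polynomial_pos_def_unique:
  fixes q q' :: "('p::{finite, linorder}) upper rvec \<Rightarrow> real"
  assumes q: "real_polynomial_function q" "real_polynomial_function q'"
    and eq: "\<And>\<Psi>. pos_def \<Psi> \<Longrightarrow> q (upper_entries \<Psi>) = q' (upper_entries \<Psi>)"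
  shows "q = q'"
proof
  fix u :: "'p upper rvec"
  let ?I = "upper_entries (mat 1 :: 'p rmat)"
  let ?D = "sym_mat u - mat 1"
  have Dsym: "?D $ i $ j = ?D $ j $ i" for i j
    by (simp add: sym_mat_sym[of u i j] mat_def)
  obtain e where e: "e > 0" "\<And>s. \<bar>s\<bar> < e \<Longrightarrow> pos_def (mat 1 + s *\<^sub>R ?D)"
    using pos_def_near_identity[OF Dsym] by blast
  define p where "p s = q (?I + s *\<^sub>R (u - ?I)) - q' (?I + s *\<^sub>R (u - ?I))" for s
  have "real_polynomial_function p"
    unfolding p_def by (intro real_polynomial_function_diff real_polynomial_line q)
  then obtain a n where p: "p = (\<lambda>s. \<Sum>i\<le>n. a i * s ^ i)"
    by (auto simp: real_polynomial_function_iff_sum)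
  have up: "upper_entries (mat 1 + s *\<^sub>R ?D) = ?I + s *\<^sub>R (u - ?I)" for s
    by (simp add: linear_add[OF linear_upper_entries] linear_diff[OF linear_upper_entries] linear_scale[OF linear_upper_entries])
  have "p s = 0" if "\<bar>s\<bar> < e" for s
    using eq[OF e(2)[OF that]] unfolding up p_def by simp
  then have "{0<..<e} \<subseteq> {s. (\<Sum>i\<le>n. a i * s ^ i) = 0}"
    by (auto simp: p)
  then have "infinite {s. (\<Sum>i\<le>n. a i * s ^ i) = 0}"
    using e(1) infinite_Ioo[of 0 e] finite_subset by blast
  then have "\<forall>i\<le>n. a i = 0"
    using polyfun_finite_roots[of a n] by blast
  then have "p 1 = 0" by (simp add: p)
  then show "q u = q' u" by (simp add: p_def)
qed

lemma var_at_eq: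
  fixes f :: "('p::{finite, linorder}) upper rvec \<Rightarrow> real"
  assumes "N \<ge> 2"
  shows "var_at f N \<mu> \<Psi> = prob_space.variance (PiM {1..N} (\<lambda>_. multi_normal \<mu> \<Psi>))
    (\<lambda>x. f (upper_entries ((1 / (real N - 1)) *\<^sub>R scatter {1..N} (\<lambda>k l. (if k = l then 1 else 0) - 1 / real N) (\<lambda>k. x k - \<mu>))))"
proof -
  have "N \<ge> 1" using assms by simp
  then show ?thesis
    unfolding var_at_def by (simp only: sample_cov_eq_scatter[of N _ \<mu>])
qed

text \<open>Resolves the definite description: \<open>V\<close> with \<open>t\<close> frozen gives
  one such polynomial and \<open>real_polynomial_pos_def_unique\<close> makes it the only one, so
  the formula holds at every \<open>u\<close>, also at that of a singular matrix.\<close>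

lemma (in moment_expansion) var_poly_eq:
  assumes N: "N \<ge> 2"
  shows "var_poly f N u = (1 / (real N - 1)) * V (u, 1 / (real N - 1))"
proof -
  let ?q = "\<lambda>u. (1 / (real N - 1)) * V (u, 1 / (real N - 1))"
  have v: "var_at f N \<mu> \<Psi> = ?q (upper_entries \<Psi>)" if "pos_def \<Psi>" for \<mu> \<Psi>
    unfolding var_at_eq[OF N] by (rule variance_f[OF projection_kernel_centering[OF N] that])
  have rq: "real_polynomial_function ?q"
    by (intro rpf_mult rpf_const real_polynomial_slice V_poly)
  have "var_poly f N = ?q"
    unfolding var_poly_def
  proof (rule the_equality)
    show "real_polynomial_function ?q \<and> (\<forall>\<mu> \<Psi>. pos_def \<Psi> \<longrightarrow> ?q (upper_entries \<Psi>) = var_at f N \<mu> \<Psi>)"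
      using rq v by simp
  next
    fix q assume "real_polynomial_function q \<and> (\<forall>\<mu> \<Psi>. pos_def \<Psi> \<longrightarrow> q (upper_entries \<Psi>) = var_at f N \<mu> \<Psi>)"
    then show "q = ?q"
      using v by (intro real_polynomial_pos_def_unique[OF _ rq]) auto
  qed
  then show ?thesis by simp
qed

section \<open>Convergence in probability\<close>

context prob_space
begin

definition tends_0_prob :: "(nat \<Rightarrow> 'a \<Rightarrow> real) \<Rightarrow> bool" where
  "tends_0_prob Y \<longleftrightarrow> (\<forall>e>0. (\<lambda>n. prob {\<omega> \<in> space M. \<bar>Y n \<omega>\<bar> > e}) \<longlonglongrightarrow> 0)"

lemma tends_0_probD: "tends_0_prob Y \<Longrightarrow> e > 0 \<Longrightarrow> (\<lambda>n. prob {\<omega> \<in> space M. \<bar>Y n \<omega>\<bar> > e}) \<longlonglongrightarrow> 0"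
  by (simp add: tends_0_prob_def)

lemma prob_tendsto_0:
  assumes "\<forall>\<^sub>F n in sequentially. prob (A n) \<le> g n" "g \<longlonglongrightarrow> 0"
  shows "(\<lambda>n. prob (A n)) \<longlonglongrightarrow> 0"
  by (rule tendsto_sandwich[OF _ assms(1) tendsto_const assms(2)]) simp

text \<open>Chebyshev's inequality. Measurability and integrability are asked eventually only, since
  the moment formulas start at N = 2.\<close>

lemma tends_0_prob_second_moment:
  assumes rv: "\<forall>\<^sub>F n in sequentially. Y n \<in> borel_measurable M \<and> integrable M (\<lambda>\<omega>. (Y n \<omega>)\<^sup>2)"
    and lim: "(\<lambda>n. expectation (\<lambda>\<omega>. (Y n \<omega>)\<^sup>2)) \<longlonglongrightarrow> 0"
  shows "tends_0_prob Y"
  unfolding tends_0_prob_def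
proof (intro allI impI)
  fix e :: real assume e: "e > 0"
  have "\<forall>\<^sub>F n in sequentially. prob {\<omega> \<in> space M. \<bar>Y n \<omega>\<bar> > e} \<le> expectation (\<lambda>\<omega>. (Y n \<omega>)\<^sup>2) / e\<^sup>2"
    using rv
  proof eventually_elim
    case (elim n)
    then have [measurable]: "Y n \<in> borel_measurable M" by simp
    have "prob {\<omega> \<in> space M. \<bar>Y n \<omega>\<bar> > e} \<le> prob {\<omega> \<in> space M. \<bar>Y n \<omega>\<bar> \<ge> e}"
      by (rule finite_measure_mono) auto
    also have "\<dots> \<le> expectation (\<lambda>\<omega>. (Y n \<omega>)\<^sup>2) / e\<^sup>2"
      using second_moment_method[of "Y n" e] elim e by simp
    finally show ?case .
  qed
  moreover have "(\<lambda>n. expectation (\<lambda>\<omega>. (Y n \<omega>)\<^sup>2) / e\<^sup>2) \<longlonglongrightarrow> 0"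
    using tendsto_divide[OF lim tendsto_const, of "e\<^sup>2"] e by simp
  ultimately show "(\<lambda>n. prob {\<omega> \<in> space M. \<bar>Y n \<omega>\<bar> > e}) \<longlonglongrightarrow> 0"
    by (rule prob_tendsto_0)
qed

lemma tends_0_prob_add:
  assumes Y: "tends_0_prob Y" and Z: "tends_0_prob Z"
    and rv: "\<forall>\<^sub>F n in sequentially. Y n \<in> borel_measurable M \<and> Z n \<in> borel_measurable M"
  shows "tends_0_prob (\<lambda>n \<omega>. Y n \<omega> + Z n \<omega>)"
  unfolding tends_0_prob_def
proof (intro allI impI)
  fix e :: real assume e: "e > 0"
  let ?A = "\<lambda>n. {\<omega> \<in> space M. \<bar>Y n \<omega>\<bar> > e / 2}" and ?B = "\<lambda>n. {\<omega> \<in> space M. \<bar>Z n \<omega>\<bar> > e / 2}"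
  have "(\<lambda>n. prob (?A n) + prob (?B n)) \<longlonglongrightarrow> 0"
    using e by (intro tendsto_add_zero tends_0_probD Y Z) simp_all
  moreover have "\<forall>\<^sub>F n in sequentially. prob {\<omega> \<in> space M. \<bar>Y n \<omega> + Z n \<omega>\<bar> > e} \<le> prob (?A n) + prob (?B n)"
    using rv
  proof eventually_elim
    case (elim n)
    then have [measurable]: "Y n \<in> borel_measurable M" "Z n \<in> borel_measurable M" by simp_all
    have "prob {\<omega> \<in> space M. \<bar>Y n \<omega> + Z n \<omega>\<bar> > e} \<le> prob (?A n \<union> ?B n)"
      by (intro finite_measure_mono) auto
    also have "\<dots> \<le> prob (?A n) + prob (?B n)"
      by (intro measure_Un_le) auto
    finally show ?case .
  qed
  ultimately show "(\<lambda>n. prob {\<omega> \<in> space M. \<bar>Y n \<omega> + Z n \<omega>\<bar> > e}) \<longlonglongrightarrow> 0"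
    by (rule prob_tendsto_0[rotated])
qed

text \<open>Bounded second moments make \<open>Y\<close> tight: where |Y| < K, the product can
  exceed \<open>e\<close> only if |Z| > e / K.\<close>

lemma tends_0_prob_mult_bounded:
  assumes Z: "tends_0_prob Z"
    and rv: "\<forall>\<^sub>F n in sequentially. Y n \<in> borel_measurable M \<and> Z n \<in> borel_measurable M"
    and bd: "\<forall>\<^sub>F n in sequentially. integrable M (\<lambda>\<omega>. (Y n \<omega>)\<^sup>2) \<and> expectation (\<lambda>\<omega>. (Y n \<omega>)\<^sup>2) \<le> C"
  shows "tends_0_prob (\<lambda>n \<omega>. Y n \<omega> * Z n \<omega>)"
  unfolding tends_0_prob_def
proof (intro allI impI)
  fix e :: real assume e: "e > 0"
  show "(\<lambda>n. prob {\<omega> \<in> space M. \<bar>Y n \<omega> * Z n \<omega>\<bar> > e}) \<longlonglongrightarrow> 0"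
    unfolding LIMSEQ_def
  proof (intro allI impI)
    fix r :: real assume r: "r > 0"
    \<comment> \<open>Chosen so that C / K^2 < r / 2; \<open>\<bar>C\<bar> + 1\<close> keeps it
      positive.\<close>
    define K where "K = sqrt (2 * (\<bar>C\<bar> + 1) / r)"
    have K: "K > 0" using r by (simp add: K_def)
    have CK: "C / K\<^sup>2 < r / 2"
    proof -
      have "K\<^sup>2 = 2 * (\<bar>C\<bar> + 1) / r" using r by (simp add: K_def)
      then have "C / K\<^sup>2 = r / 2 * (C / (\<bar>C\<bar> + 1))" by simp
      also have "\<dots> < r / 2 * 1" using r by (intro mult_strict_left_mono) (auto simp: divide_less_eq)
      finally show ?thesis by simp
    qed
    let ?A = "\<lambda>n. {\<omega> \<in> space M. \<bar>Y n \<omega>\<bar> \<ge> K}" and ?B = "\<lambda>n. {\<omega> \<in> space M. \<bar>Z n \<omega>\<bar> > e / K}"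
    have "(\<lambda>n. prob (?B n)) \<longlonglongrightarrow> 0" using Z e K by (auto simp: tends_0_prob_def)
    then have "\<forall>\<^sub>F n in sequentially. prob (?B n) < r / 2"
      by (rule order_tendstoD(2)) (use r in simp)
    with rv bd have "\<forall>\<^sub>F n in sequentially. prob {\<omega> \<in> space M. \<bar>Y n \<omega> * Z n \<omega>\<bar> > e} < r"
    proof eventually_elim
      case (elim n)
      then have [measurable]: "Y n \<in> borel_measurable M" "Z n \<in> borel_measurable M" by simp_all
      have "prob {\<omega> \<in> space M. \<bar>Y n \<omega> * Z n \<omega>\<bar> > e} \<le> prob (?A n \<union> ?B n)"
      proof (intro finite_measure_mono)
        show "{\<omega> \<in> space M. \<bar>Y n \<omega> * Z n \<omega>\<bar> > e} \<subseteq> ?A n \<union> ?B n"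
        proof
          fix \<omega> assume \<omega>: "\<omega> \<in> {\<omega> \<in> space M. \<bar>Y n \<omega> * Z n \<omega>\<bar> > e}"
          show "\<omega> \<in> ?A n \<union> ?B n"
          proof (cases "K \<le> \<bar>Y n \<omega>\<bar>")
            case False
            then have "e < \<bar>Y n \<omega>\<bar> * \<bar>Z n \<omega>\<bar>" "\<bar>Y n \<omega>\<bar> \<le> K" using \<omega> by (simp_all add: abs_mult)
            then have "e < K * \<bar>Z n \<omega>\<bar>" by (meson abs_ge_zero less_le_trans mult_right_mono)
            then have "e / K < \<bar>Z n \<omega>\<bar>" using K by (simp add: divide_less_eq mult.commute)
            then show ?thesis using \<omega> by simp
          qed (use \<omega> in simp)
        qed
      qed auto
      also have "\<dots> \<le> prob (?A n) + prob (?B n)"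
        by (intro measure_Un_le) auto
      also have "prob (?A n) \<le> expectation (\<lambda>\<omega>. (Y n \<omega>)\<^sup>2) / K\<^sup>2"
        using second_moment_method[of "Y n" K] elim K by simp
      also have "\<dots> \<le> C / K\<^sup>2" using elim by (intro divide_right_mono) auto
      finally show ?case using CK elim by linarith
    qed
    then show "\<exists>no. \<forall>n\<ge>no. dist (prob {\<omega> \<in> space M. \<bar>Y n \<omega> * Z n \<omega>\<bar> > e}) 0 < r"
      by (simp add: eventually_sequentially)
  qed
qed

text \<open>Moving the argument by e costs only P(|Z - U| > e): up to this error P(U \<le> x - e)
  and P(U \<le> x + e) enclose P(Z \<le> x), and continuity of the normal distribution function
  closes the gap.\<close>

lemma slutsky_std_normal:
  assumes U: "weak_conv_m (\<lambda>n. distr M borel (U n)) std_normal_distribution"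
    and rv: "\<forall>\<^sub>F n in sequentially. U n \<in> borel_measurable M \<and> Z n \<in> borel_measurable M"
    and d: "tends_0_prob (\<lambda>n \<omega>. Z n \<omega> - U n \<omega>)"
  shows "weak_conv_m (\<lambda>n. distr M borel (Z n)) std_normal_distribution"
proof -
  let ?F = "cdf std_normal_distribution"
  interpret S: real_distribution std_normal_distribution by (rule real_dist_normal_dist)
  have cont: "isCont ?F x" for x
  proof -
    \<comment> \<open>No atoms, hence x - e and x + e are continuity points, where weak convergence
      gives convergence of the distribution functions.\<close>
    have "emeasure std_normal_distribution {x} = 0"
      by (subst emeasure_density) (auto intro: nn_integral_null_set[where N="{x}"] simp: nn_integral_0_iff_AE AE_lborel_singleton)
    then show ?thesis
      by (simp add: S.isCont_cdf measure_def)
  qed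
  have UF: "(\<lambda>n. cdf (distr M borel (U n)) x) \<longlonglongrightarrow> ?F x" for x
    using U cont by (auto simp: weak_conv_m_def weak_conv_def)
  have cdf_eq: "cdf (distr M borel Y) x = prob {\<omega> \<in> space M. Y \<omega> \<le> x}" if [measurable]: "Y \<in> borel_measurable M" for Y x
  proof -
    have "Y -` {..x} \<inter> space M = {\<omega> \<in> space M. Y \<omega> \<le> x}" by auto
    then show ?thesis by (simp add: cdf_def measure_distr)
  qed
  show ?thesis
    unfolding weak_conv_m_def weak_conv_def
  proof (intro allI impI)
    fix x
    show "(\<lambda>n. cdf (distr M borel (Z n)) x) \<longlonglongrightarrow> ?F x"
      unfolding LIMSEQ_def
    proof (intro allI impI)
      fix r :: real assume r: "r > 0"
      obtain s where s: "s > 0" "\<And>y. \<bar>y - x\<bar> < s \<Longrightarrow> \<bar>?F y - ?F x\<bar> < r / 3"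
        using cont[of x, unfolded continuous_at_eps_delta, rule_format, of "r / 3"] r
        by (auto simp: dist_real_def)
      define e where "e = s / 2"
      have e: "e > 0" "\<bar>?F (x + e) - ?F x\<bar> < r / 3" "\<bar>?F (x - e) - ?F x\<bar> < r / 3"
        using s by (auto simp: e_def)
      let ?D = "\<lambda>n. {\<omega> \<in> space M. \<bar>Z n \<omega> - U n \<omega>\<bar> > e}"
      have "\<forall>\<^sub>F n in sequentially. prob (?D n) < r / 3"
        using d e(1) r by (intro order_tendstoD(2)[of _ 0]) (auto simp: tends_0_prob_def)
      moreover have "\<forall>\<^sub>F n in sequentially. \<bar>cdf (distr M borel (U n)) (x + e) - ?F (x + e)\<bar> < r / 3"
        using tendstoD[OF UF[of "x + e"], of "r / 3"] r by (simp add: dist_real_def)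
      moreover have "\<forall>\<^sub>F n in sequentially. \<bar>cdf (distr M borel (U n)) (x - e) - ?F (x - e)\<bar> < r / 3"
        using tendstoD[OF UF[of "x - e"], of "r / 3"] r by (simp add: dist_real_def)
      ultimately have "\<forall>\<^sub>F n in sequentially. dist (cdf (distr M borel (Z n)) x) (?F x) < r"
        using rv
      proof eventually_elim
        case (elim n)
        then have [measurable]: "U n \<in> borel_measurable M" "Z n \<in> borel_measurable M" by simp_all
        have "prob {\<omega> \<in> space M. Z n \<omega> \<le> x} \<le> prob ({\<omega> \<in> space M. U n \<omega> \<le> x + e} \<union> ?D n)"
          by (intro finite_measure_mono) auto
        also have "\<dots> \<le> prob {\<omega> \<in> space M. U n \<omega> \<le> x + e} + prob (?D n)"
          by (intro measure_Un_le) auto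
        finally have 1: "prob {\<omega> \<in> space M. Z n \<omega> \<le> x} \<le> prob {\<omega> \<in> space M. U n \<omega> \<le> x + e} + prob (?D n)" .
        have "prob {\<omega> \<in> space M. U n \<omega> \<le> x - e} \<le> prob ({\<omega> \<in> space M. Z n \<omega> \<le> x} \<union> ?D n)"
          by (intro finite_measure_mono) auto
        also have "\<dots> \<le> prob {\<omega> \<in> space M. Z n \<omega> \<le> x} + prob (?D n)"
          by (intro measure_Un_le) auto
        finally have 2: "prob {\<omega> \<in> space M. U n \<omega> \<le> x - e} \<le> prob {\<omega> \<in> space M. Z n \<omega> \<le> x} + prob (?D n)" .
        have arith: "\<bar>pz - F\<bar> < r" if "pz \<le> pu + d" "pl \<le> pz + d" "d < r / 3" "\<bar>pu - a\<bar> < r / 3"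
          "\<bar>pl - b\<bar> < r / 3" "\<bar>a - F\<bar> < r / 3" "\<bar>b - F\<bar> < r / 3" for pz pu pl d a b F :: real
          using that by linarith
        show ?case
          unfolding dist_real_def
          by (rule arith[OF _ _ elim(1-3) e(2,3)]) (use 1 2 in \<open>simp_all add: cdf_eq\<close>)
      qed
      then show "\<exists>no. \<forall>n\<ge>no. dist (cdf (distr M borel (Z n)) x) (?F x) < r"
        by (simp add: eventually_sequentially)
    qed
  qed
qed

text \<open>Continuity is asked at the limit point only, which suits an \<open>h\<close> built from
  a quotient and a square root.\<close>

lemma tends_0_prob_continuous:
  fixes S :: "nat \<Rightarrow> 'a \<Rightarrow> real ^ ('i::finite)" and h :: "(real ^ 'i) \<times> real \<Rightarrow> real"
  assumes S: "\<And>i. tends_0_prob (\<lambda>n \<omega>. S n \<omega> $ i - s $ i)"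
    and rv: "\<forall>\<^sub>F n in sequentially. S n \<in> borel_measurable M"
    and t: "t \<longlonglongrightarrow> 0" and h: "isCont h (s, 0)"
  shows "tends_0_prob (\<lambda>n \<omega>. h (S n \<omega>, t n) - h (s, 0))"
  unfolding tends_0_prob_def
proof (intro allI impI)
  fix e :: real assume "e > 0"
  then obtain d where d: "d > 0" "\<And>z. dist z (s, 0) < d \<Longrightarrow> dist (h z) (h (s, 0)) < e"
    using h unfolding continuous_at_eps_delta by blast
  \<comment> \<open>If all coordinates deviate by at most c / 2, the norm is at most d / 4; with |t
    n| < d / 2 the pair stays within d of the limit.\<close>
  define c where "c = d / 2 / real CARD('i)"
  have c: "c > 0" using d by (simp add: c_def)
  let ?B = "\<lambda>i n. {\<omega> \<in> space M. \<bar>S n \<omega> $ i - s $ i\<bar> > c / 2}"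
  have "(\<lambda>n. \<Sum>i\<in>UNIV. prob (?B i n)) \<longlonglongrightarrow> (\<Sum>i\<in>(UNIV::'i set). 0)"
    using c by (intro tendsto_sum tends_0_probD S) simp
  moreover have "\<forall>\<^sub>F n in sequentially. prob {\<omega> \<in> space M. \<bar>h (S n \<omega>, t n) - h (s, 0)\<bar> > e} \<le> (\<Sum>i\<in>UNIV. prob (?B i n))"
  proof -
    have "\<forall>\<^sub>F n in sequentially. \<bar>t n\<bar> < d / 2"
      using tendstoD[OF t, of "d / 2"] d by (simp add: dist_real_def)
    with rv show ?thesis
    proof eventually_elim
      case (elim n)
      have [measurable]: "S n \<in> borel_measurable M" by (rule elim(1))
      have "prob {\<omega> \<in> space M. \<bar>h (S n \<omega>, t n) - h (s, 0)\<bar> > e} \<le> prob (\<Union>i\<in>UNIV. ?B i n)"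
      proof (rule finite_measure_mono)
        show "{\<omega> \<in> space M. \<bar>h (S n \<omega>, t n) - h (s, 0)\<bar> > e} \<subseteq> (\<Union>i\<in>UNIV. ?B i n)"
        proof (rule subsetI, rule ccontr)
          fix \<omega> assume \<omega>: "\<omega> \<in> {\<omega> \<in> space M. \<bar>h (S n \<omega>, t n) - h (s, 0)\<bar> > e}" "\<omega> \<notin> (\<Union>i\<in>UNIV. ?B i n)"
          then have le: "\<bar>(S n \<omega> - s) $ i\<bar> \<le> c / 2" for i by (auto simp: not_less)
          have "norm (S n \<omega> - s) \<le> (\<Sum>i\<in>UNIV. \<bar>(S n \<omega> - s) $ i\<bar>)" by (rule norm_le_l1_cart)
          also have "\<dots> \<le> real CARD('i) * (c / 2)" using sum_mono[of UNIV, OF le] by simp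
          also have "\<dots> < d / 2" using d by (simp add: c_def)
          finally have "norm (S n \<omega> - s) < d / 2" .
          moreover have "dist (S n \<omega>, t n) (s, 0) \<le> norm (S n \<omega> - s) + \<bar>t n\<bar>"
            using sqrt_sum_squares_le_sum_abs[of "dist (S n \<omega>) s" "dist (t n) 0"]
            by (simp add: dist_norm norm_Pair)
          ultimately have "dist (S n \<omega>, t n) (s, 0) < d" using elim(2) by simp
          then have "dist (h (S n \<omega>, t n)) (h (s, 0)) < e" by (rule d(2))
          then show False using \<omega>(1) by (simp add: dist_real_def)
        qed
      qed auto
      also have "\<dots> \<le> (\<Sum>i\<in>UNIV. prob (?B i n))"
        by (rule measure_UNION_le) auto
      finally show ?case .
    qed
  qed
  ultimately show "(\<lambda>n. prob {\<omega> \<in> space M. \<bar>h (S n \<omega>, t n) - h (s, 0)\<bar> > e}) \<longlonglongrightarrow> 0"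
    by (intro prob_tendsto_0[where g = "\<lambda>n. \<Sum>i\<in>UNIV. prob (?B i n)"]) simp_all
qed

end

section \<open>Asymptotics of normal samples\<close>

lemma sets_multi_normal [simp]: "sets (multi_normal \<mu> \<Psi>) = sets borel"
  by (simp add: multi_normal_def)

lemma scatter_cong: "(\<And>k. k \<in> K \<Longrightarrow> x k = y k) \<Longrightarrow> scatter K P x = scatter K P y"
  by (auto simp: scatter_def vec_eq_iff intro!: sum.cong)

lemma real_polynomial_borel_measurable:
  "real_polynomial_function (g :: 'a::euclidean_space \<Rightarrow> real) \<Longrightarrow> g \<in> borel_measurable borel"
  by (intro borel_measurable_continuous_onI continuous_on_polymonial_function)
     (simp add: real_polynomial_function_eq[symmetric])

lemma real_polynomial_coord: "real_polynomial_function (\<lambda>u. u $ e)"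
  by (rule rpf_linear) (rule bounded_linear_vec_nth)

lemma real_polynomial_inner: "real_polynomial_function (\<lambda>u. G \<bullet> u)"
  by (rule rpf_linear) (rule bounded_linear_inner_right)

locale normal_sample = prob_space M for M :: "'a measure" +
  fixes X :: "nat \<Rightarrow> 'a \<Rightarrow> ('p::{finite, linorder}) rvec" and \<mu> :: "'p rvec" and \<Psi> :: "'p rmat"
  assumes pd: "pos_def \<Psi>"
    and indep: "indep_vars (\<lambda>_. borel) X {1..}"
    and distr_X: "\<And>k. k \<ge> 1 \<Longrightarrow> distr M borel (X k) = multi_normal \<mu> \<Psi>"
begin

lemma X_measurable: "k \<ge> 1 \<Longrightarrow> X k \<in> borel_measurable M"
  using indep by (simp add: indep_vars_def)

text \<open>By independence the observations with index in \<open>K\<close> have the product law,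
  and \<open>scatter\<close> sees no others; so moments computed on the product space hold on
  \<open>M\<close>.\<close>

lemma
  assumes kp: "projection_kernel K P T" "K \<subseteq> {1..}"
    and int: "integrable (PiM K (\<lambda>_. multi_normal \<mu> \<Psi>)) (\<lambda>x. g ((1 / T) *\<^sub>R scatter K P (\<lambda>k. x k - \<mu>)) :: real)"
  shows integrable_scatter: "integrable M (\<lambda>\<omega>. g ((1 / T) *\<^sub>R scatter K P (\<lambda>k. X k \<omega> - \<mu>)))"
    and expectation_scatter: "expectation (\<lambda>\<omega>. g ((1 / T) *\<^sub>R scatter K P (\<lambda>k. X k \<omega> - \<mu>)))
      = (\<integral>x. g ((1 / T) *\<^sub>R scatter K P (\<lambda>k. x k - \<mu>)) \<partial>PiM K (\<lambda>_. multi_normal \<mu> \<Psi>))"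
proof -
  interpret projection_kernel K P T by (rule kp)
  let ?R = "\<lambda>\<omega>. \<lambda>k\<in>K. X k \<omega>"
  let ?G = "\<lambda>x. g ((1 / T) *\<^sub>R scatter K P (\<lambda>k. x k - \<mu>))"
  have XK: "X k \<in> borel_measurable M" if "k \<in> K" for k
    using subsetD[OF kp(2) that] by (intro X_measurable) simp
  have "indep_vars (\<lambda>_. borel) X K"
    using indep kp(2) by (rule indep_vars_subset)
  then have "distr M (PiM K (\<lambda>_. borel)) ?R = PiM K (\<lambda>k. distr M borel (X k))"
    using indep_vars_iff_distr_eq_PiM'[of K X "\<lambda>_. borel"] XK K(2) by simp
  also have "\<dots> = PiM K (\<lambda>_. multi_normal \<mu> \<Psi>)"
    using kp(2) by (intro PiM_cong refl distr_X) auto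
  finally have D: "PiM K (\<lambda>_. multi_normal \<mu> \<Psi>) = distr M (PiM K (\<lambda>_. borel)) ?R" ..
  have R: "?R \<in> measurable M (PiM K (\<lambda>_. borel))"
    by (rule measurable_restrict) (rule XK)
  have "sets (PiM K (\<lambda>_. multi_normal \<mu> \<Psi>)) = sets (PiM K (\<lambda>_. borel))"
    by (rule sets_PiM_cong) auto
  then have G: "?G \<in> borel_measurable (PiM K (\<lambda>_. borel))"
    using borel_measurable_integrable[OF int] measurable_cong_sets by blast
  have GR: "?G (?R \<omega>) = g ((1 / T) *\<^sub>R scatter K P (\<lambda>k. X k \<omega> - \<mu>))" for \<omega>
    by (intro arg_cong[of _ _ g] arg_cong[of _ _ "\<lambda>A. _ *\<^sub>R A"] scatter_cong) simp
  show "integrable M (\<lambda>\<omega>. g ((1 / T) *\<^sub>R scatter K P (\<lambda>k. X k \<omega> - \<mu>)))"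
    using int unfolding D integrable_distr_eq[OF R G] GR .
  show "expectation (\<lambda>\<omega>. g ((1 / T) *\<^sub>R scatter K P (\<lambda>k. X k \<omega> - \<mu>))) = (\<integral>x. ?G x \<partial>PiM K (\<lambda>_. multi_normal \<mu> \<Psi>))"
    unfolding D integral_distr[OF R G] GR ..
qed

definition S :: "nat \<Rightarrow> 'a \<Rightarrow> 'p upper rvec" where
  "S N \<omega> = upper_entries (sample_cov N (\<lambda>k. X k \<omega>))"

abbreviation u0 :: "'p upper rvec" where "u0 \<equiv> upper_entries \<Psi>"

text \<open>Since \<open>g\<close> vanishes at \<Psi>, the mean of g(S) is t m, and its square adds
  only t (t m^2) to the second moment; hence Q = V + t m^2, which agrees with V at t = 0. For a
  vanishing gradient the second moment is therefore O(t^2) rather than O(t).\<close>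

lemma sample_cov_second_moment:
  assumes g: "real_polynomial_function g" and g0: "g u0 = 0"
  shows "\<exists>Q :: 'p pt \<Rightarrow> real. real_polynomial_function Q \<and>
    (\<forall>N\<ge>2. integrable M (\<lambda>\<omega>. g (S N \<omega>)) \<and> integrable M (\<lambda>\<omega>. (g (S N \<omega>))\<^sup>2) \<and>
      expectation (\<lambda>\<omega>. (g (S N \<omega>))\<^sup>2) = (1 / (real N - 1)) * Q (u0, 1 / (real N - 1))) \<and>
    (\<forall>G. GDERIV g u0 :> G \<longrightarrow> Q (u0, 0) = asym_var \<Psi> G)"
proof -
  obtain m V where "moment_expansion g m V"
    using polynomial_moments[OF g] by blast
  then interpret moment_expansion g m V .
  define Q where "Q z = V z + snd z * (m z)\<^sup>2" for z :: "'p pt"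
  show ?thesis
  proof (intro exI[of _ Q] conjI allI impI)
    show "real_polynomial_function Q"
      unfolding Q_def by (intro rpf_add rpf_mult real_polynomial_function_power real_polynomial_function_snd m_poly V_poly)
    show "Q (u0, 0) = asym_var \<Psi> G" if "GDERIV g u0 :> G" for G
      using V_0[OF that] by (simp add: Q_def sym_mat_upper_entries_pos_def[OF pd])
  next
    fix N :: nat assume N: "N \<ge> 2"
    let ?P = "\<lambda>k l. (if k = l then 1 else 0) - 1 / real N" and ?n = "real N - 1"
    let ?PM = "PiM {1..N} (\<lambda>_. multi_normal \<mu> \<Psi>)"
    have k: "projection_kernel {1..N} ?P ?n" by (rule projection_kernel_centering[OF N])
    interpret projection_kernel "{1..N}" ?P ?n by (rule k)
    interpret PM: prob_space ?PM by (rule prob_space_PiM_multi_normal[OF pd])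
    have S: "S N \<omega> = upper_entries ((1 / ?n) *\<^sub>R scatter {1..N} ?P (\<lambda>k. X k \<omega> - \<mu>))" for \<omega>
      unfolding S_def using N by (subst sample_cov_eq_scatter[of _ _ \<mu>]) auto
    have sub: "{1..N} \<subseteq> {1..}" by auto
    show "integrable M (\<lambda>\<omega>. g (S N \<omega>))"
      unfolding S by (rule integrable_scatter[where g = "\<lambda>A. g (upper_entries A)", OF k sub integrable_f[OF k pd]])
    show "integrable M (\<lambda>\<omega>. (g (S N \<omega>))\<^sup>2)"
      unfolding S by (rule integrable_scatter[where g = "\<lambda>A. (g (upper_entries A))\<^sup>2", OF k sub integrable_f_square[OF k pd]])
    have "expectation (\<lambda>\<omega>. (g (S N \<omega>))\<^sup>2) = (\<integral>x. (g (upper_entries ((1 / ?n) *\<^sub>R scatter {1..N} ?P (\<lambda>k. x k - \<mu>))))\<^sup>2 \<partial>?PM)"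
      unfolding S by (rule expectation_scatter[where g = "\<lambda>A. (g (upper_entries A))\<^sup>2", OF k sub integrable_f_square[OF k pd]])
    also have "\<dots> = (1 / ?n) * V (u0, 1 / ?n) + ((1 / ?n) * m (u0, 1 / ?n))\<^sup>2"
      using trans[OF PM.variance_eq[OF integrable_f[OF k pd] integrable_f_square[OF k pd], symmetric] variance_f[OF k pd]]
      unfolding mean_f[OF k pd] g0 by simp
    finally show "expectation (\<lambda>\<omega>. (g (S N \<omega>))\<^sup>2) = (1 / ?n) * Q (u0, 1 / ?n)"
      by (simp add: Q_def power2_eq_square algebra_simps)
  qed
qed

text \<open>Measurability is inherited from the integrability of the coordinate polynomials.\<close>

lemma S_measurable:
  assumes N: "N \<ge> 2"
  shows "S N \<in> borel_measurable M"
proof -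
  have "(\<lambda>\<omega>. S N \<omega> $ e) \<in> borel_measurable M" for e
  proof -
    have g: "real_polynomial_function (\<lambda>u. u $ e - u0 $ e)"
      by (intro real_polynomial_function_diff real_polynomial_coord rpf_const)
    have "integrable M (\<lambda>\<omega>. S N \<omega> $ e - u0 $ e)"
      using sample_cov_second_moment[OF g] N by auto
    then have "(\<lambda>\<omega>. (S N \<omega> $ e - u0 $ e) + u0 $ e) \<in> borel_measurable M"
      by (intro borel_measurable_add borel_measurable_integrable) auto
    then show ?thesis by simp
  qed
  then have "(\<lambda>\<omega>. \<chi> e. S N \<omega> $ e) \<in> borel_measurable M"
    by (rule measurable_vec_lambda)
  then show ?thesis by simp
qed

lemma tends_inverse_n: "(\<lambda>N. 1 / (real N - 1)) \<longlonglongrightarrow> 0"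
  by real_asymp

lemma poly_tends:
  assumes "real_polynomial_function (Q :: 'p pt \<Rightarrow> real)"
  shows "(\<lambda>N. Q (u0, 1 / (real N - 1))) \<longlonglongrightarrow> Q (u0, 0)"
proof -
  have "isCont Q (u0, 0)" using continuous_real_polymonial_function[OF assms] .
  moreover have "(\<lambda>N. (u0, 1 / (real N - 1))) \<longlonglongrightarrow> (u0, 0)"
    by (intro tendsto_Pair tendsto_const tends_inverse_n)
  ultimately show ?thesis by (rule isCont_tendsto_compose)
qed

lemma S_tends: "tends_0_prob (\<lambda>N \<omega>. S N \<omega> $ e - u0 $ e)"
proof -
  have g: "real_polynomial_function (\<lambda>u. u $ e - u0 $ e)"
    by (intro real_polynomial_function_diff real_polynomial_coord rpf_const)
  obtain Q :: "'p pt \<Rightarrow> real" where Q: "real_polynomial_function Q"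
    and i: "\<And>N. N \<ge> 2 \<Longrightarrow> integrable M (\<lambda>\<omega>. S N \<omega> $ e - u0 $ e)"
    "\<And>N. N \<ge> 2 \<Longrightarrow> integrable M (\<lambda>\<omega>. (S N \<omega> $ e - u0 $ e)\<^sup>2)"
    and E: "\<And>N. N \<ge> 2 \<Longrightarrow> expectation (\<lambda>\<omega>. (S N \<omega> $ e - u0 $ e)\<^sup>2) = (1 / (real N - 1)) * Q (u0, 1 / (real N - 1))"
    using sample_cov_second_moment[OF g] by auto
  show ?thesis
  proof (rule tends_0_prob_second_moment)
    show "\<forall>\<^sub>F N in sequentially. (\<lambda>\<omega>. S N \<omega> $ e - u0 $ e) \<in> borel_measurable M \<and> integrable M (\<lambda>\<omega>. (S N \<omega> $ e - u0 $ e)\<^sup>2)"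
      using eventually_ge_at_top[of 2] by eventually_elim (simp add: i borel_measurable_integrable)
    have "(\<lambda>N. (1 / (real N - 1)) * Q (u0, 1 / (real N - 1))) \<longlonglongrightarrow> 0 * Q (u0, 0)"
      by (intro tendsto_mult tends_inverse_n poly_tends Q)
    then have "(\<lambda>N. (1 / (real N - 1)) * Q (u0, 1 / (real N - 1))) \<longlonglongrightarrow> 0" by simp
    moreover have "\<forall>\<^sub>F N in sequentially. (1 / (real N - 1)) * Q (u0, 1 / (real N - 1)) = expectation (\<lambda>\<omega>. (S N \<omega> $ e - u0 $ e)\<^sup>2)"
      using eventually_ge_at_top[of 2] by eventually_elim (simp add: E)
    ultimately show "(\<lambda>N. expectation (\<lambda>\<omega>. (S N \<omega> $ e - u0 $ e)\<^sup>2)) \<longlonglongrightarrow> 0"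
      by (rule Lim_transform_eventually)
  qed
qed

section \<open>The central limit theorem for the linearised invariant\<close>

definition quad :: "'p upper rvec \<Rightarrow> 'p rvec \<Rightarrow> real" where
  "quad G x = G \<bullet> upper_entries (\<chi> a b. (x - \<mu>) $ a * (x - \<mu>) $ b) - G \<bullet> u0"

lemma quad_eq_scatter: "quad G (x k) = G \<bullet> upper_entries ((1 / 1) *\<^sub>R scatter {k} (\<lambda>k l. 1) (\<lambda>k. x k - \<mu>)) - G \<bullet> u0"
  by (simp add: quad_def scatter_def)

lemma quad_measurable [measurable]: "quad G \<in> borel_measurable borel"
proof -
  have "quad G = (\<lambda>x. (\<Sum>e\<in>UNIV. G $ e * ((x - \<mu>) $ fst (Rep_upper e) * (x - \<mu>) $ snd (Rep_upper e))) - G \<bullet> u0)"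
    by (simp add: fun_eq_iff quad_def inner_vec_def upper_entries_nth)
  then show ?thesis by simp
qed

lemma quad_clt:
  assumes G: "G \<noteq> 0"
  shows "weak_conv_m (\<lambda>N. distr M borel (\<lambda>\<omega>. (\<Sum>k = 1..N. quad G (X k \<omega>)) / sqrt (real N * asym_var \<Psi> G))) std_normal_distribution"
proof -
  have pos: "asym_var \<Psi> G > 0" by (rule asym_var_pos[OF pd G])
  \<comment> \<open>The central limit theorem counts from 0, the sample from 1.\<close>
  let ?q = "\<lambda>k \<omega>. quad G (X (Suc k) \<omega>)"
  define L where "L k \<omega> = G \<bullet> upper_entries ((1 / 1) *\<^sub>R scatter {Suc k} (\<lambda>k l. 1) (\<lambda>k. X k \<omega> - \<mu>))" for k \<omega>
  have qL: "?q k \<omega> = L k \<omega> - G \<bullet> u0" for k \<omega>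
    unfolding L_def by (rule quad_eq_scatter)
  have mom: "integrable M (L k)" "integrable M (\<lambda>\<omega>. (L k \<omega>)\<^sup>2)" "expectation (L k) = G \<bullet> u0" "variance (L k) = asym_var \<Psi> G" for k
  proof -
    have kp: "projection_kernel {Suc k} (\<lambda>k l. 1) 1" by (rule projection_kernel_single)
    interpret projection_kernel "{Suc k}" "\<lambda>k l. 1" 1 by (rule kp)
    interpret PM: prob_space "PiM {Suc k} (\<lambda>_. multi_normal \<mu> \<Psi>)" by (rule prob_space_PiM_multi_normal[OF pd])
    have sub: "{Suc k} \<subseteq> {1..}" by auto
    note lm = linear_moments[OF pd, of \<mu> G]
    show i1: "integrable M (L k)"
      unfolding L_def[abs_def] by (rule integrable_scatter[where g = "\<lambda>A. G \<bullet> upper_entries A", OF kp sub lm(1)])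
    show i2: "integrable M (\<lambda>\<omega>. (L k \<omega>)\<^sup>2)"
      unfolding L_def[abs_def] by (rule integrable_scatter[where g = "\<lambda>A. (G \<bullet> upper_entries A)\<^sup>2", OF kp sub lm(2)])
    show e1: "expectation (L k) = G \<bullet> u0"
      unfolding L_def[abs_def] using expectation_scatter[where g = "\<lambda>A. G \<bullet> upper_entries A", OF kp sub lm(1)] lm(3) by simp
    have e2: "expectation (\<lambda>\<omega>. (L k \<omega>)\<^sup>2) = asym_var \<Psi> G + (G \<bullet> u0)\<^sup>2"
      unfolding L_def[abs_def]
      using expectation_scatter[where g = "\<lambda>A. (G \<bullet> upper_entries A)\<^sup>2", OF kp sub lm(2)] lm(3,4) PM.variance_eq[OF lm(1,2)] by simp
    show "variance (L k) = asym_var \<Psi> G"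
      unfolding variance_eq[OF i1 i2] unfolding e1 e2 by simp
  qed
  have "weak_conv_m (\<lambda>n. distr M borel (\<lambda>x. (\<Sum>i<n. ?q i x) / sqrt (n * (sqrt (asym_var \<Psi> G))\<^sup>2))) std_normal_distribution"
  proof (rule central_limit_theorem_zero_mean)
    \<comment> \<open>Reindexing by \<open>Suc\<close> is done by restricting the family to disjoint
      singletons.\<close>
    have "indep_vars (\<lambda>k. PiM {Suc k} (\<lambda>_. borel)) (\<lambda>k \<omega>. restrict (\<lambda>i. X i \<omega>) {Suc k}) UNIV"
      using indep by (rule indep_vars_restrict) (auto simp: disjoint_family_on_def)
    then have "indep_vars (\<lambda>_. borel) (\<lambda>k \<omega>. (\<lambda>w. quad G (w (Suc k))) (restrict (\<lambda>i. X i \<omega>) {Suc k})) UNIV"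
      by (rule indep_vars_compose2) measurable
    then show "indep_vars (\<lambda>_. borel) ?q UNIV" by simp
    show "expectation (?q n) = 0" for n
      unfolding qL using mom(1,3)[of n] by (simp add: prob_space)
    show "integrable M (\<lambda>\<omega>. (?q n \<omega>)\<^sup>2)" for n
      unfolding qL power2_diff
      by (intro Bochner_Integration.integrable_add Bochner_Integration.integrable_diff integrable_mult_left integrable_mult_right mom) simp
    show "variance (?q n) = (sqrt (asym_var \<Psi> G))\<^sup>2" for n
      unfolding qL using mom[of n] pos by (simp add: prob_space)
    show "distr M borel (?q n) = distr (multi_normal \<mu> \<Psi>) borel (quad G)" for n
    proof -
      have [measurable]: "X (Suc n) \<in> borel_measurable M" by (rule X_measurable) simp
      have "distr (multi_normal \<mu> \<Psi>) borel (quad G) = distr (distr M borel (X (Suc n))) borel (quad G)"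
        by (simp add: distr_X)
      also have "\<dots> = distr M borel (?q n)"
        by (subst distr_distr) (auto simp: o_def)
      finally show ?thesis ..
    qed
  qed (use pos in simp)
  moreover have "(\<Sum>i<n. ?q i \<omega>) = (\<Sum>k = 1..n. quad G (X k \<omega>))" for n \<omega>
    by (simp add: sum.atLeast1_atMost_eq)
  ultimately show ?thesis using pos by simp
qed

end

section \<open>The delta method with estimated variance\<close>

theorem proposition4:
  fixes f :: "('p::{finite, linorder}) upper rvec \<Rightarrow> real"
    and m :: nat
    and \<Psi> :: "'p rmat"
    and G :: "'p upper rvec"
    and \<mu> :: "'p rvec"
    and M :: "'a measure"
    and X :: "nat \<Rightarrow> 'a \<Rightarrow> 'p rvec"
  assumes "model_invariant m f"
    and "pos_def \<Psi>"
    and "f (upper_entries \<Psi>) = 0"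
    and "GDERIV f (upper_entries \<Psi>) :> G" and "G \<noteq> 0"
    and "prob_space M"
    and "prob_space.indep_vars M (\<lambda>_. borel) X {1..}"
    and "\<And>k. k \<ge> 1 \<Longrightarrow> distr M borel (X k) = multi_normal \<mu> \<Psi>"
  shows "weak_conv_m
    (\<lambda>N. distr M borel (\<lambda>\<omega>. standardized_invariant f N (\<lambda>k. X k \<omega>)))
    std_normal_distribution"
proof -
  interpret prob_space M by fact
  interpret normal_sample M X \<mu> \<Psi>
    by unfold_locales (fact assms)+
  have f: "real_polynomial_function f" using assms(1) by (simp add: model_invariant_def)
  define v where "v = asym_var \<Psi> G"
  have v: "v > 0" unfolding v_def by (rule asym_var_pos) fact+
  obtain m' V where "moment_expansion f m' V"
    using polynomial_moments[OF f] by blast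
  then interpret moment_expansion f m' V .
  note V = V_poly
  have V_v: "V (u0, 0) = v"
    using V_0[OF assms(4)] by (simp add: v_def sym_mat_upper_entries_pos_def[OF pd])
  define t where "t N = 1 / (real N - 1)" for N :: nat
  define U where "U N \<omega> = (\<Sum>k = 1..N. quad G (X k \<omega>)) / sqrt (real N * v)" for N \<omega>
  \<comment> \<open>f(S) on the scale of \<open>U\<close>: the factor N - 1 turns S into a sum over
    the observations, and sqrt(N v) is the normalisation in \<open>quad_clt\<close>.\<close>
  define D where "D N \<omega> = (real N - 1) / sqrt (real N * v) * f (S N \<omega>)" for N \<omega>
  \<comment> \<open>The quotient of the deterministic and the estimated normalisation. Since 1 + t =
    N / (N - 1), the factorisation Z = D h is exact.\<close>
  define h where "h z = sqrt (v * (1 + snd z) / V z)" for z :: "'p pt"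
  define Z where "Z N \<omega> = standardized_invariant f N (\<lambda>k. X k \<omega>)" for N \<omega>
  \<comment> \<open>The identity also covers a nonpositive variance estimate: \<open>sqrt\<close> is
    odd and multiplicative on the reals, and division by 0 gives 0.\<close>
  have ZDC: "Z N \<omega> = D N \<omega> * h (S N \<omega>, t N)" if N: "N \<ge> 2" for N \<omega>
  proof -
    have n: "real N - 1 > 0" using N by simp
    have "1 + t N = real N / (real N - 1)" using n by (simp add: t_def field_simps)
    then have "h (S N \<omega>, t N) = sqrt (real N * v) / sqrt ((real N - 1) * V (S N \<omega>, t N))"
      by (simp add: h_def real_sqrt_divide[symmetric] ac_simps)
    then have "D N \<omega> * h (S N \<omega>, t N) = (real N - 1) * f (S N \<omega>) / sqrt ((real N - 1) * V (S N \<omega>, t N))"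
      using v N by (simp add: D_def)
    also have "sqrt ((real N - 1) * V (S N \<omega>, t N)) = (real N - 1) * sqrt (V (S N \<omega>, t N) / (real N - 1))"
    proof -
      have "(real N - 1) * V (S N \<omega>, t N) = (real N - 1)\<^sup>2 * (V (S N \<omega>, t N) / (real N - 1))"
        using n by (simp add: power2_eq_square)
      then show ?thesis using n by (simp only: real_sqrt_mult real_sqrt_abs abs_of_pos)
    qed
    also have "(real N - 1) * f (S N \<omega>) / \<dots> = f (S N \<omega>) / sqrt (var_poly f N (S N \<omega>))"
      using n by (simp add: var_poly_eq[OF N] t_def)
    finally show ?thesis by (simp add: Z_def standardized_invariant_def S_def)
  qed
  have ev2: "\<forall>\<^sub>F N :: nat in sequentially. N \<ge> 2" by (rule eventually_ge_at_top)
  have fS [measurable]: "(\<lambda>\<omega>. g (S N \<omega>)) \<in> borel_measurable M"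
    if "N \<ge> 2" "real_polynomial_function g" for N and g :: "'p upper rvec \<Rightarrow> real"
    by (rule measurable_compose[OF S_measurable real_polynomial_borel_measurable]) fact+
  have D_meas: "D N \<in> borel_measurable M" if "N \<ge> 2" for N
    unfolding D_def[abs_def] using fS[OF that f] by measurable
  have h_meas: "(\<lambda>\<omega>. h (S N \<omega>, t N)) \<in> borel_measurable M" if "N \<ge> 2" for N
    unfolding h_def snd_conv
    by (rule measurable_compose[OF fS[OF that real_polynomial_slice[OF V, of "t N"]], of "\<lambda>y. sqrt (v * (1 + t N) / y)"]) measurable
  have U_meas: "U N \<in> borel_measurable M" for N
  proof -
    have "(\<lambda>\<omega>. quad G (X k \<omega>)) \<in> borel_measurable M" if "k \<in> {1..N}" for k
      by (rule measurable_compose[OF X_measurable quad_measurable]) (use that in auto)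
    then show ?thesis unfolding U_def[abs_def] by (intro borel_measurable_divide borel_measurable_sum) auto
  qed
  have h1: "h (u0, 0) = 1" using v by (simp add: h_def V_v)
  have "isCont h (u0, 0)"
    unfolding h_def
  proof (intro continuous_intros)
    show "isCont V (u0, 0)" by (rule continuous_real_polymonial_function[OF V])
    show "V (u0, 0) \<noteq> 0" using v V_v by simp
  qed
  then have "tends_0_prob (\<lambda>N \<omega>. h (S N \<omega>, t N) - h (u0, 0))"
    using S_tends
    by (intro tends_0_prob_continuous) (auto simp: t_def tends_inverse_n intro!: eventually_mono[OF ev2] S_measurable)
  then have hC: "tends_0_prob (\<lambda>N \<omega>. h (S N \<omega>, t N) - 1)" by (simp add: h1)
  have Nn: "(\<lambda>N. (real N - 1) / real N) \<longlonglongrightarrow> 1" by real_asymp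
  \<comment> \<open>The second moments of \<open>D\<close> converge, hence are eventually bounded,
    and h - 1 tends to 0 in probability, so exchanging the normalisations does not affect the
    limit.\<close>
  have DhC: "tends_0_prob (\<lambda>N \<omega>. D N \<omega> * (h (S N \<omega>, t N) - 1))"
  proof -
    obtain Q :: "'p pt \<Rightarrow> real" where Q: "real_polynomial_function Q"
      and i2: "\<And>N. N \<ge> 2 \<Longrightarrow> integrable M (\<lambda>\<omega>. (f (S N \<omega>))\<^sup>2)"
      and E: "\<And>N. N \<ge> 2 \<Longrightarrow> expectation (\<lambda>\<omega>. (f (S N \<omega>))\<^sup>2) = (1 / (real N - 1)) * Q (u0, 1 / (real N - 1))"
      using sample_cov_second_moment[OF f assms(3)] by blast
    have ED: "expectation (\<lambda>\<omega>. (D N \<omega>)\<^sup>2) = (real N - 1) / real N * Q (u0, 1 / (real N - 1)) / v" if "N \<ge> 2" for N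
    proof -
      have "expectation (\<lambda>\<omega>. (D N \<omega>)\<^sup>2) = ((real N - 1) / sqrt (real N * v))\<^sup>2 * expectation (\<lambda>\<omega>. (f (S N \<omega>))\<^sup>2)"
        unfolding D_def power_mult_distrib by (rule integral_mult_right_zero)
      then show ?thesis
        using that v by (simp add: E power_divide) (simp add: power2_eq_square)
    qed
    have "(\<lambda>N. (real N - 1) / real N * Q (u0, 1 / (real N - 1)) / v) \<longlonglongrightarrow> 1 * Q (u0, 0) / v"
      by (intro tendsto_mult tendsto_divide tendsto_const Nn poly_tends Q) (use v in simp)
    then have "\<forall>\<^sub>F N in sequentially. (real N - 1) / real N * Q (u0, 1 / (real N - 1)) / v < Q (u0, 0) / v + 1"
      by (rule order_tendstoD(2)) simp
    with ev2 have bd: "\<forall>\<^sub>F N in sequentially. integrable M (\<lambda>\<omega>. (D N \<omega>)\<^sup>2) \<and> expectation (\<lambda>\<omega>. (D N \<omega>)\<^sup>2) \<le> Q (u0, 0) / v + 1"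
    proof eventually_elim
      case (elim N)
      then have "integrable M (\<lambda>\<omega>. (D N \<omega>)\<^sup>2)"
        unfolding D_def power_mult_distrib by (intro integrable_mult_right i2)
      then show ?case using elim by (simp add: ED)
    qed
    have m: "\<forall>\<^sub>F N in sequentially. D N \<in> borel_measurable M \<and> (\<lambda>\<omega>. h (S N \<omega>, t N) - 1) \<in> borel_measurable M"
      using ev2 by eventually_elim (intro conjI D_meas borel_measurable_diff h_meas; simp)
    show ?thesis by (rule tends_0_prob_mult_bounded[OF hC m bd])
  qed
  \<comment> \<open>\<open>r\<close> is \<open>f\<close> minus its linearisation at \<open>\<Psi>\<close>; \<open>L N\<close> is the part of \<open>(N - 1) (G \<bullet> S)\<close> that comes from the sample mean.\<close>
  define r where "r u = f u - (G \<bullet> u - G \<bullet> u0)" for u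
  define L where "L N \<omega> = G \<bullet> upper_entries ((1 / 1) *\<^sub>R scatter {1..N} (\<lambda>k l. 1 / real N) (\<lambda>k. X k \<omega> - \<mu>))" for N \<omega>
  have r: "real_polynomial_function r"
    unfolding r_def by (intro real_polynomial_function_diff f real_polynomial_inner rpf_const)
  \<comment> \<open>\<open>scatter_decomposition\<close> gives (N - 1) (G \<bullet> S) as the sum of
    the \<open>quad\<close> terms plus N (G \<bullet> \<Psi>) minus \<open>L N\<close>; subtracting
    (N - 1) (G \<bullet> \<Psi>) leaves one G \<bullet> \<Psi>, the mean of
    \<open>L N\<close>.\<close>
  have DU: "D N \<omega> - U N \<omega> = (real N - 1) / sqrt (real N * v) * r (S N \<omega>) + (- 1 / sqrt (real N * v)) * (L N \<omega> - G \<bullet> u0)"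
    if N: "N \<ge> 2" for N \<omega>
  proof -
    let ?P = "\<lambda>k l. (if k = l then 1 else 0) - 1 / real N"
    let ?y = "\<lambda>k. X k \<omega> - \<mu>"
    have "(real N - 1) * (G \<bullet> S N \<omega>) = G \<bullet> upper_entries (scatter {1..N} ?P ?y)"
      unfolding S_def using N
      by (subst sample_cov_eq_scatter[of _ _ \<mu>]) (auto simp: linear_scale[OF linear_upper_entries])
    also have "\<dots> = (\<Sum>k = 1..N. G \<bullet> upper_entries (scatter {k} (\<lambda>k l. 1) ?y)) - L N \<omega>"
      unfolding scatter_decomposition L_def
      by (simp add: linear_diff[OF linear_upper_entries] linear_sum[OF linear_upper_entries] inner_diff_right inner_sum_right)
    also have "(\<Sum>k = 1..N. G \<bullet> upper_entries (scatter {k} (\<lambda>k l. 1) ?y)) = (\<Sum>k = 1..N. quad G (X k \<omega>)) + real N * (G \<bullet> u0)"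
      using quad_eq_scatter[of G "\<lambda>k. X k \<omega>"] by (simp add: sum_subtractf)
    finally have "(real N - 1) * f (S N \<omega>) - (\<Sum>k = 1..N. quad G (X k \<omega>)) = (real N - 1) * r (S N \<omega>) - (L N \<omega> - G \<bullet> u0)"
      by (simp add: r_def algebra_simps)
    moreover have "n / s * y - q / s = n / s * y' + (- 1 / s) * (l - c)" if "n * y - q = n * y' - (l - c)"
      for n s y q y' l c :: real
    proof -
      have "n / s * y - q / s = (n * y - q) / s" by (simp add: diff_divide_distrib)
      also have "\<dots> = n / s * y' + (- 1 / s) * (l - c)" unfolding that by (simp add: diff_divide_distrib)
      finally show ?thesis .
    qed
    ultimately show ?thesis unfolding D_def U_def by blast
  qed
  \<comment> \<open>The squared scale (N - 1)^2 / (N v) times t stays bounded, so the second moment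
    tends to Q(\<Psi>, 0) / v, which is 0 because \<open>r\<close> has gradient 0 at \<Psi>.\<close>
  have t1: "tends_0_prob (\<lambda>N \<omega>. (real N - 1) / sqrt (real N * v) * r (S N \<omega>))"
  proof -
    have r0: "r u0 = 0" using assms(3) by (simp add: r_def)
    obtain Q :: "'p pt \<Rightarrow> real" where Q: "real_polynomial_function Q"
      and i2: "\<And>N. N \<ge> 2 \<Longrightarrow> integrable M (\<lambda>\<omega>. (r (S N \<omega>))\<^sup>2)"
      and E: "\<And>N. N \<ge> 2 \<Longrightarrow> expectation (\<lambda>\<omega>. (r (S N \<omega>))\<^sup>2) = (1 / (real N - 1)) * Q (u0, 1 / (real N - 1))"
      and Q0: "\<And>G. GDERIV r u0 :> G \<Longrightarrow> Q (u0, 0) = asym_var \<Psi> G"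
      using sample_cov_second_moment[OF r r0] by blast
    have "GDERIV r u0 :> 0"
    proof -
      have "(f has_derivative (\<lambda>k. k \<bullet> G)) (at u0)" using assms(4) by (simp add: gderiv_def)
      then have "(r has_derivative (\<lambda>k. k \<bullet> G - (G \<bullet> k - 0))) (at u0)"
        unfolding r_def by (intro has_derivative_diff has_derivative_inner_right has_derivative_ident has_derivative_const)
      then show ?thesis by (simp add: gderiv_def inner_commute)
    qed
    then have Q00: "Q (u0, 0) = 0" using Q0 by (simp add: asym_var_def)
    show ?thesis
    proof (rule tends_0_prob_second_moment)
      show "\<forall>\<^sub>F N in sequentially. (\<lambda>\<omega>. (real N - 1) / sqrt (real N * v) * r (S N \<omega>)) \<in> borel_measurable M
          \<and> integrable M (\<lambda>\<omega>. ((real N - 1) / sqrt (real N * v) * r (S N \<omega>))\<^sup>2)"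
        using ev2
      proof eventually_elim
        case (elim N)
        show ?case
          unfolding power_mult_distrib
          by (intro conjI borel_measurable_times borel_measurable_const fS[OF elim r] integrable_mult_right i2[OF elim])
      qed
      have "(\<lambda>N. (real N - 1) / real N * Q (u0, 1 / (real N - 1)) / v) \<longlonglongrightarrow> 1 * Q (u0, 0) / v"
        by (intro tendsto_mult tendsto_divide tendsto_const Nn poly_tends Q) (use v in simp)
      then have "(\<lambda>N. (real N - 1) / real N * Q (u0, 1 / (real N - 1)) / v) \<longlonglongrightarrow> 0" by (simp add: Q00)
      moreover have "\<forall>\<^sub>F N in sequentially. (real N - 1) / real N * Q (u0, 1 / (real N - 1)) / v
          = expectation (\<lambda>\<omega>. ((real N - 1) / sqrt (real N * v) * r (S N \<omega>))\<^sup>2)"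
        using ev2
      proof eventually_elim
        case (elim N)
        have "expectation (\<lambda>\<omega>. ((real N - 1) / sqrt (real N * v) * r (S N \<omega>))\<^sup>2)
          = ((real N - 1) / sqrt (real N * v))\<^sup>2 * expectation (\<lambda>\<omega>. (r (S N \<omega>))\<^sup>2)"
          unfolding power_mult_distrib by (rule integral_mult_right_zero)
        then show ?case
          using elim v by (simp add: E power_divide) (simp add: power2_eq_square)
      qed
      ultimately show "(\<lambda>N. expectation (\<lambda>\<omega>. ((real N - 1) / sqrt (real N * v) * r (S N \<omega>))\<^sup>2)) \<longlonglongrightarrow> 0"
        by (rule Lim_transform_eventually)
    qed
  qed
  \<comment> \<open>The averaging projection has rank 1 for every N, so the variance of
    \<open>L N\<close> is \<open>v\<close> independently of N, and the factor 1 / sqrt(N v) sends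
    this term to 0.\<close>
  have Lmom: "integrable M (\<lambda>\<omega>. (L N \<omega> - G \<bullet> u0)\<^sup>2)" "(\<lambda>\<omega>. L N \<omega> - G \<bullet> u0) \<in> borel_measurable M"
    "expectation (\<lambda>\<omega>. (L N \<omega> - G \<bullet> u0)\<^sup>2) = v" if "N \<ge> 2" for N
  proof -
    have kp: "projection_kernel {1..N} (\<lambda>k l. 1 / real N) 1" by (rule projection_kernel_mean) (use that in simp)
    interpret K: projection_kernel "{1..N}" "\<lambda>k l. 1 / real N" 1 by (rule kp)
    interpret PM: prob_space "PiM {1..N} (\<lambda>_. multi_normal \<mu> \<Psi>)" by (rule K.prob_space_PiM_multi_normal[OF pd])
    have sub: "{1..N} \<subseteq> {1..}" by auto
    note lm = K.linear_moments[OF pd, of \<mu> G]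
    have i: "integrable (PiM {1..N} (\<lambda>_. multi_normal \<mu> \<Psi>)) (\<lambda>x. (G \<bullet> upper_entries ((1 / 1) *\<^sub>R scatter {1..N} (\<lambda>k l. 1 / real N) (\<lambda>k. x k - \<mu>)) - G \<bullet> u0)\<^sup>2)"
      unfolding power2_diff
      by (intro Bochner_Integration.integrable_add Bochner_Integration.integrable_diff integrable_mult_left integrable_mult_right lm PM.integrable_const)
    have iL: "integrable M (L N)"
      unfolding L_def[abs_def] by (rule integrable_scatter[where g = "\<lambda>A. G \<bullet> upper_entries A", OF kp sub lm(1)])
    show "integrable M (\<lambda>\<omega>. (L N \<omega> - G \<bullet> u0)\<^sup>2)"
      unfolding L_def by (rule integrable_scatter[where g = "\<lambda>A. (G \<bullet> upper_entries A - G \<bullet> u0)\<^sup>2", OF kp sub i])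
    show "(\<lambda>\<omega>. L N \<omega> - G \<bullet> u0) \<in> borel_measurable M"
      using borel_measurable_integrable[OF iL] by measurable
    show "expectation (\<lambda>\<omega>. (L N \<omega> - G \<bullet> u0)\<^sup>2) = v"
      unfolding L_def expectation_scatter[where g = "\<lambda>A. (G \<bullet> upper_entries A - G \<bullet> u0)\<^sup>2", OF kp sub i]
      using lm(4) unfolding lm(3) by (simp add: v_def)
  qed
  have t2: "tends_0_prob (\<lambda>N \<omega>. (- 1 / sqrt (real N * v)) * (L N \<omega> - G \<bullet> u0))"
  proof (rule tends_0_prob_second_moment)
    show "\<forall>\<^sub>F N in sequentially. (\<lambda>\<omega>. (- 1 / sqrt (real N * v)) * (L N \<omega> - G \<bullet> u0)) \<in> borel_measurable M
        \<and> integrable M (\<lambda>\<omega>. ((- 1 / sqrt (real N * v)) * (L N \<omega> - G \<bullet> u0))\<^sup>2)"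
      using ev2
    proof eventually_elim
      case (elim N)
      show ?case
        unfolding power_mult_distrib
        by (intro conjI borel_measurable_times borel_measurable_const Lmom[OF elim] integrable_mult_right)
    qed
    have "(\<lambda>N. 1 / real N) \<longlonglongrightarrow> 0" by real_asymp
    moreover have "\<forall>\<^sub>F N in sequentially. 1 / real N = expectation (\<lambda>\<omega>. ((- 1 / sqrt (real N * v)) * (L N \<omega> - G \<bullet> u0))\<^sup>2)"
      using ev2
    proof eventually_elim
      case (elim N)
      have "expectation (\<lambda>\<omega>. ((- 1 / sqrt (real N * v)) * (L N \<omega> - G \<bullet> u0))\<^sup>2)
        = (- 1 / sqrt (real N * v))\<^sup>2 * expectation (\<lambda>\<omega>. (L N \<omega> - G \<bullet> u0)\<^sup>2)"
        by (simp only: power_mult_distrib integral_mult_right_zero)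
      then show ?case using elim v by (simp add: Lmom power_divide)
    qed
    ultimately show "(\<lambda>N. expectation (\<lambda>\<omega>. ((- 1 / sqrt (real N * v)) * (L N \<omega> - G \<bullet> u0))\<^sup>2)) \<longlonglongrightarrow> 0"
      by (rule Lim_transform_eventually)
  qed
  have DUm: "\<forall>\<^sub>F N in sequentially. (\<lambda>\<omega>. (real N - 1) / sqrt (real N * v) * r (S N \<omega>)) \<in> borel_measurable M
      \<and> (\<lambda>\<omega>. (- 1 / sqrt (real N * v)) * (L N \<omega> - G \<bullet> u0)) \<in> borel_measurable M"
    using ev2
  proof eventually_elim
    case (elim N)
    show ?case
      by (intro conjI borel_measurable_times borel_measurable_const fS[OF elim r] Lmom[OF elim])
  qed
  define W where "W N \<omega> = (real N - 1) / sqrt (real N * v) * r (S N \<omega>) + (- 1 / sqrt (real N * v)) * (L N \<omega> - G \<bullet> u0)" for N \<omega>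
  have tW: "tends_0_prob W"
    unfolding W_def[abs_def] by (rule tends_0_prob_add[OF t1 t2 DUm])
  define W' where "W' N \<omega> = W N \<omega> + D N \<omega> * (h (S N \<omega>, t N) - 1)" for N \<omega>
  have tW': "tends_0_prob W'"
    unfolding W'_def[abs_def]
  proof (rule tends_0_prob_add[OF tW DhC])
    show "\<forall>\<^sub>F N in sequentially. W N \<in> borel_measurable M \<and> (\<lambda>\<omega>. D N \<omega> * (h (S N \<omega>, t N) - 1)) \<in> borel_measurable M"
      using DUm ev2
    proof eventually_elim
      case (elim N)
      have "W N \<in> borel_measurable M"
        unfolding W_def[abs_def] using elim(1) by (intro borel_measurable_add) simp_all
      moreover have "(\<lambda>\<omega>. D N \<omega> * (h (S N \<omega>, t N) - 1)) \<in> borel_measurable M"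
        using elim(2) by (intro borel_measurable_times borel_measurable_diff borel_measurable_const D_meas h_meas)
      ultimately show ?case ..
    qed
  qed
  have ZU: "Z N \<omega> - U N \<omega> = W' N \<omega>" if "N \<ge> 2" for N \<omega>
    using DU[OF that, of \<omega>] by (simp add: W'_def W_def ZDC[OF that] algebra_simps)
  have tZU: "tends_0_prob (\<lambda>N \<omega>. Z N \<omega> - U N \<omega>)"
    unfolding tends_0_prob_def
  proof (intro allI impI)
    fix e :: real assume "e > 0"
    with tW' have "(\<lambda>N. prob {\<omega> \<in> space M. \<bar>W' N \<omega>\<bar> > e}) \<longlonglongrightarrow> 0" by (rule tends_0_probD)
    \<comment> \<open>The exact identities start at N = 2, so the limit is carried over along
      eventual equality.\<close>
    moreover have "\<forall>\<^sub>F N in sequentially. prob {\<omega> \<in> space M. \<bar>W' N \<omega>\<bar> > e} = prob {\<omega> \<in> space M. \<bar>Z N \<omega> - U N \<omega>\<bar> > e}"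
      using ev2 by eventually_elim (simp add: ZU)
    ultimately show "(\<lambda>N. prob {\<omega> \<in> space M. \<bar>Z N \<omega> - U N \<omega>\<bar> > e}) \<longlonglongrightarrow> 0"
      by (rule Lim_transform_eventually)
  qed
  have "weak_conv_m (\<lambda>N. distr M borel (Z N)) std_normal_distribution"
  proof (rule slutsky_std_normal[OF _ _ tZU])
    show "weak_conv_m (\<lambda>N. distr M borel (U N)) std_normal_distribution"
      using quad_clt[OF assms(5)] unfolding U_def[abs_def] v_def .
    show "\<forall>\<^sub>F N in sequentially. U N \<in> borel_measurable M \<and> Z N \<in> borel_measurable M"
      using ev2
    proof eventually_elim
      case (elim N)
      have "Z N = (\<lambda>\<omega>. D N \<omega> * h (S N \<omega>, t N))" using ZDC[OF elim] by auto
      then show ?case using U_meas D_meas[OF elim] h_meas[OF elim] by simp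
    qed
  qed
  then show ?thesis unfolding Z_def .
qed

end
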